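(* Let $\Omega,\Lambda,\phi,\mathcal{D},\Delta t$ be as in the context, and let $u^{in}\in L^2(\Omega)$ be a non-negative function such that $\int_\Omega u^{in}=M>0$. Then there exists at least one positive solution $(\underline{u}_{\mathcal{D}}^n\in\underline{V}_{\mathcal{D}})_{n\geq 1}$ to the nonlinear scheme: for all $n\ge 1$, $$\frac{1}{\Delta t}(u^n_{\mathcal{M}}-u^{n-1}_{\mathcal{M}},v_{\mathcal{M}})_\Omega+T_{\mathcal{D}}\big(\underline{u}^n_{\mathcal{D}},\underline{w}_{\mathcal{D}}(\underline{u}^n_{\mathcal{D}}),\underline{v}_{\mathcal{D}}\big)=0\quad\forall \underline{v}_{\mathcal{D}}\in\underline{V}_{\mathcal{D}},\qquad u^0_K=\frac{1}{|K|}\int_K u^{in}\quad\forall K\in\mathcal{M}.$$ Moreover, there exists $\varepsilon>0$, depending on $\Lambda,\phi,u^{in},M,\Omega,d,\Delta t$ and $\mathcal{D}$ (and not on $n$), such that $$\forall n\geq 1,\qquad u^n_K\geq\varepsilon\quad\forall K\in\mathcal{M}\qquad\text{and}\qquad u^n_\sigma\geq\varepsilon\quad\forall\sigma\in\mathcal{E}.$$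
   Context: **Data.** $\Omega\subset\mathbb{R}^d$, $d\in\{2,3\}$, is open, bounded, connected and polytopal. $\Lambda\in L^\infty(\Omega;\mathbb{R}^{d\times d})$ is symmetric with, for some $0<\lambda_\flat\le\lambda_\sharp<\infty$, $\xi\cdot\Lambda(x)\xi\ge\lambda_\flat|\xi|^2$ and $|\Lambda(x)\xi|\le\lambda_\sharp|\xi|$ for a.e. $x\in\Omega$ and all $\xi\in\mathbb{R}^d$. $\phi\in C^1(\overline\Omega)$, with $\Lambda\nabla\phi\in H(\mathrm{div};\Omega)$, and $\omega:=e^{-\phi}$. $\Delta t>0$ is a fixed time step. (The scheme discretises $\partial_t u-\mathrm{div}(\Lambda(\nabla u+u\nabla\phi))=0$ with homogeneous pure Neumann boundary conditions and initial datum $u^{in}$.) **Discretisation.** A discretisation of $\Omega$ is a triplet $\mathcal{D}=(\mathcal{M},\mathcal{E},\mathcal{P})$. $\mathcal{M}$ is a finite family of nonempty disjoint open connected polytopal subsets $K$ of $\Omega$ (cells) with $|K|>0$ and $\overline\Omega=\bigcup_K\overline K$. $\mathcal{E}$ is a finite family of nonempty disjoint (relatively open) connected subsets $\sigma$ of $\overline\Omega$ (faces), each of positive $(d-1)$-dimensional measure $|\sigma|$ and contained in an affine hyperplane $\mathcal{H}_\sigma$, with $\bigcup_K\partial K=\bigcup_\sigma\overline\sigma$; for each $K$ there is $\mathcal{E}_K\subset\mathcal{E}$ with $\partial K=\bigcup_{\sigma\in\mathcal{E}_K}\overline\sigma$. With $\mathcal{M}_\sigma=\{K:\sigma\in\mathcal{E}_K\}$,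 each $\sigma$ is either a boundary face ($\mathcal{M}_\sigma=\{K\}$, $\sigma\subset\partial\Omega$) or an interface ($\mathcal{M}_\sigma=\{K,L\}$). $\mathcal{P}=\{x_K\}_{K\in\mathcal{M}}$ with $x_K\in K$, $K$ star-shaped with respect to $x_K$, and the distance $d_{K,\sigma}$ from $x_K$ to $\mathcal{H}_\sigma$ positive for all $\sigma\in\mathcal{E}_K$. $\overline{x}_\sigma$ is the barycentre of $\sigma$, $n_{K,\sigma}$ the unit normal to $\sigma$ outward to $K$, and $P_{K,\sigma}$ the open pyramid with base $\sigma$ and apex $x_K$. **Unknowns.** $\underline{V}_{\mathcal{D}}$ is the space of real vectors $\underline{v}_{\mathcal{D}}=((v_K)_{K\in\mathcal{M}},(v_\sigma)_{\sigma\in\mathcal{E}})$; $\underline{v}_K=(v_K,(v_\sigma)_{\sigma\in\mathcal{E}_K})$ is its restriction to $K$; $v_{\mathcal{M}}$ is the piecewise constant function equal to $v_K$ on $K$; $(\cdot,\cdot)_\Omega$ is the $L^2(\Omega)$ inner product. A vector is positive if all its coordinates are positive. $\underline{\omega}_{\mathcal{D}}\in\underline{V}_{\mathcal{D}}$ is given by $\omega_K=\frac1{|K|}\int_K\omega$, $\omega_\sigma=\frac1{|\sigma|}\int_\sigma\omega$; $\underline{u}^\infty_{\mathcal{D}}:=\frac{M}{\int_\Omega\omega}\,\underline{\omega}_{\mathcal{D}}$. **Discrete gradient and bilinear form.** With a fixed parameter $\eta>0$, $\nabla_K\underline v_K$ is the piecewise constant field equal on $P_{K,\sigma}$ to $\nabla_{K,\sigma}\underline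 v_K=G_K\underline v_K+\frac{\eta}{d_{K,\sigma}}\big(v_\sigma-v_K-G_K\underline v_K\cdot(\overline x_\sigma-x_K)\big)n_{K,\sigma}$, where $G_K\underline v_K=\frac1{|K|}\sum_{\sigma'\in\mathcal{E}_K}|\sigma'|(v_{\sigma'}-v_K)n_{K,\sigma'}$. Set $a^\Lambda_K(\underline u_K,\underline v_K)=\int_K\Lambda\nabla_K\underline u_K\cdot\nabla_K\underline v_K$. **Nonlinear operator.** For positive $\underline u_{\mathcal{D}}$, $\underline w_{\mathcal{D}}(\underline u_{\mathcal{D}})$ is the vector with coordinates $w_K=\log(u_K/u_K^\infty)$, $w_\sigma=\log(u_\sigma/u_\sigma^\infty)$, and $$T_{\mathcal{D}}(\underline u_{\mathcal{D}},\underline w_{\mathcal{D}},\underline v_{\mathcal{D}})=\sum_{K\in\mathcal{M}}r_K(\underline u_K)\,a_K^\Lambda(\underline w_K,\underline v_K),\qquad r_K(\underline u_K)=f_{|\mathcal{E}_K|}\big((m(u_K,u_\sigma))_{\sigma\in\mathcal{E}_K}\big).$$ Here $f_k(x_1,\dots,x_k)$ is either $\frac1k\sum_i x_i$ or $\max(x_1,\dots,x_k)$, and $m:(0,\infty)^2\to(0,\infty)$ is a fixed function that is non-decreasing in both variables, satisfies $m(x,x)=x$, $m(x,y)=m(y,x)$, $m(\lambda x,\lambda y)=\lambda m(x,y)$ for all $\lambda,x,y>0$, and $\frac{y-x}{\log y-\log x}\le m(x,y)\le\max(x,y)$ for all $x\ne y$. *)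

theory Defs
  imports "HOL-Analysis.Analysis"
begin

section \<open>Function spaces\<close>

definition L2_on :: "(real^'d) set \<Rightarrow> (real^'d \<Rightarrow> 'b::euclidean_space) \<Rightarrow> bool" where
  "L2_on \<Omega> f \<longleftrightarrow> f \<in> borel_measurable (lebesgue_on \<Omega>)
     \<and> integrable (lebesgue_on \<Omega>) (\<lambda>x. (norm (f x))\<^sup>2)"

definition Linf_on :: "(real^'d) set \<Rightarrow> (real^'d \<Rightarrow> 'b::euclidean_space) \<Rightarrow> bool" where
  "Linf_on \<Omega> f \<longleftrightarrow> f \<in> borel_measurable (lebesgue_on \<Omega>)
     \<and> (\<exists>C. AE x in lebesgue_on \<Omega>. norm (f x) \<le> C)"

definition gradient :: "(real^'d \<Rightarrow> real) \<Rightarrow> real^'d \<Rightarrow> real^'d" where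
  "gradient f x = (THE g. GDERIV f x :> g)"

definition C1_closure :: "(real^'d) set \<Rightarrow> (real^'d \<Rightarrow> real) \<Rightarrow> bool" where
  "C1_closure \<Omega> f \<longleftrightarrow> continuous_on (closure \<Omega>) f \<and> (\<forall>x\<in>\<Omega>. f differentiable (at x))
     \<and> (\<exists>g. continuous_on (closure \<Omega>) g \<and> (\<forall>x\<in>\<Omega>. g x = gradient f x))"

primrec Ck :: "nat \<Rightarrow> (real^'d \<Rightarrow> real) \<Rightarrow> bool" where
  "Ck 0 f \<longleftrightarrow> continuous_on UNIV f"
| "Ck (Suc k) f \<longleftrightarrow> (\<forall>x. f differentiable (at x))
     \<and> (\<forall>i. Ck k (\<lambda>x. frechet_derivative f (at x) (axis i 1)))"

text \<open>The space of smooth functions with compact support in \<open>\<Omega>\<close>, extended by zero.\<close>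

definition test_function :: "(real^'d) set \<Rightarrow> (real^'d \<Rightarrow> real) \<Rightarrow> bool" where
  "test_function \<Omega> \<psi> \<longleftrightarrow> (\<forall>k. Ck k \<psi>)
     \<and> compact (closure {x. \<psi> x \<noteq> 0}) \<and> closure {x. \<psi> x \<noteq> 0} \<subseteq> \<Omega>"

definition Hdiv_on :: "(real^'d) set \<Rightarrow> (real^'d \<Rightarrow> real^'d) \<Rightarrow> bool" where
  "Hdiv_on \<Omega> F \<longleftrightarrow> L2_on \<Omega> F
     \<and> (\<exists>g::real^'d \<Rightarrow> real. L2_on \<Omega> g \<and> (\<forall>\<psi>. test_function \<Omega> \<psi> \<longrightarrow>
          (\<integral>x. F x \<bullet> gradient \<psi> x \<partial>lebesgue_on \<Omega>) = - (\<integral>x. g x * \<psi> x \<partial>lebesgue_on \<Omega>)))"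


section \<open>Polytopal discretisations\<close>

text \<open>The library notion \<^const>\<open>polytope\<close> is convex and closed; domains and cells are
  open and need not be convex.\<close>

definition polytopal :: "(real^'d) set \<Rightarrow> bool" where
  "polytopal S \<longleftrightarrow> (\<exists>F. finite F \<and> (\<forall>P\<in>F. polytope P) \<and> S = interior (\<Union>F))"

text \<open>The \<open>(d-1)\<close>-dimensional Lebesgue measure on an affine hyperplane \<open>H\<close>: the \<open>d\<close>-dimensional
  Lebesgue measure of the slab of thickness one around \<open>H\<close>, pushed forward by the orthogonal
  projection onto \<open>H\<close>.  (By Fubini, a set \<open>A \<subseteq> H\<close> gets the volume of the right cylinder
  with base \<open>A\<close> and height one.)\<close>

definition hyperplane_measure :: "(real^'d) set \<Rightarrow> (real^'d) measure" where
  "hyperplane_measure H =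
     distr (restrict_space lborel {x. infdist x H \<le> 1/2}) borel (closest_point H)"

text \<open>A face is relatively open and nonempty in its hyperplane, so that the hyperplane is the affine
  hull of the face.\<close>

definition face_measure :: "(real^'d) set \<Rightarrow> (real^'d) measure" where
  "face_measure \<sigma> = hyperplane_measure (affine hull \<sigma>)"

definition face_area :: "(real^'d) set \<Rightarrow> real" where
  "face_area \<sigma> = measure (face_measure \<sigma>) \<sigma>"

definition face_average :: "(real^'d) set \<Rightarrow> (real^'d \<Rightarrow> 'b::euclidean_space) \<Rightarrow> 'b" where
  "face_average \<sigma> f = (1 / face_area \<sigma>) *\<^sub>R set_lebesgue_integral (face_measure \<sigma>) \<sigma> f"

definition vol :: "(real^'d) set \<Rightarrow> real" where
  "vol K = measure lebesgue K"

definition cell_average :: "(real^'d) set \<Rightarrow> (real^'d \<Rightarrow> real) \<Rightarrow> real" where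
  "cell_average K f = (1 / vol K) * (\<integral>x. f x \<partial>lebesgue_on K)"

definition star_shaped_wrt :: "(real^'d) set \<Rightarrow> real^'d \<Rightarrow> bool" where
  "star_shaped_wrt K z \<longleftrightarrow> z \<in> K \<and> (\<forall>y\<in>K. closed_segment z y \<subseteq> K)"

record ('d::finite) discr =
  cells :: "(real^'d) set set"
  faces :: "(real^'d) set set"
  cell_faces :: "(real^'d) set \<Rightarrow> (real^'d) set set"
  pt :: "(real^'d) set \<Rightarrow> real^'d"

definition face_cells :: "('d::finite) discr \<Rightarrow> (real^'d) set \<Rightarrow> (real^'d) set set" where
  "face_cells D \<sigma> = {K \<in> cells D. \<sigma> \<in> cell_faces D K}"

definition pt_face_dist :: "('d::finite) discr \<Rightarrow> (real^'d) set \<Rightarrow> (real^'d) set \<Rightarrow> real" where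
  "pt_face_dist D K \<sigma> = infdist (pt D K) (affine hull \<sigma>)"

definition discretisation :: "(real^'d) set \<Rightarrow> ('d::finite) discr \<Rightarrow> bool" where
  "discretisation \<Omega> D \<longleftrightarrow>
     finite (cells D)
   \<and> (\<forall>K\<in>cells D. K \<noteq> {} \<and> open K \<and> connected K \<and> polytopal K \<and> K \<subseteq> \<Omega> \<and> 0 < vol K)
   \<and> pairwise disjnt (cells D)
   \<and> closure \<Omega> = (\<Union>K\<in>cells D. closure K)
   \<and> finite (faces D)
   \<and> (\<forall>\<sigma>\<in>faces D. \<sigma> \<noteq> {} \<and> connected \<sigma> \<and> \<sigma> \<subseteq> closure \<Omega>
        \<and> (\<exists>a b. a \<noteq> 0 \<and> affine hull \<sigma> = {x. a \<bullet> x = b})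
        \<and> openin (top_of_set (affine hull \<sigma>)) \<sigma>
        \<and> 0 < face_area \<sigma>)
   \<and> pairwise disjnt (faces D)
   \<and> (\<Union>K\<in>cells D. frontier K) = (\<Union>\<sigma>\<in>faces D. closure \<sigma>)
   \<and> (\<forall>K\<in>cells D. cell_faces D K \<subseteq> faces D
        \<and> frontier K = (\<Union>\<sigma>\<in>cell_faces D K. closure \<sigma>))
   \<and> (\<forall>\<sigma>\<in>faces D. (\<exists>K. face_cells D \<sigma> = {K} \<and> \<sigma> \<subseteq> frontier \<Omega>)
        \<or> (\<exists>K L. K \<noteq> L \<and> face_cells D \<sigma> = {K, L}))
   \<and> (\<forall>K\<in>cells D. star_shaped_wrt K (pt D K)
        \<and> (\<forall>\<sigma>\<in>cell_faces D K. 0 < pt_face_dist D K \<sigma>))"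

definition barycentre :: "(real^'d) set \<Rightarrow> real^'d" where
  "barycentre \<sigma> = face_average \<sigma> (\<lambda>x. x)"

definition outward_normal :: "(real^'d) set \<Rightarrow> (real^'d) set \<Rightarrow> real^'d" where
  "outward_normal K \<sigma> = (THE n. norm n = 1
     \<and> (\<forall>x\<in>\<sigma>. \<forall>y\<in>\<sigma>. n \<bullet> (y - x) = 0)
     \<and> (\<forall>y\<in>\<sigma>. \<exists>e>0. \<forall>t\<in>{0<..<e}. y - t *\<^sub>R n \<in> K \<and> y + t *\<^sub>R n \<notin> K))"

definition pyramid :: "('d::finite) discr \<Rightarrow> (real^'d) set \<Rightarrow> (real^'d) set \<Rightarrow> (real^'d) set" where
  "pyramid D K \<sigma> = (\<Union>y\<in>\<sigma>. {pt D K + s *\<^sub>R (y - pt D K) | s. 0 < s \<and> s < 1})"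


section \<open>Hybrid unknowns, discrete gradient and bilinear form\<close>

text \<open>Only the values at the cells and faces of the mesh are meaningful; every notion below
  ignores the others.\<close>

record ('d::finite) hybrid =
  cval :: "(real^'d) set \<Rightarrow> real"
  fval :: "(real^'d) set \<Rightarrow> real"

definition positive_hybrid :: "('d::finite) discr \<Rightarrow> 'd hybrid \<Rightarrow> bool" where
  "positive_hybrid D v \<longleftrightarrow> (\<forall>K\<in>cells D. 0 < cval v K) \<and> (\<forall>\<sigma>\<in>faces D. 0 < fval v \<sigma>)"

definition cell_function :: "('d::finite) discr \<Rightarrow> 'd hybrid \<Rightarrow> real^'d \<Rightarrow> real" where
  "cell_function D v x = (\<Sum>K\<in>cells D. cval v K * indicator K x)"

definition GK :: "('d::finite) discr \<Rightarrow> (real^'d) set \<Rightarrow> 'd hybrid \<Rightarrow> real^'d" where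
  "GK D K v = (1 / vol K) *\<^sub>R
     (\<Sum>\<sigma>\<in>cell_faces D K. (face_area \<sigma> * (fval v \<sigma> - cval v K)) *\<^sub>R outward_normal K \<sigma>)"

definition pyramid_gradient ::
    "real \<Rightarrow> ('d::finite) discr \<Rightarrow> (real^'d) set \<Rightarrow> 'd hybrid \<Rightarrow> (real^'d) set \<Rightarrow> real^'d" where
  "pyramid_gradient \<eta> D K v \<sigma> = GK D K v
     + (\<eta> / pt_face_dist D K \<sigma>
        * (fval v \<sigma> - cval v K - GK D K v \<bullet> (barycentre \<sigma> - pt D K))) *\<^sub>R outward_normal K \<sigma>"

definition cell_gradient ::
    "real \<Rightarrow> ('d::finite) discr \<Rightarrow> (real^'d) set \<Rightarrow> 'd hybrid \<Rightarrow> real^'d \<Rightarrow> real^'d" where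
  "cell_gradient \<eta> D K v x =
     (\<Sum>\<sigma>\<in>cell_faces D K. indicator (pyramid D K \<sigma>) x *\<^sub>R pyramid_gradient \<eta> D K v \<sigma>)"

definition aK ::
    "(real^'d \<Rightarrow> real^'d^'d) \<Rightarrow> real \<Rightarrow> ('d::finite) discr \<Rightarrow> (real^'d) set
      \<Rightarrow> 'd hybrid \<Rightarrow> 'd hybrid \<Rightarrow> real" where
  "aK \<Lambda> \<eta> D K u v =
     (\<integral>x. (\<Lambda> x *v cell_gradient \<eta> D K u x) \<bullet> cell_gradient \<eta> D K v x \<partial>lebesgue_on K)"


section \<open>The nonlinear scheme\<close>

text \<open>The family \<open>f\<^sub>k\<close> is represented by a function of a finite index set \<open>I\<close> with \<open>k\<close> elements
  and a family indexed by it.\<close>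

definition f_mean :: "'i set \<Rightarrow> ('i \<Rightarrow> real) \<Rightarrow> real" where
  "f_mean I x = (1 / real (card I)) * (\<Sum>i\<in>I. x i)"

definition f_max :: "'i set \<Rightarrow> ('i \<Rightarrow> real) \<Rightarrow> real" where
  "f_max I x = Max (x ` I)"

definition admissible_m :: "(real \<Rightarrow> real \<Rightarrow> real) \<Rightarrow> bool" where
  "admissible_m m \<longleftrightarrow>
     (\<forall>x>0. \<forall>y>0. 0 < m x y)
   \<and> (\<forall>x>0. \<forall>x'>0. \<forall>y>0. x \<le> x' \<longrightarrow> m x y \<le> m x' y)
   \<and> (\<forall>x>0. \<forall>y>0. \<forall>y'>0. y \<le> y' \<longrightarrow> m x y \<le> m x y')
   \<and> (\<forall>x>0. m x x = x)
   \<and> (\<forall>x>0. \<forall>y>0. m x y = m y x)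
   \<and> (\<forall>c>0. \<forall>x>0. \<forall>y>0. m (c * x) (c * y) = c * m x y)
   \<and> (\<forall>x>0. \<forall>y>0. x \<noteq> y \<longrightarrow> (y - x) / (ln y - ln x) \<le> m x y \<and> m x y \<le> max x y)"

definition u_inf ::
    "(real^'d) set \<Rightarrow> (real^'d \<Rightarrow> real) \<Rightarrow> real \<Rightarrow> ('d::finite) hybrid" where
  "u_inf \<Omega> \<phi> M =
     (let \<omega> = (\<lambda>x. exp (- \<phi> x)); c = M / (\<integral>x. \<omega> x \<partial>lebesgue_on \<Omega>) in
      \<lparr> cval = (\<lambda>K. c * cell_average K \<omega>), fval = (\<lambda>\<sigma>. c * face_average \<sigma> \<omega>) \<rparr>)"

definition log_ratio :: "('d::finite) hybrid \<Rightarrow> 'd hybrid \<Rightarrow> 'd hybrid" where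
  "log_ratio uinf u =
     \<lparr> cval = (\<lambda>K. ln (cval u K / cval uinf K)), fval = (\<lambda>\<sigma>. ln (fval u \<sigma> / fval uinf \<sigma>)) \<rparr>"

definition rK ::
    "((real^'d) set set \<Rightarrow> ((real^'d) set \<Rightarrow> real) \<Rightarrow> real) \<Rightarrow> (real \<Rightarrow> real \<Rightarrow> real)
      \<Rightarrow> ('d::finite) discr \<Rightarrow> (real^'d) set \<Rightarrow> 'd hybrid \<Rightarrow> real" where
  "rK f m D K u = f (cell_faces D K) (\<lambda>\<sigma>. m (cval u K) (fval u \<sigma>))"

definition TD ::
    "(real^'d \<Rightarrow> real^'d^'d) \<Rightarrow> real
      \<Rightarrow> ((real^'d) set set \<Rightarrow> ((real^'d) set \<Rightarrow> real) \<Rightarrow> real) \<Rightarrow> (real \<Rightarrow> real \<Rightarrow> real)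
      \<Rightarrow> ('d::finite) discr \<Rightarrow> 'd hybrid \<Rightarrow> 'd hybrid \<Rightarrow> 'd hybrid \<Rightarrow> real" where
  "TD \<Lambda> \<eta> f m D u w v = (\<Sum>K\<in>cells D. rK f m D K u * aK \<Lambda> \<eta> D K w v)"

text \<open>The sequence starts at index 0, but only the cell values of \<open>u 0\<close> are prescribed or used.\<close>

definition positive_solution ::
    "(real^'d) set \<Rightarrow> (real^'d \<Rightarrow> real^'d^'d) \<Rightarrow> (real^'d \<Rightarrow> real) \<Rightarrow> (real^'d \<Rightarrow> real)
      \<Rightarrow> real \<Rightarrow> real \<Rightarrow> real
      \<Rightarrow> ((real^'d) set set \<Rightarrow> ((real^'d) set \<Rightarrow> real) \<Rightarrow> real) \<Rightarrow> (real \<Rightarrow> real \<Rightarrow> real)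
      \<Rightarrow> ('d::finite) discr \<Rightarrow> (nat \<Rightarrow> 'd hybrid) \<Rightarrow> bool" where
  "positive_solution \<Omega> \<Lambda> \<phi> u_in M dt \<eta> f m D u \<longleftrightarrow>
     (\<forall>K\<in>cells D. cval (u 0) K = cell_average K u_in)
   \<and> (\<forall>n\<ge>1. positive_hybrid D (u n)
        \<and> (\<forall>v. 1 / dt *
               (\<integral>x. (cell_function D (u n) x - cell_function D (u (n - 1)) x)
                     * cell_function D v x \<partial>lebesgue_on \<Omega>)
             + TD \<Lambda> \<eta> f m D (u n) (log_ratio (u_inf \<Omega> \<phi> M) (u n)) v = 0))"

end

theory Submission
  imports Defs
begin

text \<open>
  The argument works with the logarithms \<open>w = log (u / u\<^sup>\<infinity>)\<close> of the unknowns. In these variables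
  positivity is automatic, and one time step asks for a zero of a vector field on \<open>\<real>\<^sup>N\<close>, with \<open>N\<close>
  the number of cells and faces. Existence and the lower bound both come from a single a priori
  estimate (\<open>a_priori_bound\<close>): there is a radius \<open>R\<close> that depends on the data only, such that every
  \<open>w\<close> whose residual, tested with \<open>w\<close> itself, is nonpositive satisfies \<open>\<bar>w\<^sub>i\<bar> < R\<close> for all \<open>i\<close>,
  whatever the nonnegative previous state of mass \<open>M\<close>.

  The estimate is the entropy method. Testing with \<open>w\<close> produces the discrete entropy production
  \<open>\<Sum> |K| (u\<^sub>K - p\<^sub>K) w\<^sub>K / \<Delta>t\<close>, where \<open>p\<close> is the previous state, plus the dissipation
  \<open>\<Sum> r\<^sub>K(u) a\<^sub>K(w, w)\<close>. Each cell term is bounded below because \<open>p\<^sub>K \<le> M / |K|\<close>, so every cell term and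
  every dissipation term is bounded above. The cell terms bound \<open>w\<^sub>K\<close> from above. If all \<open>w\<^sub>K\<close>
  were very negative, the entropy production would be at least a large multiple of \<open>M\<close>, so at
  least one cell value is bounded below. For a face \<open>\<sigma>\<close> of \<open>K\<close> the mobility \<open>r\<^sub>K\<close> dominates a logarithmic
  mean and \<open>a\<^sub>K\<close> is coercive, so the dissipation controls
  \<open>(exp w\<^sub>\<sigma> - exp w\<^sub>K) (w\<^sub>\<sigma> - w\<^sub>K)\<close>: a lower bound at one end of the pair (cell, face) propagates to the
  other end. The mesh is connected through its faces (\<open>cells_connected\<close>), so the lower bound
  reaches every unknown.

  Existence follows because a field that points outwards on the boundary of a large cube has a zero
  (\<open>zero_of_coercive_field\<close>). Testing with the constant \<open>1\<close> shows that the mass is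
  preserved, so the step can be iterated and the same \<open>R\<close> serves at all times.

  Coercivity of \<open>a\<^sub>K\<close> (\<open>aK_coercive\<close>) rests on the geometry of star-shaped cells. The
  pyramids over the faces are disjoint open subsets of the cell, and two faces have nonparallel
  normals. The gradients on the two corresponding pyramids differ from the consistent part
  \<open>G\<^sub>K v\<close> by multiples of these normals, so together they control \<open>G\<^sub>K v\<close>, and
  then each increment \<open>v\<^sub>\<sigma> - v\<^sub>K\<close>.
\<close>

section \<open>Zeros of coercive vector fields\<close>

lemma tendsto_fun_coordinatewise:
  fixes X :: "nat \<Rightarrow> 'i \<Rightarrow> 'a::topological_space"
  assumes "\<And>i. (\<lambda>n. X n i) \<longlonglongrightarrow> x i"
  shows "X \<longlonglongrightarrow> x"
proof -
  have "limitin (product_topology (\<lambda>i. euclidean) UNIV) X x sequentially"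
    using assms by (auto simp: limitin_componentwise)
  then show ?thesis
    by (simp add: euclidean_product_topology)
qed

lemma compact_fun_cube:
  fixes a b :: "'i \<Rightarrow> real"
  shows "compact {x. \<forall>i. a i \<le> x i \<and> x i \<le> b i}"
proof -
  have "compactin (product_topology (\<lambda>i. euclidean) UNIV) (\<Pi>\<^sub>E i\<in>UNIV. {a i..b i})"
    by (subst compactin_PiE) auto
  moreover have "(\<Pi>\<^sub>E i\<in>UNIV. {a i..b i}) = {x. \<forall>i. a i \<le> x i \<and> x i \<le> b i}"
    by (auto simp: PiE_def)
  ultimately show ?thesis
    by (simp add: euclidean_product_topology)
qed

text \<open>The dimension of the discrete problem is the number of cells and faces of an arbitrary mesh, so
  it cannot be the dimension of a type and the cube lives in a space of sequences. Kuhn's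
  combinatorial lemma, applied to the signs of the components on finer and finer grids, gives
  for every \<open>k\<close> two points of a common grid cube at which the \<open>k\<close>-th component has opposite signs;
  a limit point of the cubes is a zero.\<close>

lemma poincare_miranda_nat:
  fixes G :: "(nat \<Rightarrow> real) \<Rightarrow> nat \<Rightarrow> real"
  assumes R: "0 < R"
    and cont: "\<And>k. k < n \<Longrightarrow> continuous_on UNIV (\<lambda>x. G x k)"
    and lo: "\<And>x k. k < n \<Longrightarrow> \<forall>j<n. \<bar>x j\<bar> \<le> R \<Longrightarrow> x k = - R \<Longrightarrow> G x k \<le> 0"
    and hi: "\<And>x k. k < n \<Longrightarrow> \<forall>j<n. \<bar>x j\<bar> \<le> R \<Longrightarrow> x k = R \<Longrightarrow> 0 \<le> G x k"
  obtains x where "\<forall>j<n. \<bar>x j\<bar> \<le> R" "\<forall>k<n. G x k = 0"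
proof -
  \<comment> \<open>\<open>S p q\<close> is the grid point with integer coordinates \<open>q\<close> and mesh size \<open>2 R / p\<close>. The label of \<open>q\<close>
     records the sign of a component there, except that the boundary labels are fixed as Kuhn's lemma
     requires; this is consistent with the sign conditions on the boundary.\<close>
  define S where "S p q = (\<lambda>k. if k < n then - R + 2 * R * (real (q k) / real p) else 0)"
    for p :: nat and q :: "nat \<Rightarrow> nat"
  define label where "label p q k =
      (if q k = 0 then 0 else if q k = p then 1 else if G (S p q) k \<le> 0 then 0 else 1::nat)"
    for p :: nat and q :: "nat \<Rightarrow> nat" and k
  have S_cube: "\<forall>j<n. \<bar>S p q j\<bar> \<le> R" if "0 < p" "\<forall>j<n. q j \<le> p" for p q
  proof (intro allI impI)
    fix j assume j: "j < n"
    define t where "t = real (q j) / real p"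
    have "0 \<le> t" "t \<le> 1" using that j by (auto simp: t_def)
    then have "0 \<le> R * t" "R * t \<le> R" using R by (auto simp: mult_left_le)
    then show "\<bar>S p q j\<bar> \<le> R" using j by (simp add: S_def t_def abs_le_iff)
  qed
  have l0: "G (S p q) k \<le> 0" if "0 < p" "\<forall>j<n. q j \<le> p" "k < n" "label p q k = 0" for p q k
    using that lo[OF \<open>k < n\<close> S_cube[OF that(1,2)]]
    by (auto simp: label_def S_def split: if_splits)
  have l1: "0 \<le> G (S p q) k" if "0 < p" "\<forall>j<n. q j \<le> p" "k < n" "label p q k \<noteq> 0" for p q k
    using that hi[OF \<open>k < n\<close> S_cube[OF that(1,2)]]
    by (auto simp: label_def S_def split: if_splits)
  have ex: "\<exists>q. (\<forall>i<n. q i \<le> p) \<and> (\<forall>k. \<exists>r s. k < n \<longrightarrow>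
        ((\<forall>j<n. r j \<le> p \<and> \<bar>real (r j) - real (q j)\<bar> \<le> 1) \<and> (\<forall>j<n. s j \<le> p \<and> \<bar>real (s j) - real (q j)\<bar> \<le> 1)
         \<and> label p r k = 0 \<and> label p s k \<noteq> 0))" if p: "0 < p" for p
  proof -
    obtain q where q: "\<forall>i<n. q i < p"
      "\<forall>i<n. \<exists>r s. (\<forall>j<n. q j \<le> r j \<and> r j \<le> q j + 1) \<and>
              (\<forall>j<n. q j \<le> s j \<and> s j \<le> q j + 1) \<and> label p r i \<noteq> label p s i"
      by (rule kuhn_lemma[of p n "label p", OF p]) (use p in \<open>auto simp: label_def\<close>)
    have lab: "\<And>r k. label p r k = 0 \<or> label p r k = 1" by (auto simp: label_def)
    have near: "\<forall>j<n. r j \<le> p \<and> \<bar>real (r j) - real (q j)\<bar> \<le> 1"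
      if "\<forall>j<n. q j \<le> r j \<and> r j \<le> q j + 1" for r
    proof (intro allI impI)
      fix j assume "j < n"
      then have "q j \<le> r j" "r j \<le> q j + 1" "q j < p" using that q(1) by auto
      then show "r j \<le> p \<and> \<bar>real (r j) - real (q j)\<bar> \<le> 1" by linarith
    qed
    show ?thesis
    proof (rule exI[of _ q], rule conjI, use q(1) in force, rule allI)
      show "\<exists>r s. k < n \<longrightarrow>
        ((\<forall>j<n. r j \<le> p \<and> \<bar>real (r j) - real (q j)\<bar> \<le> 1) \<and> (\<forall>j<n. s j \<le> p \<and> \<bar>real (s j) - real (q j)\<bar> \<le> 1)
         \<and> label p r k = 0 \<and> label p s k \<noteq> 0)" for k
      proof (cases "k < n")
        case True
        then obtain r s where rs: "\<forall>j<n. q j \<le> r j \<and> r j \<le> q j + 1"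
          "\<forall>j<n. q j \<le> s j \<and> s j \<le> q j + 1" "label p r k \<noteq> label p s k"
          using q(2) by blast
        show ?thesis
        proof (cases "label p r k = 0")
          case True
          then show ?thesis using near[OF rs(1)] near[OF rs(2)] rs(3)
            by (intro exI[of _ r] exI[of _ s]) auto
        next
          case False
          then have "label p s k = 0" using lab[of r k] lab[of s k] rs(3) by auto
          then show ?thesis using near[OF rs(1)] near[OF rs(2)] False
            by (intro exI[of _ s] exI[of _ r]) auto
        qed
      qed auto
    qed
  qed
  have "\<forall>p. \<exists>q. (\<forall>i<n. q i \<le> Suc p) \<and> (\<forall>k. \<exists>r s. k < n \<longrightarrow>
        ((\<forall>j<n. r j \<le> Suc p \<and> \<bar>real (r j) - real (q j)\<bar> \<le> 1) \<and> (\<forall>j<n. s j \<le> Suc p \<and> \<bar>real (s j) - real (q j)\<bar> \<le> 1)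
         \<and> label (Suc p) r k = 0 \<and> label (Suc p) s k \<noteq> 0))"
    using ex by blast
  then obtain q r s where q: "\<And>p i. i < n \<Longrightarrow> q p i \<le> Suc p"
    and rs: "\<And>p k. k < n \<Longrightarrow>
        (\<forall>j<n. r p k j \<le> Suc p \<and> \<bar>real (r p k j) - real (q p j)\<bar> \<le> 1)
      \<and> (\<forall>j<n. s p k j \<le> Suc p \<and> \<bar>real (s p k j) - real (q p j)\<bar> \<le> 1)
      \<and> label (Suc p) (r p k) k = 0 \<and> label (Suc p) (s p k) k \<noteq> 0"
    by metis
  define X where "X p = S (Suc p) (q p)" for p
  let ?cube = "{x. \<forall>i. (if i < n then - R else 0) \<le> x i \<and> x i \<le> (if i < n then R else (0::real))}"
  have "X p \<in> ?cube" for p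
    using S_cube[of "Suc p" "q p"] q[of _ p] by (auto simp: X_def S_def abs_le_iff)
  moreover have "seq_compact ?cube"
    by (intro compact_imp_seq_compact compact_fun_cube)
  ultimately obtain x \<rho> where x: "x \<in> ?cube" and \<rho>: "strict_mono \<rho>" and lim: "(X \<circ> \<rho>) \<longlonglongrightarrow> x"
    unfolding seq_compact_def by meson
  have limj: "(\<lambda>p. X (\<rho> p) j) \<longlonglongrightarrow> x j" for j
    using continuous_on_tendsto_compose[OF continuous_on_product_coordinates[of j] lim]
    by (simp add: comp_def)
  have lim_near: "(\<lambda>p. S (Suc (\<rho> p)) (t (\<rho> p))) \<longlonglongrightarrow> x"
    if t: "\<And>p j. j < n \<Longrightarrow> \<bar>real (t p j) - real (q p j)\<bar> \<le> 1" for t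
  proof (rule tendsto_fun_coordinatewise)
    fix j
    have "(\<lambda>p. S (Suc (\<rho> p)) (t (\<rho> p)) j - X (\<rho> p) j) \<longlonglongrightarrow> 0"
    proof (rule Lim_null_comparison)
      have "\<bar>S (Suc p) (t p) j - X p j\<bar> \<le> 2 * R / real (Suc p)" for p
      proof (cases "j < n")
        case True
        have "S (Suc p) (t p) j - X p j = 2 * R / real (Suc p) * (real (t p j) - real (q p j))"
          using True by (simp add: S_def X_def diff_divide_distrib right_diff_distrib del: of_nat_Suc)
        also have "\<bar>\<dots>\<bar> = 2 * R / real (Suc p) * \<bar>real (t p j) - real (q p j)\<bar>"
          using R by (simp add: abs_mult)
        also have "\<dots> \<le> 2 * R / real (Suc p) * 1"
          using R t[OF True, of p] by (intro mult_left_mono) auto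
        finally show ?thesis by simp
      qed (use R in \<open>auto simp: S_def X_def\<close>)
      then show "\<forall>\<^sub>F p in sequentially. norm (S (Suc (\<rho> p)) (t (\<rho> p)) j - X (\<rho> p) j) \<le> 2 * R / real (Suc (\<rho> p))"
        by (intro always_eventually) auto
      have "(\<lambda>p. 2 * R / real (Suc p)) \<longlonglongrightarrow> 0"
        by (intro LIMSEQ_Suc real_tendsto_divide_at_top[OF tendsto_const filterlim_real_sequentially])
      from LIMSEQ_subseq_LIMSEQ[OF this \<rho>]
      show "(\<lambda>p. 2 * R / real (Suc (\<rho> p))) \<longlonglongrightarrow> 0" by (simp add: comp_def)
    qed
    from tendsto_add[OF this limj[of j]] show "(\<lambda>p. S (Suc (\<rho> p)) (t (\<rho> p)) j) \<longlonglongrightarrow> x j" by simp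
  qed
  have "G x k = 0" if k: "k < n" for k
  proof (rule antisym)
    have "(\<lambda>p. G (S (Suc (\<rho> p)) (r (\<rho> p) k)) k) \<longlonglongrightarrow> G x k"
      using continuous_on_tendsto_compose[OF cont[OF k] lim_near[of "\<lambda>p. r p k"]] rs k by auto
    then show "G x k \<le> 0"
      by (rule LIMSEQ_le_const2) (use l0 rs k in auto)
    have "(\<lambda>p. G (S (Suc (\<rho> p)) (s (\<rho> p) k)) k) \<longlonglongrightarrow> G x k"
      using continuous_on_tendsto_compose[OF cont[OF k] lim_near[of "\<lambda>p. s p k"]] rs k by auto
    then show "0 \<le> G x k"
      by (rule LIMSEQ_le_const) (use l1 rs k in auto)
  qed
  moreover have "\<bar>x j\<bar> \<le> R" if "j < n" for j
  proof -
    have "(if j < n then - R else 0) \<le> x j \<and> x j \<le> (if j < n then R else 0)"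
      using x by blast
    then show ?thesis using that by (simp add: abs_le_iff)
  qed
  ultimately show ?thesis using that by blast
qed

text \<open>Truncating \<open>w - F w\<close> to the cube \<open>[-R, R]\<^sup>I\<close> gives a continuous map whose fixed points satisfy the
  variational inequality of \<open>F\<close> on the cube; coercivity excludes that a constraint is active.\<close>

lemma zero_of_coercive_field:
  fixes F :: "('i \<Rightarrow> real) \<Rightarrow> 'i \<Rightarrow> real"
  assumes I: "finite I" and R: "0 < R"
    and cont: "\<And>i. i \<in> I \<Longrightarrow> continuous_on UNIV (\<lambda>w. F w i)"
    and coercive: "\<And>w. (\<Sum>i\<in>I. F w i * w i) \<le> 0 \<Longrightarrow> \<forall>i\<in>I. \<bar>w i\<bar> < R"
  obtains w where "\<forall>i\<in>I. F w i = 0"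
proof -
  obtain h where h: "bij_betw h {..<card I} I"
    using ex_bij_betw_nat_finite[OF I] by (auto simp: atLeast0LessThan)
  define g where "g = inv_into {..<card I} h"
  have gh: "g (h k) = k" if "k < card I" for k
    using h that by (auto simp: g_def bij_betw_def)
  have hI: "h k \<in> I" if "k < card I" for k using h that by (auto simp: bij_betw_def)
  have hg: "h (g i) = i" "g i < card I" if "i \<in> I" for i
    using h that by (auto simp: g_def bij_betw_def f_inv_into_f) (metis inv_into_into lessThan_iff)
  define W where "W x = (\<lambda>i. x (g i))" for x :: "nat \<Rightarrow> real"
  define clip where "clip t = max (- R) (min R t)" for t :: real
  define G where "G x k = x k - clip (x k - F (W x) (h k))" for x k
  obtain x where x: "\<forall>j<card I. \<bar>x j\<bar> \<le> R" "\<forall>k<card I. G x k = 0"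
  proof (rule poincare_miranda_nat[where G = G and R = R and n = "card I"])
    fix k assume "k < card I"
    have "continuous_on UNIV (\<lambda>x. F (W x) (h k))"
      unfolding W_def
      by (rule continuous_on_compose2[OF cont[OF hI[OF \<open>k < card I\<close>]]])
         (auto intro!: continuous_on_coordinatewise_then_product)
    then show "continuous_on UNIV (\<lambda>x. G x k)"
      unfolding G_def clip_def by (intro continuous_intros continuous_on_product_coordinates)
  qed (use R in \<open>auto simp: G_def clip_def\<close>)
  \<comment> \<open>At a fixed point of the clipped field, an active coordinate has a residual
     of the sign opposite to the coordinate.\<close>
  have sgn: "F (W x) i * W x i \<le> 0" "\<bar>W x i\<bar> < R \<Longrightarrow> F (W x) i = 0" if "i \<in> I" for i
  proof -
    have 1: "W x i = clip (W x i - F (W x) i)" "\<bar>W x i\<bar> \<le> R"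
      using x hg[OF that] by (auto simp: G_def W_def)
    consider "W x i = R" "F (W x) i \<le> 0" | "W x i = - R" "0 \<le> F (W x) i" | "F (W x) i = 0"
      using 1 R unfolding clip_def by linarith
    then show "F (W x) i * W x i \<le> 0"
      by cases (use R in \<open>auto simp: mult_nonpos_nonneg mult_nonneg_nonpos\<close>)
    show "F (W x) i = 0" if "\<bar>W x i\<bar> < R"
      using 1 that R unfolding clip_def by linarith
  qed
  have "(\<Sum>i\<in>I. F (W x) i * W x i) \<le> 0" by (intro sum_nonpos sgn)
  from coercive[OF this] sgn(2) show ?thesis by (intro that[of "W x"]) auto
qed

section \<open>Entropy estimates for an abstract scheme\<close>

text \<open>With \<open>y = log (u / U)\<close>, the product \<open>(U exp y - p) y\<close> is the entropy production of one cell of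
  previous value \<open>p\<close>. The three bounds serve to control the dissipation, to bound the cell values
  above, and to exclude that all cell values are small.\<close>

lemma entropy_production_lower_bounds:
  fixes U p P y :: real
  assumes "0 < U" "0 \<le> p" "p \<le> P"
  shows "- (U + P\<^sup>2 / (4 * U)) \<le> (U * exp y - p) * y"
    and "0 \<le> y \<Longrightarrow> U * y\<^sup>2 - P * y \<le> (U * exp y - p) * y"
    and "y \<le> - R \<Longrightarrow> 0 \<le> R \<Longrightarrow> p * R - U \<le> (U * exp y - p) * y"
proof -
  have neg: "- U \<le> U * exp y * y" if "y \<le> 0"
  proof -
    have "- y \<le> exp (- y)" using exp_ge_add_one_self[of "- y"] by linarith
    then have "exp y * (- y) \<le> exp y * exp (- y)" by (intro mult_left_mono) auto
    also have "\<dots> = 1" by (simp add: exp_minus)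
    finally have "U * (exp y * (- y)) \<le> U * 1" using assms by (intro mult_left_mono) auto
    then show ?thesis by (simp add: algebra_simps)
  qed
  have pos: "U * y\<^sup>2 - P * y \<le> (U * exp y - p) * y" if "0 \<le> y"
  proof -
    have "U * y \<le> U * exp y" using assms exp_ge_add_one_self[of y] by (intro mult_left_mono) linarith+
    then have "(U * y - P) * y \<le> (U * exp y - p) * y"
      using assms that by (intro mult_right_mono) linarith+
    then show ?thesis by (simp add: algebra_simps power2_eq_square)
  qed
  show "- (U + P\<^sup>2 / (4 * U)) \<le> (U * exp y - p) * y"
  proof (cases "0 \<le> y")
    case True
    have "0 \<le> (2 * U * y - P)\<^sup>2 / (4 * U)" using assms by simp
    also have "\<dots> = U * y\<^sup>2 - P * y + P\<^sup>2 / (4 * U)"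
      using assms by (simp add: power2_eq_square field_simps)
    finally show ?thesis using pos[OF True] assms by linarith
  next
    case False
    then have "- U \<le> U * exp y * y" "0 \<le> - (p * y)" "0 \<le> P\<^sup>2 / (4 * U)"
      using neg assms by (auto simp: mult_nonneg_nonpos)
    then show ?thesis by (simp add: algebra_simps)
  qed
  show "0 \<le> y \<Longrightarrow> U * y\<^sup>2 - P * y \<le> (U * exp y - p) * y" by (rule pos)
  show "p * R - U \<le> (U * exp y - p) * y" if "y \<le> - R" "0 \<le> R"
  proof -
    have "p * R \<le> p * (- y)" using that assms by (intro mult_left_mono) auto
    then show ?thesis using neg that by (simp add: algebra_simps)
  qed
qed

lemma exp_diff_mult_diff_nonneg: "0 \<le> (exp a - exp b) * (a - b :: real)"
  by (cases "a \<le> b") (auto simp: mult_nonpos_nonpos)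

lemma one_minus_exp_minus_one: "1 / 2 \<le> 1 - exp (- 1 :: real)"
  using exp_ge_add_one_self[of "1::real"] by (simp add: exp_minus field_simps)

text \<open>If \<open>a\<close> and \<open>b\<close> are more than \<open>1\<close> apart, the difference of their exponentials is at least half of the
  larger one.\<close>

lemma exp_diff_mult_diff_bounds:
  fixes a b \<Gamma> :: real
  assumes "(exp a - exp b) * (a - b) \<le> \<Gamma>"
  shows "- A \<le> a \<Longrightarrow> - (A + 1 + 2 * \<Gamma> * exp A) \<le> b"
    and "a \<le> A \<Longrightarrow> b \<le> \<bar>A\<bar> + 1 + 2 * \<Gamma>"
proof -
  have \<Gamma>: "0 \<le> \<Gamma>" using assms exp_diff_mult_diff_nonneg[of a b] by linarith
  have gap: "exp y / 2 \<le> exp y - exp x" if "x \<le> y - 1" for x y :: real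
  proof -
    have "exp x \<le> exp y * exp (- 1)" using that by (simp flip: exp_add)
    moreover have "exp y * (1 / 2) \<le> exp y * (1 - exp (- 1))"
      by (intro mult_left_mono one_minus_exp_minus_one) auto
    ultimately show ?thesis by (simp add: algebra_simps)
  qed
  show "- (A + 1 + 2 * \<Gamma> * exp A) \<le> b" if "- A \<le> a"
  proof (cases "b \<le> a - 1")
    case True
    have "exp (- A) / 2 \<le> exp a / 2" using that by simp
    also have "\<dots> \<le> exp a - exp b" by (rule gap[OF True])
    finally have "exp (- A) / 2 * (a - b) \<le> (exp a - exp b) * (a - b)"
      using True by (intro mult_right_mono) auto
    also have "\<dots> \<le> \<Gamma>" by (rule assms)
    finally have "a - b \<le> 2 * \<Gamma> * exp A" by (simp add: exp_minus field_simps)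
    then show ?thesis using that by linarith
  next
    case False
    moreover have "0 \<le> 2 * \<Gamma> * exp A" using \<Gamma> by simp
    ultimately show ?thesis using that by linarith
  qed
  show "b \<le> \<bar>A\<bar> + 1 + 2 * \<Gamma>" if "a \<le> A"
  proof (cases "a \<le> b - 1")
    case True
    have "exp b / 2 * 1 \<le> (exp b - exp a) * (b - a)"
      using gap[OF True] True by (intro mult_mono) auto
    also have "\<dots> \<le> \<Gamma>" using assms by (simp add: algebra_simps)
    finally have "exp b \<le> 2 * \<Gamma>" by simp
    then show ?thesis using exp_ge_add_one_self[of b] by linarith
  qed (use that \<Gamma> in linarith)
qed

text \<open>One time step reduced to its algebra: cells \<open>C\<close>, faces \<open>Fa\<close>, volumes \<open>V\<close>, equilibrium values \<open>U\<close>
  on the cells, the matrix \<open>A K\<close> of the local bilinear form in the increments \<open>w\<^sub>\<sigma> - w\<^sub>K\<close>, and mobilities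
  \<open>r\<close>. The unknown \<open>w\<close> is the logarithm of the ratio to the equilibrium, indexed by the disjoint sum of
  cells and faces. The last assumption is the only trace of coercivity and of the logarithmic mean.\<close>

locale entropy_scheme =
  fixes C :: "'c set" and Fa :: "'f set" and E :: "'c \<Rightarrow> 'f set"
    and V U :: "'c \<Rightarrow> real" and A :: "'c \<Rightarrow> 'f \<Rightarrow> 'f \<Rightarrow> real"
    and r :: "'c \<Rightarrow> ('c + 'f \<Rightarrow> real) \<Rightarrow> real" and dt M c :: real
  assumes finite_C: "finite C" and finite_Fa: "finite Fa"
    and E_subset: "\<And>K. K \<in> C \<Longrightarrow> E K \<subseteq> Fa"
    and E_nonempty: "\<And>K. K \<in> C \<Longrightarrow> E K \<noteq> {}"
    and E_cover: "\<And>\<sigma>. \<sigma> \<in> Fa \<Longrightarrow> \<exists>K\<in>C. \<sigma> \<in> E K"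
    and E_connected: "\<And>K L. K \<in> C \<Longrightarrow> L \<in> C \<Longrightarrow>
          (K, L) \<in> {(K, L). K \<in> C \<and> L \<in> C \<and> E K \<inter> E L \<noteq> {}}\<^sup>*"
    and V_pos: "\<And>K. K \<in> C \<Longrightarrow> 0 < V K" and U_pos: "\<And>K. K \<in> C \<Longrightarrow> 0 < U K"
    and dt_pos: "0 < dt" and M_pos: "0 < M" and c_pos: "0 < c"
    and r_continuous: "\<And>K. K \<in> C \<Longrightarrow> continuous_on UNIV (r K)"
    and dissipation: "\<And>K \<sigma> w. K \<in> C \<Longrightarrow> \<sigma> \<in> E K \<Longrightarrow>
          c * ((exp (w (Inr \<sigma>)) - exp (w (Inl K))) * (w (Inr \<sigma>) - w (Inl K)))
          \<le> r K w * (\<Sum>\<rho>\<in>E K. \<Sum>\<tau>\<in>E K.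
               A K \<rho> \<tau> * (w (Inr \<rho>) - w (Inl K)) * (w (Inr \<tau>) - w (Inl K)))"
begin

definition flux :: "'c \<Rightarrow> ('c + 'f \<Rightarrow> real) \<Rightarrow> ('c + 'f \<Rightarrow> real) \<Rightarrow> real" where
  "flux K w v = (\<Sum>\<rho>\<in>E K. \<Sum>\<tau>\<in>E K.
     A K \<rho> \<tau> * (w (Inr \<rho>) - w (Inl K)) * (v (Inr \<tau>) - v (Inl K)))"

definition residual :: "('c \<Rightarrow> real) \<Rightarrow> ('c + 'f \<Rightarrow> real) \<Rightarrow> ('c + 'f \<Rightarrow> real) \<Rightarrow> real" where
  "residual p w v = (\<Sum>K\<in>C. V K * ((U K * exp (w (Inl K)) - p K) * v (Inl K))) / dt
     + (\<Sum>K\<in>C. r K w * flux K w v)"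

definition density :: "('c \<Rightarrow> real) \<Rightarrow> bool" where
  "density p \<longleftrightarrow> (\<forall>K\<in>C. 0 \<le> p K) \<and> (\<Sum>K\<in>C. V K * p K) = M"

abbreviation dofs :: "('c + 'f) set" where
  "dofs \<equiv> Inl ` C \<union> Inr ` Fa"

lemma density_bounds:
  assumes "density p" "K \<in> C"
  shows "0 \<le> p K" "p K \<le> M / V K"
proof -
  show "0 \<le> p K" using assms by (auto simp: density_def)
  have "V K * p K \<le> (\<Sum>K\<in>C. V K * p K)"
    using assms finite_C V_pos by (intro member_le_sum) (auto simp: density_def less_imp_le)
  then show "p K \<le> M / V K"
    using assms V_pos[of K] by (simp add: density_def field_simps)
qed

text \<open>Minus a lower bound for the total entropy production: the sum over the cells of the first bound of
  \<open>entropy_production_lower_bounds\<close>, with \<open>P = M / V K\<close> because a density of mass \<open>M\<close> is at most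
  \<open>M / V K\<close> on \<open>K\<close>.\<close>

definition entropy_bound :: real where
  "entropy_bound = (\<Sum>K\<in>C. V K * (U K + (M / V K)\<^sup>2 / (4 * U K)))"

lemma entropy_bound_nonneg: "0 \<le> entropy_bound"
  unfolding entropy_bound_def using V_pos U_pos
  by (intro sum_nonneg mult_nonneg_nonneg add_nonneg_nonneg) (auto simp: less_imp_le)

lemma dissipation_nonneg: "K \<in> C \<Longrightarrow> 0 \<le> r K w * flux K w w"
proof -
  assume K: "K \<in> C"
  then obtain \<sigma> where \<sigma>: "\<sigma> \<in> E K" using E_nonempty by blast
  have "0 \<le> c * ((exp (w (Inr \<sigma>)) - exp (w (Inl K))) * (w (Inr \<sigma>) - w (Inl K)))"
    by (rule mult_nonneg_nonneg[OF less_imp_le[OF c_pos] exp_diff_mult_diff_nonneg])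
  then show ?thesis using dissipation[OF K \<sigma>, of w] unfolding flux_def by linarith
qed

text \<open>The residual tested with \<open>w\<close> is a sum of terms that are bounded below, so a nonpositive total bounds
  each of them above.\<close>

lemma residual_nonpos_bounds:
  assumes p: "density p" and res: "residual p w w \<le> 0"
  shows "K \<in> C \<Longrightarrow> \<sigma> \<in> E K \<Longrightarrow>
          (exp (w (Inr \<sigma>)) - exp (w (Inl K))) * (w (Inr \<sigma>) - w (Inl K)) \<le> entropy_bound / (dt * c)"
    and "K \<in> C \<Longrightarrow> V K * ((U K * exp (w (Inl K)) - p K) * w (Inl K)) \<le> entropy_bound"
    and "(\<Sum>K\<in>C. V K * ((U K * exp (w (Inl K)) - p K) * w (Inl K))) \<le> 0"
proof -
  let ?f = "\<lambda>K. V K * ((U K * exp (w (Inl K)) - p K) * w (Inl K))"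
  let ?b = "\<lambda>K. V K * (U K + (M / V K)\<^sup>2 / (4 * U K))"
  let ?D = "\<Sum>K\<in>C. r K w * flux K w w"
  have b: "- ?b K \<le> ?f K" if "K \<in> C" for K
    using mult_left_mono[OF entropy_production_lower_bounds(1)[OF U_pos[OF that] density_bounds[OF p that], of "w (Inl K)"]
        less_imp_le[OF V_pos[OF that]]] by (simp only: mult_minus_right)
  have D: "0 \<le> ?D" by (intro sum_nonneg dissipation_nonneg)
  have S: "sum ?f C / dt + ?D \<le> 0" using res by (simp add: residual_def)
  then have "sum ?f C / dt \<le> 0" using D by linarith
  then show S0: "sum ?f C \<le> 0" using dt_pos by (simp add: divide_le_0_iff)
  have lower: "- entropy_bound \<le> sum ?f C"
    unfolding entropy_bound_def sum_negf[symmetric] by (intro sum_mono b)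
  show "?f K \<le> entropy_bound" if K: "K \<in> C"
  proof -
    have "sum ?f C = ?f K + sum ?f (C - {K})" by (rule sum.remove[OF finite_C K])
    moreover have "- (\<Sum>K\<in>C - {K}. ?b K) \<le> sum ?f (C - {K})"
      unfolding sum_negf[symmetric] by (intro sum_mono b) auto
    moreover have "(\<Sum>K\<in>C - {K}. ?b K) \<le> entropy_bound"
      unfolding entropy_bound_def using finite_C V_pos U_pos
      by (intro sum_mono2 mult_nonneg_nonneg add_nonneg_nonneg) (auto simp: less_imp_le)
    ultimately show ?thesis using S0 by linarith
  qed
  show "(exp (w (Inr \<sigma>)) - exp (w (Inl K))) * (w (Inr \<sigma>) - w (Inl K)) \<le> entropy_bound / (dt * c)"
    if K: "K \<in> C" and \<sigma>: "\<sigma> \<in> E K"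
  proof -
    let ?d = "(exp (w (Inr \<sigma>)) - exp (w (Inl K))) * (w (Inr \<sigma>) - w (Inl K))"
    have "c * ?d \<le> r K w * flux K w w"
      using dissipation[OF K \<sigma>] by (simp add: flux_def)
    also have "\<dots> \<le> ?D"
      using finite_C K dissipation_nonneg by (intro member_le_sum) auto
    also have "\<dots> \<le> - (sum ?f C / dt)" using S by linarith
    also have "\<dots> \<le> entropy_bound / dt" using lower dt_pos by (simp add: field_simps)
    finally show ?thesis using dt_pos c_pos by (simp add: field_simps)
  qed
qed

text \<open>A lower bound passes from a cell to a shared face and from there to the neighbouring cell, losing
  an amount that depends on the data only.\<close>

lemma lower_bound_propagates:
  assumes "(K, L) \<in> {(K, L). K \<in> C \<and> L \<in> C \<and> E K \<inter> E L \<noteq> {}}\<^sup>*"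
  shows "\<exists>B'. \<forall>p w. density p \<longrightarrow> residual p w w \<le> 0 \<longrightarrow> - B \<le> w (Inl K) \<longrightarrow> - B' \<le> w (Inl L)"
  using assms
proof (induction rule: rtrancl_induct)
  case (step L L')
  then obtain B' where B': "\<And>p w. density p \<Longrightarrow> residual p w w \<le> 0 \<Longrightarrow> - B \<le> w (Inl K) \<Longrightarrow> - B' \<le> w (Inl L)"
    by blast
  obtain \<sigma> where \<sigma>: "\<sigma> \<in> E L" "\<sigma> \<in> E L'" and LL: "L \<in> C" "L' \<in> C" using step by blast
  define \<Gamma> where "\<Gamma> = entropy_bound / (dt * c)"
  define B1 where "B1 = B' + 1 + 2 * \<Gamma> * exp B'"
  define B2 where "B2 = B1 + 1 + 2 * \<Gamma> * exp B1"
  show ?case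
  proof (intro exI[of _ B2] allI impI)
    fix p w assume pw: "density p" "residual p w w \<le> 0" "- B \<le> w (Inl K)"
    have 1: "(exp (w (Inl L)) - exp (w (Inr \<sigma>))) * (w (Inl L) - w (Inr \<sigma>)) \<le> \<Gamma>"
      using residual_nonpos_bounds(1)[OF pw(1,2) LL(1) \<sigma>(1)] by (simp add: algebra_simps \<Gamma>_def)
    have 2: "(exp (w (Inr \<sigma>)) - exp (w (Inl L'))) * (w (Inr \<sigma>) - w (Inl L')) \<le> \<Gamma>"
      using residual_nonpos_bounds(1)[OF pw(1,2) LL(2) \<sigma>(2)] by (simp add: \<Gamma>_def)
    show "- B2 \<le> w (Inl L')"
      unfolding B2_def B1_def
      by (intro exp_diff_mult_diff_bounds(1)[OF 2] exp_diff_mult_diff_bounds(1)[OF 1] B'[OF pw])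
  qed
qed (auto intro: exI[of _ B])

text \<open>A bound by data alone, uniform in the previous state \<open>p\<close>. The assumption is an inequality
  so that the bound applies both to solutions and to the coercivity required by
  \<open>zero_of_coercive_field\<close>.\<close>

lemma a_priori_bound:
  obtains R where "0 < R"
    "\<And>p w. density p \<Longrightarrow> residual p w w \<le> 0 \<Longrightarrow> \<forall>i\<in>dofs. \<bar>w i\<bar> < R"
proof -
  \<comment> \<open>The level at which the bound \<open>p R0 - U\<close> per cell adds up to \<open>1\<close>.\<close>
  define R0 where "R0 = (1 + (\<Sum>K\<in>C. V K * U K)) / M"
  have R0: "0 \<le> R0"
    unfolding R0_def using M_pos V_pos U_pos
    by (intro divide_nonneg_nonneg add_nonneg_nonneg sum_nonneg mult_nonneg_nonneg) (auto simp: less_imp_le)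
  have somewhere: "\<exists>K\<in>C. - R0 \<le> w (Inl K)" if pw: "density p" "residual p w w \<le> 0" for p w
  proof (rule ccontr)
    assume "\<not> ?thesis"
    then have le: "V K * (p K * R0 - U K) \<le> V K * ((U K * exp (w (Inl K)) - p K) * w (Inl K))"
      if "K \<in> C" for K
      using that V_pos[OF that] R0 density_bounds[OF pw(1) that] U_pos[OF that]
      by (intro mult_left_mono entropy_production_lower_bounds(3)[where P = "M / V K"]) force+
    have "(\<Sum>K\<in>C. V K * (p K * R0 - U K))
        \<le> (\<Sum>K\<in>C. V K * ((U K * exp (w (Inl K)) - p K) * w (Inl K)))"
      by (intro sum_mono le)
    then have "(\<Sum>K\<in>C. V K * (p K * R0 - U K)) \<le> 0"
      using residual_nonpos_bounds(3)[OF pw] by linarith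
    moreover have "(\<Sum>K\<in>C. V K * (p K * R0 - U K)) = R0 * (\<Sum>K\<in>C. V K * p K) - (\<Sum>K\<in>C. V K * U K)"
      by (simp add: sum_distrib_left sum_subtractf algebra_simps)
    moreover have "R0 * (\<Sum>K\<in>C. V K * p K) = 1 + (\<Sum>K\<in>C. V K * U K)"
      using pw M_pos by (simp add: density_def R0_def)
    ultimately show False by linarith
  qed
  define B where "B K L = (SOME B'. \<forall>p w. density p \<longrightarrow> residual p w w \<le> 0 \<longrightarrow>
      - R0 \<le> w (Inl K) \<longrightarrow> - B' \<le> w (Inl L))" for K L
  have B: "- B K L \<le> w (Inl L)"
    if "K \<in> C" "L \<in> C" "density p" "residual p w w \<le> 0" "- R0 \<le> w (Inl K)" for K L p w
    using someI_ex[OF lower_bound_propagates[OF E_connected[OF that(1,2)], of R0]] that(3-)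
    unfolding B_def by blast
  define Rl where "Rl = (\<Sum>K\<in>C. \<Sum>L\<in>C. \<bar>B K L\<bar>)"
  \<comment> \<open>Beyond \<open>Y K\<close> the quadratic lower bound for the entropy production of \<open>K\<close> exceeds \<open>entropy_bound\<close>.\<close>
  define Y where "Y K = 1 + (M / V K + entropy_bound / V K) / U K" for K
  define Ru where "Ru = (\<Sum>K\<in>C. \<bar>Y K\<bar>)"
  define \<Gamma> where "\<Gamma> = entropy_bound / (dt * c)"
  define Rf where "Rf = (Rl + 1 + 2 * \<Gamma> * exp Rl) + (\<bar>Ru\<bar> + 1 + 2 * \<Gamma>)"
  have nn: "0 \<le> \<Gamma>" "0 \<le> Rl" "0 \<le> Ru"
    using entropy_bound_nonneg dt_pos c_pos by (auto simp: \<Gamma>_def Rl_def Ru_def sum_nonneg)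
  have "0 \<le> 2 * \<Gamma> * exp Rl" using nn by simp
  then have Rf: "0 < Rf" "Rl + 1 + 2 * \<Gamma> * exp Rl \<le> Rf" "\<bar>Ru\<bar> + 1 + 2 * \<Gamma> \<le> Rf" "Rl \<le> Rf" "Ru \<le> Rf"
    using nn unfolding Rf_def by linarith+
  show ?thesis
  proof (rule that[of "Rf + 1"])
    fix p w assume pw: "density p" "residual p w w \<le> 0"
    have lower: "- Rl \<le> w (Inl L)" if L: "L \<in> C" for L
    proof -
      obtain K where K: "K \<in> C" "- R0 \<le> w (Inl K)" using somewhere[OF pw] by blast
      have "\<bar>B K L\<bar> \<le> (\<Sum>L\<in>C. \<bar>B K L\<bar>)" using L finite_C by (intro member_le_sum) auto
      also have "\<dots> \<le> Rl" unfolding Rl_def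
        using K finite_C by (intro member_le_sum) (auto intro: sum_nonneg)
      finally show ?thesis using B[OF K(1) L pw K(2)] by linarith
    qed
    have upper: "w (Inl K) \<le> Ru" if K: "K \<in> C" for K
    proof -
      have "w (Inl K) \<le> Y K"
      proof (rule ccontr)
        assume "\<not> ?thesis"
        then have y: "Y K < w (Inl K)" by simp
        have pos: "0 < V K" "0 < U K" using V_pos U_pos K by auto
        have "0 \<le> (M / V K + entropy_bound / V K) / U K"
          using pos M_pos entropy_bound_nonneg by simp
        then have y1: "1 \<le> w (Inl K)" using y unfolding Y_def by linarith
        have "U K * Y K < U K * w (Inl K)" using y pos by simp
        moreover have "U K * Y K = U K + (M / V K + entropy_bound / V K)"
          using pos by (simp add: Y_def field_simps)
        ultimately have "entropy_bound / V K < U K * w (Inl K) - M / V K"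
          using pos by linarith
        moreover have "0 \<le> entropy_bound / V K" using entropy_bound_nonneg pos by simp
        ultimately have gap: "entropy_bound / V K < U K * w (Inl K) - M / V K"
          and gap0: "0 \<le> U K * w (Inl K) - M / V K" by linarith+
        have "U K * w (Inl K) - M / V K \<le> (U K * w (Inl K) - M / V K) * w (Inl K)"
          using mult_left_mono[OF y1 gap0] by (simp only: mult_1_right)
        with gap have "entropy_bound / V K < (U K * w (Inl K) - M / V K) * w (Inl K)"
          by (rule order_less_le_trans)
        also have "\<dots> = U K * (w (Inl K))\<^sup>2 - M / V K * w (Inl K)"
          by (simp add: algebra_simps power2_eq_square)
        also have "\<dots> \<le> (U K * exp (w (Inl K)) - p K) * w (Inl K)"
          using y1 by (intro entropy_production_lower_bounds(2) pos density_bounds[OF pw(1) K]) auto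
        finally have "entropy_bound < V K * ((U K * exp (w (Inl K)) - p K) * w (Inl K))"
          using pos by (simp add: field_simps)
        then show False using residual_nonpos_bounds(2)[OF pw K] by linarith
      qed
      also have "\<dots> \<le> \<bar>Y K\<bar>" by simp
      also have "\<dots> \<le> Ru" unfolding Ru_def using K finite_C by (intro member_le_sum) auto
      finally show ?thesis .
    qed
    have face: "- Rf \<le> w (Inr \<sigma>) \<and> w (Inr \<sigma>) \<le> Rf" if \<sigma>: "\<sigma> \<in> Fa" for \<sigma>
    proof -
      obtain K where K: "K \<in> C" "\<sigma> \<in> E K" using E_cover[OF \<sigma>] by blast
      have 1: "(exp (w (Inl K)) - exp (w (Inr \<sigma>))) * (w (Inl K) - w (Inr \<sigma>)) \<le> \<Gamma>"
        using residual_nonpos_bounds(1)[OF pw K] by (simp add: algebra_simps \<Gamma>_def)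
      show ?thesis
        using exp_diff_mult_diff_bounds(1)[OF 1 lower[OF K(1)]]
          exp_diff_mult_diff_bounds(2)[OF 1 upper[OF K(1)]] Rf by linarith
    qed
    show "\<forall>i\<in>dofs. \<bar>w i\<bar> < Rf + 1"
      using lower upper face Rf by (fastforce simp: abs_less_iff)
  qed (use Rf in auto)
qed

lemma flux_sum_right:
  assumes "finite I" "K \<in> C"
  shows "flux K w (\<lambda>j. \<Sum>i\<in>I. a i * e i j) = (\<Sum>i\<in>I. a i * flux K w (e i))"
proof -
  have "flux K w (\<lambda>j. \<Sum>i\<in>I. a i * e i j) =
    (\<Sum>\<rho>\<in>E K. \<Sum>\<tau>\<in>E K. \<Sum>i\<in>I. a i * (A K \<rho> \<tau> * (w (Inr \<rho>) - w (Inl K)) * (e i (Inr \<tau>) - e i (Inl K))))"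
    unfolding flux_def
    by (intro sum.cong refl) (simp add: sum_subtractf[symmetric] sum_distrib_left algebra_simps)
  also have "\<dots> = (\<Sum>\<rho>\<in>E K. \<Sum>i\<in>I. \<Sum>\<tau>\<in>E K. a i * (A K \<rho> \<tau> * (w (Inr \<rho>) - w (Inl K)) * (e i (Inr \<tau>) - e i (Inl K))))"
    by (intro sum.cong refl sum.swap)
  also have "\<dots> = (\<Sum>i\<in>I. a i * flux K w (e i))"
    unfolding flux_def by (subst sum.swap) (simp add: sum_distrib_left)
  finally show ?thesis .
qed

lemma residual_sum_right:
  assumes "finite I"
  shows "residual p w (\<lambda>j. \<Sum>i\<in>I. a i * e i j) = (\<Sum>i\<in>I. a i * residual p w (e i))"
proof -
  have "(\<Sum>K\<in>C. V K * ((U K * exp (w (Inl K)) - p K) * (\<Sum>i\<in>I. a i * e i (Inl K)))) =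
    (\<Sum>K\<in>C. \<Sum>i\<in>I. a i * (V K * ((U K * exp (w (Inl K)) - p K) * e i (Inl K))))"
    by (simp add: sum_distrib_left algebra_simps)
  also have "\<dots> = (\<Sum>i\<in>I. a i * (\<Sum>K\<in>C. V K * ((U K * exp (w (Inl K)) - p K) * e i (Inl K))))"
    by (subst sum.swap) (simp add: sum_distrib_left)
  finally have 1: "(\<Sum>K\<in>C. V K * ((U K * exp (w (Inl K)) - p K) * (\<Sum>i\<in>I. a i * e i (Inl K)))) = \<dots>" .
  have "(\<Sum>K\<in>C. r K w * flux K w (\<lambda>j. \<Sum>i\<in>I. a i * e i j)) =
    (\<Sum>K\<in>C. \<Sum>i\<in>I. a i * (r K w * flux K w (e i)))"
    using flux_sum_right[OF assms] by (simp add: sum_distrib_left algebra_simps)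
  also have "\<dots> = (\<Sum>i\<in>I. a i * (\<Sum>K\<in>C. r K w * flux K w (e i)))"
    by (subst sum.swap) (simp add: sum_distrib_left)
  finally have 2: "(\<Sum>K\<in>C. r K w * flux K w (\<lambda>j. \<Sum>i\<in>I. a i * e i j)) = \<dots>" .
  have "(\<Sum>i\<in>I. a i * X i) / dt + (\<Sum>i\<in>I. a i * Y i) = (\<Sum>i\<in>I. a i * (X i / dt + Y i))" for X Y
    by (simp add: distrib_left sum.distrib sum_divide_distrib)
  then show ?thesis
    unfolding residual_def 1 2 .
qed

definition unit :: "'c + 'f \<Rightarrow> 'c + 'f \<Rightarrow> real" where
  "unit i j = (if j = i then 1 else 0)"

lemma residual_expand: "residual p w v = (\<Sum>i\<in>dofs. v i * residual p w (unit i))"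
proof -
  have fin: "finite dofs" using finite_C finite_Fa by simp
  have v: "(\<Sum>i\<in>dofs. v i * unit i j) = v j" if "j \<in> dofs" for j
    using fin that by (simp add: unit_def if_distrib cong: if_cong)
  have "residual p w v = residual p w (\<lambda>j. \<Sum>i\<in>dofs. v i * unit i j)"
    unfolding residual_def flux_def
    by (intro arg_cong2[where f = "(+)"] arg_cong2[where f = "(/)"] arg_cong2[where f = "(*)"] refl sum.cong)
       (use E_subset in \<open>auto simp: v subset_iff\<close>)
  then show ?thesis using residual_sum_right[OF fin] by metis
qed

theorem solution_exists:
  assumes p: "density p"
  obtains w where "\<And>v. residual p w v = 0"
proof -
  obtain R where R: "0 < R" "\<And>p w. density p \<Longrightarrow> residual p w w \<le> 0 \<Longrightarrow> \<forall>i\<in>dofs. \<bar>w i\<bar> < R"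
    by (rule a_priori_bound) blast
  have fin: "finite dofs" using finite_C finite_Fa by simp
  have cont: "continuous_on UNIV (\<lambda>w. residual p w (unit i))" for i
    unfolding residual_def flux_def
    by (intro continuous_intros r_continuous continuous_on_product_coordinates) (use dt_pos in auto)
  have coercive: "\<forall>i\<in>dofs. \<bar>w i\<bar> < R" if "(\<Sum>i\<in>dofs. residual p w (unit i) * w i) \<le> 0" for w
  proof (rule R(2)[OF p])
    show "residual p w w \<le> 0" using that by (subst residual_expand) (simp only: mult.commute)
  qed
  obtain w where w: "\<forall>i\<in>dofs. residual p w (unit i) = 0"
    by (rule zero_of_coercive_field[OF fin R(1) cont coercive])
  show ?thesis
    by (rule that[of w], subst residual_expand, rule sum.neutral) (use w in simp)
qed

text \<open>Conservation of mass: the flux vanishes on constants.\<close>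

lemma solution_density:
  assumes p: "density p" and w: "\<And>v. residual p w v = 0"
  shows "density (\<lambda>K. U K * exp (w (Inl K)))"
proof -
  have "residual p w (\<lambda>_. 1) = 0" by (rule w)
  then have "(\<Sum>K\<in>C. V K * (U K * exp (w (Inl K)) - p K)) = 0"
    using dt_pos by (simp add: residual_def flux_def)
  then have "(\<Sum>K\<in>C. V K * (U K * exp (w (Inl K)))) = (\<Sum>K\<in>C. V K * p K)"
    by (simp add: algebra_simps sum_subtractf)
  then show ?thesis using p U_pos by (auto simp: density_def less_imp_le)
qed

end

section \<open>Star-shaped cells, their normals and pyramids\<close>

lemma hyperplane_unit_normal_unique:
  fixes n n' :: "'a::euclidean_space"
  assumes n: "norm n = 1" and n': "norm n' = 1"
    and sub: "{x. n \<bullet> x = b} \<subseteq> {x. n' \<bullet> x = b'}"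
  shows "n' = n \<and> b' = b \<or> n' = - n \<and> b' = - b"
proof -
  have nn: "n \<bullet> n = 1" "n' \<bullet> n' = 1" using n n' by (simp_all add: dot_square_norm)
  define q where "q = n' - (n' \<bullet> n) *\<^sub>R n"
  have nq: "n \<bullet> q = 0" using nn by (simp add: q_def inner_diff_right inner_commute)
  have "n \<bullet> (b *\<^sub>R n) = b" "n \<bullet> (b *\<^sub>R n + q) = b" using nn nq by (simp_all add: inner_add_right)
  then have b': "n' \<bullet> (b *\<^sub>R n) = b'" and "n' \<bullet> (b *\<^sub>R n + q) = b'" using sub by blast+
  then have "n' \<bullet> q = 0" by (simp add: inner_add_right)
  then have "q \<bullet> q = 0" using nq by (simp add: q_def inner_diff_left inner_diff_right inner_commute)
  then have eq: "n' = (n' \<bullet> n) *\<^sub>R n" by (simp add: q_def)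
  then have "\<bar>n' \<bullet> n\<bar> = 1" using n n' by (metis mult.right_neutral norm_scaleR)
  then have "n' \<bullet> n = 1 \<or> n' \<bullet> n = - 1" by linarith
  then have "n' = n \<or> n' = - n" using eq by (metis scaleR_minus1_left scaleR_one)
  then show ?thesis using b' nn by auto
qed

lemma closure_meets_ball: "x \<in> closure N \<Longrightarrow> 0 < e \<Longrightarrow> N \<inter> ball x e \<noteq> {}"
  using open_Int_closure_eq_empty[OF open_ball, of x e N] by force

lemma interior_Union_closed_empty:
  assumes "finite F" "\<And>S. S \<in> F \<Longrightarrow> closed S \<and> interior S = {}"
  shows "interior (\<Union>F) = {}"
  using assms
proof (induction F rule: finite_induct)
  case (insert S F)
  then have "interior (S \<union> \<Union>F) = interior S"
    by (intro interior_closed_Un_empty_interior) auto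
  with insert show ?case by simp
qed simp

text \<open>The rim \<open>closure \<sigma> - \<sigma>\<close> may have positive surface measure, but it is closed with empty interior in
  the hyperplane of \<open>\<sigma>\<close>. Hence a segment from \<open>p\<close> that meets it can be tilted so that it crosses the
  hyperplane in \<open>\<sigma>\<close>, and a line through \<open>p\<close> meets the hyperplane only once.\<close>

lemma rim_cone:
  fixes \<sigma> :: "'a::euclidean_space set"
  assumes op: "openin (top_of_set (affine hull \<sigma>)) \<sigma>"
    and hull: "affine hull \<sigma> = {x. a \<bullet> x = b}" and p: "p \<notin> affine hull \<sigma>"
  defines "C \<equiv> {q. \<exists>t. t \<in> {0..1} \<and> p + t *\<^sub>R (q - p) \<in> closure \<sigma> - \<sigma>}"
  shows "closed C" "interior C = {}"
proof -
  have "closed (affine hull \<sigma>)" by simp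
  then have clo: "closure \<sigma> \<subseteq> affine hull \<sigma>" by (intro closure_minimal hull_subset)
  obtain T where T: "open T" "\<sigma> = affine hull \<sigma> \<inter> T" using op by (auto simp: openin_open)
  have "closure \<sigma> - \<sigma> = closure \<sigma> - T" using T clo by blast
  then have cl: "closed (closure \<sigma> - \<sigma>)" using T by auto
  have "closed ((\<lambda>(t, q). p + t *\<^sub>R (q - p)) -` (closure \<sigma> - \<sigma>))"
    by (rule closed_vimage[OF cl]) (auto simp: split_beta intro!: continuous_intros)
  from closed_compact_projection[OF compact_Icc[of 0 1] this] show "closed C"
    by (simp add: C_def)
  show "interior C = {}"
  proof (rule ccontr)
    assume "interior C \<noteq> {}"
    then obtain q0 e where e: "0 < e" "ball q0 e \<subseteq> C"
      by (metis ex_in_conv open_contains_ball open_interior interior_subset subset_trans)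
    then have "q0 \<in> C" by (auto simp: subset_iff)
    then obtain t0 where t0: "0 \<le> t0" "p + t0 *\<^sub>R (q0 - p) \<in> closure \<sigma> - \<sigma>"
      by (auto simp: C_def)
    have "t0 \<noteq> 0" using t0 p clo by (auto simp: subset_iff)
    then have t0': "0 < t0" using t0 by simp
    then obtain z where z: "z \<in> \<sigma>" "dist z (p + t0 *\<^sub>R (q0 - p)) < t0 * e"
      using t0(2) e(1) by (metis DiffD1 closure_approachable mult_pos_pos)
    define q where "q = p + (1 / t0) *\<^sub>R (z - p)"
    have "q - q0 = (1 / t0) *\<^sub>R (z - (p + t0 *\<^sub>R (q0 - p)))"
      using t0' by (simp add: q_def algebra_simps)
    then have "dist q q0 = (1 / t0) * dist z (p + t0 *\<^sub>R (q0 - p))"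
      using t0' by (simp add: dist_norm)
    also have "\<dots> < e" using z t0' by (simp add: field_simps)
    finally have "q \<in> C" using e by (auto simp: dist_commute)
    then obtain t where t: "p + t *\<^sub>R (q - p) \<in> closure \<sigma> - \<sigma>" by (auto simp: C_def)
    have tz: "p + t *\<^sub>R (q - p) = p + (t / t0) *\<^sub>R (z - p)" by (simp add: q_def)
    then have "a \<bullet> (p + (t / t0) *\<^sub>R (z - p)) = b" using t clo hull by auto
    moreover have "a \<bullet> z = b" using z(1) hull hull_subset[of \<sigma> affine] by auto
    ultimately have "(t / t0) * (b - a \<bullet> p) = b - a \<bullet> p"
      by (simp add: inner_add_right inner_diff_right)
    moreover have "b - a \<bullet> p \<noteq> 0" using p unfolding hull by simp
    ultimately have "t / t0 = 1" unfolding mult_cancel_right2 by blast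
    then show False using t tz z by simp
  qed
qed

text \<open>A single cell with centre \<open>c\<close> and faces \<open>S\<close>, independent of the surrounding mesh.\<close>

locale star_cell =
  fixes K :: "(real^'d) set" and c :: "real^'d" and S :: "(real^'d) set set"
  assumes open_K: "open K" and star: "star_shaped_wrt K c"
    and frontier_K: "frontier K = (\<Union>\<sigma>\<in>S. closure \<sigma>)"
    and face_nonempty: "\<And>\<sigma>. \<sigma> \<in> S \<Longrightarrow> \<sigma> \<noteq> {}"
    and face_hyperplane: "\<And>\<sigma>. \<sigma> \<in> S \<Longrightarrow> \<exists>a b. a \<noteq> 0 \<and> affine hull \<sigma> = {x. a \<bullet> x = b}"
    and face_openin: "\<And>\<sigma>. \<sigma> \<in> S \<Longrightarrow> openin (top_of_set (affine hull \<sigma>)) \<sigma>"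
    and centre_off: "\<And>\<sigma>. \<sigma> \<in> S \<Longrightarrow> c \<notin> affine hull \<sigma>"
begin

text \<open>The hyperplane of a face in normal form \<open>{x. n \<bullet> x = b}\<close>, with the unit normal pointing away from
  the centre.\<close>

definition plane :: "(real^'d) set \<Rightarrow> (real^'d) \<times> real" where
  "plane \<sigma> = (SOME (n, b). norm n = 1 \<and> affine hull \<sigma> = {x. n \<bullet> x = b} \<and> n \<bullet> c < b)"

definition nrm :: "(real^'d) set \<Rightarrow> real^'d" where "nrm \<sigma> = fst (plane \<sigma>)"
definition lev :: "(real^'d) set \<Rightarrow> real" where "lev \<sigma> = snd (plane \<sigma>)"

lemma plane:
  assumes "\<sigma> \<in> S"
  shows norm_nrm: "norm (nrm \<sigma>) = 1" and hull_eq: "affine hull \<sigma> = {x. nrm \<sigma> \<bullet> x = lev \<sigma>}"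
    and centre_below: "nrm \<sigma> \<bullet> c < lev \<sigma>"
proof -
  obtain a b where a: "a \<noteq> 0" "affine hull \<sigma> = {x. a \<bullet> x = b}" using face_hyperplane[OF assms] by blast
  define P where "P = (\<lambda>(n, b). norm n = 1 \<and> affine hull \<sigma> = {x. n \<bullet> x = b} \<and> n \<bullet> c < b)"
  define k where "k = (if a \<bullet> c < b then 1 / norm a else - 1 / norm a)"
  have k: "k \<noteq> 0" "\<bar>k\<bar> = 1 / norm a" using a by (auto simp: k_def)
  have "a \<bullet> c \<noteq> b" using centre_off[OF assms] a by auto
  then have "k * (a \<bullet> c) < k * b"
    using a by (auto simp: k_def divide_strict_right_mono)
  then have "norm (k *\<^sub>R a) = 1 \<and> affine hull \<sigma> = {x. (k *\<^sub>R a) \<bullet> x = k * b} \<and> (k *\<^sub>R a) \<bullet> c < k * b"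
    using a k by simp
  then have "P (k *\<^sub>R a, k * b)" by (simp add: P_def)
  then have "P (plane \<sigma>)" unfolding plane_def P_def[symmetric] by (rule someI)
  then show "norm (nrm \<sigma>) = 1" "affine hull \<sigma> = {x. nrm \<sigma> \<bullet> x = lev \<sigma>}" "nrm \<sigma> \<bullet> c < lev \<sigma>"
    by (simp_all add: P_def nrm_def lev_def split_beta)
qed

lemma face_level: "\<sigma> \<in> S \<Longrightarrow> y \<in> closure \<sigma> \<Longrightarrow> nrm \<sigma> \<bullet> y = lev \<sigma>"
proof -
  assume \<sigma>: "\<sigma> \<in> S" and y: "y \<in> closure \<sigma>"
  have "closed (affine hull \<sigma>)" by simp
  then have "closure \<sigma> \<subseteq> affine hull \<sigma>" by (intro closure_minimal hull_subset)
  then show ?thesis using y hull_eq[OF \<sigma>] by auto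
qed

text \<open>Projection from the centre onto the hyperplane of \<open>\<sigma>\<close>, meaningful on the side of the centre to which
  the normal points.\<close>

definition rad :: "(real^'d) set \<Rightarrow> real^'d \<Rightarrow> real^'d" where
  "rad \<sigma> z = c + ((lev \<sigma> - nrm \<sigma> \<bullet> c) / (nrm \<sigma> \<bullet> z - nrm \<sigma> \<bullet> c)) *\<^sub>R (z - c)"

text \<open>The infinite open cone over \<open>\<sigma>\<close> with apex \<open>c\<close>.\<close>

definition shadow :: "(real^'d) set \<Rightarrow> (real^'d) set" where
  "shadow \<sigma> = {z. nrm \<sigma> \<bullet> c < nrm \<sigma> \<bullet> z \<and> rad \<sigma> z \<in> \<sigma>}"

lemma rad_level: "nrm \<sigma> \<bullet> c < nrm \<sigma> \<bullet> z \<Longrightarrow> nrm \<sigma> \<bullet> rad \<sigma> z = lev \<sigma>"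
  by (simp add: rad_def inner_add_right inner_diff_right)

lemma rad_fixed: "nrm \<sigma> \<bullet> z = lev \<sigma> \<Longrightarrow> nrm \<sigma> \<bullet> c < lev \<sigma> \<Longrightarrow> rad \<sigma> z = z"
  by (simp add: rad_def)

lemma rad_scale: "0 < t \<Longrightarrow> rad \<sigma> (c + t *\<^sub>R (z - c)) = rad \<sigma> z"
  by (simp add: rad_def inner_add_right inner_diff_right flip: right_diff_distrib)

lemma shadow_scale: "0 < t \<Longrightarrow> z \<in> shadow \<sigma> \<Longrightarrow> c + t *\<^sub>R (z - c) \<in> shadow \<sigma>"
  by (simp add: shadow_def rad_scale inner_add_right inner_diff_right)

lemma face_subset_shadow: "\<sigma> \<in> S \<Longrightarrow> \<sigma> \<subseteq> shadow \<sigma>"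
  using centre_below face_level closure_subset by (fastforce simp: shadow_def rad_fixed)

lemma open_shadow:
  assumes "\<sigma> \<in> S" shows "open (shadow \<sigma>)"
proof -
  obtain T where T: "open T" "\<sigma> = affine hull \<sigma> \<inter> T"
    using face_openin[OF assms] by (auto simp: openin_open)
  let ?H = "{z. nrm \<sigma> \<bullet> c < nrm \<sigma> \<bullet> z}"
  have "open ?H" by (rule open_halfspace_gt)
  moreover have "continuous_on ?H (rad \<sigma>)" unfolding rad_def by (intro continuous_intros) auto
  ultimately have "open (?H \<inter> rad \<sigma> -` T)" using T by (intro continuous_open_preimage)
  moreover have "rad \<sigma> z \<in> \<sigma> \<longleftrightarrow> rad \<sigma> z \<in> T" if "nrm \<sigma> \<bullet> c < nrm \<sigma> \<bullet> z" for z
  proof -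
    have "rad \<sigma> z \<in> affine hull \<sigma>" using rad_level[OF that] hull_eq[OF assms] by simp
    then show ?thesis using T(2) by blast
  qed
  then have "?H \<inter> rad \<sigma> -` T = shadow \<sigma>" by (auto simp: shadow_def)
  ultimately show ?thesis by simp
qed

lemma face_subset_frontier: "\<sigma> \<in> S \<Longrightarrow> y \<in> \<sigma> \<Longrightarrow> y \<in> frontier K"
  using frontier_K closure_subset by blast

lemma frontier_notin: "y \<in> frontier K \<Longrightarrow> y \<notin> K"
  using open_K by (simp add: frontier_def interior_open)

lemma star_segment: "z \<in> K \<Longrightarrow> 0 \<le> t \<Longrightarrow> t \<le> 1 \<Longrightarrow> c + t *\<^sub>R (z - c) \<in> K"
  using star unfolding star_shaped_wrt_def closed_segment_def
  by (force simp: algebra_simps)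

text \<open>A point of \<open>K\<close> on or beyond the face would, by star-shapedness, put its projection onto the face in
  \<open>K\<close>, but faces lie in the frontier of the open set \<open>K\<close>.\<close>

lemma shadow_outside:
  assumes \<sigma>: "\<sigma> \<in> S" and z: "z \<in> shadow \<sigma>" and above: "lev \<sigma> \<le> nrm \<sigma> \<bullet> z"
  shows "z \<notin> K"
proof
  assume "z \<in> K"
  then have "rad \<sigma> z \<in> K"
    unfolding rad_def using above centre_below[OF \<sigma>] by (intro star_segment) auto
  moreover have "rad \<sigma> z \<in> \<sigma>" using z by (simp add: shadow_def)
  ultimately show False using face_subset_frontier[OF \<sigma>] frontier_notin by blast
qed

lemma shadow_outside_closure:
  assumes \<sigma>: "\<sigma> \<in> S" and z: "z \<in> shadow \<sigma>" and above: "lev \<sigma> < nrm \<sigma> \<bullet> z"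
  shows "z \<notin> closure K"
proof -
  have "open (shadow \<sigma> \<inter> {z. lev \<sigma> < nrm \<sigma> \<bullet> z})"
    using open_shadow[OF \<sigma>] by (intro open_Int open_halfspace_gt)
  moreover have "shadow \<sigma> \<inter> {z. lev \<sigma> < nrm \<sigma> \<bullet> z} \<inter> K = {}"
    using shadow_outside[OF \<sigma>] by (auto simp: less_imp_le)
  ultimately show ?thesis
    using z above open_Int_closure_eq_empty by blast
qed

text \<open>Star-shapedness with respect to a point only gives that the segment from \<open>c\<close> to a point of \<open>\<sigma>\<close> lies
  in the closure of \<open>K\<close>. If it touched the frontier before reaching \<open>\<sigma>\<close>, it would come close to another face \<open>\<tau>\<close>
  there, and points of \<open>\<sigma>\<close> would lie strictly behind \<open>\<tau>\<close>, outside the closure of \<open>K\<close>. Here it matters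
  that the centre lies on no face hyperplane.\<close>

lemma shadow_inside:
  assumes \<sigma>: "\<sigma> \<in> S" and z: "z \<in> shadow \<sigma>" and below: "nrm \<sigma> \<bullet> z < lev \<sigma>"
  shows "z \<in> K"
proof (rule ccontr)
  assume "z \<notin> K"
  define s where "s = (nrm \<sigma> \<bullet> z - nrm \<sigma> \<bullet> c) / (lev \<sigma> - nrm \<sigma> \<bullet> c)"
  have s: "0 < s" "s < 1" using z below centre_below[OF \<sigma>] by (auto simp: s_def shadow_def)
  have zs: "z = c + s *\<^sub>R (rad \<sigma> z - c)"
    using z below centre_below[OF \<sigma>] by (simp add: s_def rad_def shadow_def)
  have "(\<lambda>x. c + s *\<^sub>R (x - c)) ` closure K \<subseteq> closure K"
    using s star_segment closure_subset[of K]
    by (intro image_closure_subset continuous_intros) auto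
  moreover have "rad \<sigma> z \<in> closure K"
    using z face_subset_frontier[OF \<sigma>] by (auto simp: shadow_def frontier_def)
  ultimately have "z \<in> closure K" using zs by (metis (no_types, lifting) image_subset_iff)
  then have "z \<in> frontier K" using \<open>z \<notin> K\<close> open_K by (simp add: frontier_def interior_open)
  then obtain \<tau> where \<tau>: "\<tau> \<in> S" "z \<in> closure \<tau>" using frontier_K by blast
  have "open (shadow \<sigma> \<inter> {x. nrm \<sigma> \<bullet> x < lev \<sigma>})"
    using open_shadow[OF \<sigma>] by (intro open_Int open_halfspace_lt)
  then obtain z' where z': "z' \<in> \<tau>" "z' \<in> shadow \<sigma>" "nrm \<sigma> \<bullet> z' < lev \<sigma>"
    using \<tau>(2) z below open_Int_closure_eq_empty[of "shadow \<sigma> \<inter> {x. nrm \<sigma> \<bullet> x < lev \<sigma>}" \<tau>] by blast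
  define t where "t = (lev \<sigma> - nrm \<sigma> \<bullet> c) / (nrm \<sigma> \<bullet> z' - nrm \<sigma> \<bullet> c)"
  have t: "1 < t" using z' by (auto simp: t_def shadow_def)
  have y': "rad \<sigma> z' = c + t *\<^sub>R (z' - c)" by (simp add: rad_def t_def)
  have "z' \<in> shadow \<tau>" using z' face_subset_shadow[OF \<tau>(1)] by blast
  then have 1: "rad \<sigma> z' \<in> shadow \<tau>" using t y' shadow_scale[of t z' \<tau>] by simp
  have "nrm \<tau> \<bullet> z' = lev \<tau>" using face_level[OF \<tau>(1)] z' closure_subset by blast
  then have "nrm \<tau> \<bullet> rad \<sigma> z' = lev \<tau> + (t - 1) * (lev \<tau> - nrm \<tau> \<bullet> c)"
    by (simp add: y' inner_add_right inner_diff_right algebra_simps)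
  then have 2: "lev \<tau> < nrm \<tau> \<bullet> rad \<sigma> z'" using t centre_below[OF \<tau>(1)] by simp
  have "rad \<sigma> z' \<in> closure K"
    using z' face_subset_frontier[OF \<sigma>] by (auto simp: shadow_def frontier_def)
  then show False using shadow_outside_closure[OF \<tau>(1) 1 2] by blast
qed

text \<open>Near a point of a face, the cell is exactly the side of the hyperplane that contains the centre.\<close>

lemma local_sides:
  assumes \<sigma>: "\<sigma> \<in> S" and y: "y \<in> \<sigma>"
  obtains e where "0 < e" "\<And>z. z \<in> ball y e \<Longrightarrow> nrm \<sigma> \<bullet> z < lev \<sigma> \<Longrightarrow> z \<in> K"
    "\<And>z. z \<in> ball y e \<Longrightarrow> lev \<sigma> \<le> nrm \<sigma> \<bullet> z \<Longrightarrow> z \<notin> K"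
proof -
  have "y \<in> shadow \<sigma>" using face_subset_shadow[OF \<sigma>] y by blast
  then obtain e where "0 < e" "ball y e \<subseteq> shadow \<sigma>"
    using open_shadow[OF \<sigma>] by (meson open_contains_ball)
  then show ?thesis
    using shadow_inside[OF \<sigma>] shadow_outside[OF \<sigma>] by (intro that[of e]) auto
qed

text \<open>Since the face spans its hyperplane, only the two unit normals qualify, and by \<open>local_sides\<close> only
  one of them points out of \<open>K\<close>. This makes the definite description of \<open>outward_normal\<close> meaningful.\<close>

lemma outward_normal_eq:
  assumes \<sigma>: "\<sigma> \<in> S" shows "outward_normal K \<sigma> = nrm \<sigma>"
  unfolding outward_normal_def
proof (rule the_equality)
  have level: "nrm \<sigma> \<bullet> y = lev \<sigma>" if "y \<in> \<sigma>" for y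
    using that face_level[OF \<sigma>] closure_subset by blast
  have nn: "nrm \<sigma> \<bullet> nrm \<sigma> = 1" using norm_nrm[OF \<sigma>] by (simp add: dot_square_norm)
  have sides: "\<exists>e>0. \<forall>t\<in>{0<..<e}. y - t *\<^sub>R nrm \<sigma> \<in> K \<and> y + t *\<^sub>R nrm \<sigma> \<notin> K" if y: "y \<in> \<sigma>" for y
  proof -
    obtain e where e: "0 < e" "\<And>z. z \<in> ball y e \<Longrightarrow> nrm \<sigma> \<bullet> z < lev \<sigma> \<Longrightarrow> z \<in> K"
      "\<And>z. z \<in> ball y e \<Longrightarrow> lev \<sigma> \<le> nrm \<sigma> \<bullet> z \<Longrightarrow> z \<notin> K"
      using local_sides[OF \<sigma> y] by blast
    have "y - t *\<^sub>R nrm \<sigma> \<in> K \<and> y + t *\<^sub>R nrm \<sigma> \<notin> K" if "t \<in> {0<..<e}" for t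
      using that norm_nrm[OF \<sigma>] level[OF y] nn
      by (intro conjI e(2,3)) (auto simp: dist_norm inner_diff_right inner_add_right)
    with e(1) show ?thesis by blast
  qed
  show "norm (nrm \<sigma>) = 1 \<and> (\<forall>x\<in>\<sigma>. \<forall>y\<in>\<sigma>. nrm \<sigma> \<bullet> (y - x) = 0) \<and>
    (\<forall>y\<in>\<sigma>. \<exists>e>0. \<forall>t\<in>{0<..<e}. y - t *\<^sub>R nrm \<sigma> \<in> K \<and> y + t *\<^sub>R nrm \<sigma> \<notin> K)"
    using norm_nrm[OF \<sigma>] sides level by (simp add: inner_diff_right)
  fix n
  assume n: "norm n = 1 \<and> (\<forall>x\<in>\<sigma>. \<forall>y\<in>\<sigma>. n \<bullet> (y - x) = 0) \<and>
    (\<forall>y\<in>\<sigma>. \<exists>e>0. \<forall>t\<in>{0<..<e}. y - t *\<^sub>R n \<in> K \<and> y + t *\<^sub>R n \<notin> K)"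
  obtain y where y: "y \<in> \<sigma>" using face_nonempty[OF \<sigma>] by blast
  have "n \<bullet> (x - y) = 0" if "x \<in> \<sigma>" for x using n y that by blast
  then have "\<sigma> \<subseteq> {x. n \<bullet> x = n \<bullet> y}" by (auto simp: inner_diff_right)
  then have sub: "affine hull \<sigma> \<subseteq> {x. n \<bullet> x = n \<bullet> y}"
    by (intro hull_minimal affine_hyperplane)
  have "norm n = 1" using n by blast
  then have "n = nrm \<sigma> \<or> n = - nrm \<sigma>"
    using hyperplane_unit_normal_unique[OF norm_nrm[OF \<sigma>] _ sub[unfolded hull_eq[OF \<sigma>]]] by blast
  moreover have "n \<noteq> - nrm \<sigma>"
  proof
    assume neg: "n = - nrm \<sigma>"
    obtain e1 where e1: "0 < e1" "\<forall>t\<in>{0<..<e1}. y - t *\<^sub>R nrm \<sigma> \<in> K \<and> y + t *\<^sub>R nrm \<sigma> \<notin> K"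
      using sides[OF y] by blast
    obtain e2 where e2: "0 < e2" "\<forall>t\<in>{0<..<e2}. y - t *\<^sub>R n \<in> K \<and> y + t *\<^sub>R n \<notin> K"
      using n y by blast
    have "min e1 e2 / 2 \<in> {0<..<e1}" "min e1 e2 / 2 \<in> {0<..<e2}" using e1(1) e2(1) by auto
    with e1(2) e2(2) neg show False by fastforce
  qed
  ultimately show "n = nrm \<sigma>" by blast
qed

definition pyr :: "(real^'d) set \<Rightarrow> (real^'d) set" where
  "pyr \<sigma> = shadow \<sigma> \<inter> {z. nrm \<sigma> \<bullet> z < lev \<sigma>}"

lemma pyr_eq:
  assumes \<sigma>: "\<sigma> \<in> S"
  shows "pyr \<sigma> = (\<Union>y\<in>\<sigma>. {c + s *\<^sub>R (y - c) | s. 0 < s \<and> s < 1})"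
proof (intro set_eqI iffI)
  fix z assume z: "z \<in> pyr \<sigma>"
  define s where "s = (nrm \<sigma> \<bullet> z - nrm \<sigma> \<bullet> c) / (lev \<sigma> - nrm \<sigma> \<bullet> c)"
  have "0 < s" "s < 1" using z centre_below[OF \<sigma>] by (auto simp: s_def shadow_def pyr_def)
  moreover have "z = c + s *\<^sub>R (rad \<sigma> z - c)"
    using z centre_below[OF \<sigma>] by (simp add: s_def rad_def shadow_def pyr_def)
  moreover have "rad \<sigma> z \<in> \<sigma>" using z by (simp add: pyr_def shadow_def)
  ultimately show "z \<in> (\<Union>y\<in>\<sigma>. {c + s *\<^sub>R (y - c) | s. 0 < s \<and> s < 1})" by blast
next
  fix z assume "z \<in> (\<Union>y\<in>\<sigma>. {c + s *\<^sub>R (y - c) | s. 0 < s \<and> s < 1})"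
  then obtain y s where ys: "y \<in> \<sigma>" "0 < s" "s < 1" "z = c + s *\<^sub>R (y - c)" by blast
  have "nrm \<sigma> \<bullet> y = lev \<sigma>" using ys face_level[OF \<sigma>] closure_subset by blast
  then have "lev \<sigma> - nrm \<sigma> \<bullet> z = (1 - s) * (lev \<sigma> - nrm \<sigma> \<bullet> c)"
    unfolding ys(4) by (simp add: inner_add_right inner_diff_right algebra_simps)
  moreover have "0 < (1 - s) * (lev \<sigma> - nrm \<sigma> \<bullet> c)" using ys centre_below[OF \<sigma>] by simp
  ultimately have "nrm \<sigma> \<bullet> z < lev \<sigma>" by linarith
  moreover have "z \<in> shadow \<sigma>"
    using ys face_subset_shadow[OF \<sigma>] shadow_scale[of s y \<sigma>] by blast
  ultimately show "z \<in> pyr \<sigma>" by (simp add: pyr_def)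
qed

lemma open_pyr: "\<sigma> \<in> S \<Longrightarrow> open (pyr \<sigma>)"
  unfolding pyr_def by (intro open_Int open_shadow open_halfspace_lt)

lemma pyr_subset: "\<sigma> \<in> S \<Longrightarrow> pyr \<sigma> \<subseteq> K"
  using shadow_inside by (auto simp: pyr_def)

lemma pyr_nonempty: "\<sigma> \<in> S \<Longrightarrow> pyr \<sigma> \<noteq> {}"
proof -
  assume \<sigma>: "\<sigma> \<in> S"
  then obtain y where "y \<in> \<sigma>" using face_nonempty by blast
  moreover have "0 < (1/2::real) \<and> (1/2::real) < 1" by simp
  ultimately show ?thesis unfolding pyr_eq[OF \<sigma>] by blast
qed

text \<open>If a ray from the centre met two disjoint faces, the nearer point would lie inside the pyramid over
  the other face, hence in \<open>K\<close>.\<close>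

lemma pyr_disjoint:
  assumes \<sigma>: "\<sigma> \<in> S" and \<tau>: "\<tau> \<in> S" and disj: "\<sigma> \<inter> \<tau> = {}"
  shows "pyr \<sigma> \<inter> pyr \<tau> = {}"
proof -
  have far: "t \<ge> s" if \<rho>: "\<rho> \<in> S" "\<rho>' \<in> S" and z: "c + s *\<^sub>R (z - c) \<in> \<rho>" "c + t *\<^sub>R (z - c) \<in> \<rho>'" "0 < s" "0 < t"
    for \<rho> \<rho>' s t z
  proof (rule ccontr)
    assume "\<not> t \<ge> s"
    then have ts: "0 < t / s" "t / s < 1" using that by auto
    have "c + t *\<^sub>R (z - c) = c + (t / s) *\<^sub>R ((c + s *\<^sub>R (z - c)) - c)" using that by simp
    then have "c + t *\<^sub>R (z - c) \<in> pyr \<rho>" unfolding pyr_eq[OF \<rho>(1)] using ts z by blast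
    then have "c + t *\<^sub>R (z - c) \<in> K" using pyr_subset \<rho> by blast
    then show False using face_subset_frontier[OF \<rho>(2) z(2)] frontier_notin by blast
  qed
  show ?thesis
  proof (rule ccontr)
    assume "\<not> ?thesis"
    then obtain z where z: "z \<in> pyr \<sigma>" "z \<in> pyr \<tau>" by blast
    define s where "s = (lev \<sigma> - nrm \<sigma> \<bullet> c) / (nrm \<sigma> \<bullet> z - nrm \<sigma> \<bullet> c)"
    define t where "t = (lev \<tau> - nrm \<tau> \<bullet> c) / (nrm \<tau> \<bullet> z - nrm \<tau> \<bullet> c)"
    have pos: "0 < s" "0 < t"
      using z centre_below \<sigma> \<tau> by (auto simp: s_def t_def pyr_def shadow_def)
    have in1: "c + s *\<^sub>R (z - c) \<in> \<sigma>" and in2: "c + t *\<^sub>R (z - c) \<in> \<tau>"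
      using z by (auto simp: s_def t_def pyr_def shadow_def rad_def)
    have "s = t"
      using far[OF \<sigma> \<tau> in1 in2 pos] far[OF \<tau> \<sigma> in2 in1 pos(2,1)] by simp
    then show False using in1 in2 disj by auto
  qed
qed

lemma hits_face:
  assumes "bounded K" "q \<noteq> 0"
  obtains d \<sigma> where "\<sigma> \<in> S" "c + d *\<^sub>R q \<in> closure \<sigma>"
proof -
  have "c \<in> interior K" using star open_K by (simp add: star_shaped_wrt_def interior_open)
  from ray_to_frontier[OF assms(1) this assms(2)] obtain d where "c + d *\<^sub>R q \<in> frontier K" by blast
  then show ?thesis using frontier_K that by blast
qed

text \<open>A bounded cell cannot lie between parallel faces: a ray from the centre orthogonal to one normal
  leaves the cell through a face, and if that face had the same normal up to sign, its hyperplane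
  would contain the centre.\<close>

lemma nonparallel_normals:
  assumes K: "bounded K" and dim: "2 \<le> CARD('d)"
  obtains \<sigma> \<tau> where "\<sigma> \<in> S" "\<tau> \<in> S" "\<bar>nrm \<sigma> \<bullet> nrm \<tau>\<bar> < 1"
proof -
  have "axis undefined 1 \<noteq> (0 :: real^'d)" by (simp add: axis_eq_0_iff)
  then obtain \<sigma> where \<sigma>: "\<sigma> \<in> S" using hits_face[OF K] by metis
  obtain q where q: "q \<noteq> 0" "orthogonal (nrm \<sigma>) q"
    using orthogonal_to_vector_exists[of "nrm \<sigma>"] dim by auto
  obtain d \<tau> where \<tau>: "\<tau> \<in> S" "c + d *\<^sub>R q \<in> closure \<tau>" using hits_face[OF K q(1)] by metis
  have "\<bar>nrm \<sigma> \<bullet> nrm \<tau>\<bar> \<le> 1"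
    using Cauchy_Schwarz_ineq2[of "nrm \<sigma>" "nrm \<tau>"] norm_nrm \<sigma> \<tau> by simp
  moreover have "\<bar>nrm \<sigma> \<bullet> nrm \<tau>\<bar> \<noteq> 1"
  proof
    assume "\<bar>nrm \<sigma> \<bullet> nrm \<tau>\<bar> = 1"
    then have "nrm \<tau> = nrm \<sigma> \<or> nrm \<tau> = - nrm \<sigma>"
      using norm_cauchy_schwarz_abs_eq[of "nrm \<sigma>" "nrm \<tau>"] norm_nrm \<sigma> \<tau> by simp
    then have "nrm \<tau> \<bullet> q = 0" using q(2) by (auto simp: orthogonal_def)
    moreover have "nrm \<tau> \<bullet> (c + d *\<^sub>R q) = lev \<tau>" using face_level[OF \<tau>] .
    ultimately have "nrm \<tau> \<bullet> c = lev \<tau>" by (simp add: inner_add_right)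
    then show False using centre_below[OF \<tau>(1)] by simp
  qed
  ultimately show ?thesis using that \<sigma> \<tau> by fastforce
qed

end

section \<open>Connectivity of the mesh\<close>

lemma discretisationD:
  assumes "discretisation \<Omega> D"
  shows finite_cells: "finite (cells D)" and finite_faces: "finite (faces D)"
    and cell_props: "\<forall>K\<in>cells D. K \<noteq> {} \<and> open K \<and> connected K \<and> polytopal K \<and> K \<subseteq> \<Omega> \<and> 0 < vol K"
    and cells_disjoint: "pairwise disjnt (cells D)"
    and cells_cover: "closure \<Omega> = (\<Union>K\<in>cells D. closure K)"
    and face_props: "\<forall>\<sigma>\<in>faces D. \<sigma> \<noteq> {} \<and> connected \<sigma> \<and> \<sigma> \<subseteq> closure \<Omega>
        \<and> (\<exists>a b. a \<noteq> 0 \<and> affine hull \<sigma> = {x. a \<bullet> x = b})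
        \<and> openin (top_of_set (affine hull \<sigma>)) \<sigma>
        \<and> 0 < face_area \<sigma>"
    and faces_disjoint: "pairwise disjnt (faces D)"
    and cell_face_props: "\<forall>K\<in>cells D. cell_faces D K \<subseteq> faces D
        \<and> frontier K = (\<Union>\<sigma>\<in>cell_faces D K. closure \<sigma>)"
    and face_kinds: "\<forall>\<sigma>\<in>faces D. (\<exists>K. face_cells D \<sigma> = {K} \<and> \<sigma> \<subseteq> frontier \<Omega>)
        \<or> (\<exists>K L. K \<noteq> L \<and> face_cells D \<sigma> = {K, L})"
    and centre_props: "\<forall>K\<in>cells D. star_shaped_wrt K (pt D K)
        \<and> (\<forall>\<sigma>\<in>cell_faces D K. 0 < pt_face_dist D K \<sigma>)"
  by (insert assms[unfolded discretisation_def], (elim conjE, assumption)+)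

lemma discretisation_star_cell:
  assumes D: "discretisation \<Omega> D" and K: "K \<in> cells D"
  shows "star_cell K (pt D K) (cell_faces D K)"
proof
  have sub: "\<sigma> \<in> faces D" if "\<sigma> \<in> cell_faces D K" for \<sigma>
    using that cell_face_props[OF D] K by blast
  show "open K" "star_shaped_wrt K (pt D K)" "frontier K = (\<Union>\<sigma>\<in>cell_faces D K. closure \<sigma>)"
    using cell_props[OF D] centre_props[OF D] cell_face_props[OF D] K by simp_all
  fix \<sigma> assume \<sigma>: "\<sigma> \<in> cell_faces D K"
  show "\<sigma> \<noteq> {}" "\<exists>a b. a \<noteq> 0 \<and> affine hull \<sigma> = {x. a \<bullet> x = b}" "openin (top_of_set (affine hull \<sigma>)) \<sigma>"
    using face_props[OF D] sub[OF \<sigma>] by simp_all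
  have "0 < pt_face_dist D K \<sigma>" using centre_props[OF D] K \<sigma> by blast
  then show "pt D K \<notin> affine hull \<sigma>" by (auto simp: pt_face_dist_def)
qed

text \<open>The two cells of an interface lie on opposite sides of it, since on the same side they would overlap.\<close>

lemma interface_neighbourhood:
  assumes D: "discretisation \<Omega> D" and x: "x \<in> \<sigma>" and \<sigma>: "\<sigma> \<in> faces D"
    and cells: "face_cells D \<sigma> = {K, K'}" "K \<noteq> K'"
  obtains e where "0 < e" "ball x e \<subseteq> K \<union> K' \<union> affine hull \<sigma>"
proof -
  have K: "K \<in> cells D" "\<sigma> \<in> cell_faces D K" and K': "K' \<in> cells D" "\<sigma> \<in> cell_faces D K'"
    using cells by (auto simp: face_cells_def)
  interpret k: star_cell K "pt D K" "cell_faces D K" by (rule discretisation_star_cell[OF D K(1)])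
  interpret k': star_cell K' "pt D K'" "cell_faces D K'" by (rule discretisation_star_cell[OF D K'(1)])
  have disj: "K \<inter> K' = {}"
    using cells_disjoint[OF D] K(1) K'(1) cells(2) unfolding pairwise_def disjnt_def by blast
  obtain e where e: "0 < e" "\<And>z. z \<in> ball x e \<Longrightarrow> k.nrm \<sigma> \<bullet> z < k.lev \<sigma> \<Longrightarrow> z \<in> K"
    by (rule k.local_sides[OF K(2) x]) blast
  obtain e' where e': "0 < e'" "\<And>z. z \<in> ball x e' \<Longrightarrow> k'.nrm \<sigma> \<bullet> z < k'.lev \<sigma> \<Longrightarrow> z \<in> K'"
    by (rule k'.local_sides[OF K'(2) x]) blast
  have level: "k.nrm \<sigma> \<bullet> x = k.lev \<sigma>"
    using k.face_level[OF K(2)] x closure_subset by blast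
  have nn: "k.nrm \<sigma> \<bullet> k.nrm \<sigma> = 1" using k.norm_nrm[OF K(2)] by (simp add: dot_square_norm)
  have "k'.nrm \<sigma> = k.nrm \<sigma> \<and> k'.lev \<sigma> = k.lev \<sigma> \<or> k'.nrm \<sigma> = - k.nrm \<sigma> \<and> k'.lev \<sigma> = - k.lev \<sigma>"
    using hyperplane_unit_normal_unique[OF k.norm_nrm[OF K(2)] k'.norm_nrm[OF K'(2)]]
      k.hull_eq[OF K(2)] k'.hull_eq[OF K'(2)] by auto
  moreover have "\<not> (k'.nrm \<sigma> = k.nrm \<sigma> \<and> k'.lev \<sigma> = k.lev \<sigma>)"
  proof
    assume same: "k'.nrm \<sigma> = k.nrm \<sigma> \<and> k'.lev \<sigma> = k.lev \<sigma>"
    define z where "z = x - (min e e' / 2) *\<^sub>R k.nrm \<sigma>"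
    have "z \<in> ball x e" "z \<in> ball x e'" "k.nrm \<sigma> \<bullet> z < k.lev \<sigma>"
      using e(1) e'(1) k.norm_nrm[OF K(2)] nn level
      by (auto simp: z_def dist_norm inner_diff_right)
    then have "z \<in> K \<inter> K'" using e(2) e'(2) same by auto
    then show False using disj by blast
  qed
  ultimately have opp: "k'.nrm \<sigma> = - k.nrm \<sigma>" "k'.lev \<sigma> = - k.lev \<sigma>" by auto
  show ?thesis
  proof (rule that[of "min e e'"])
    show "ball x (min e e') \<subseteq> K \<union> K' \<union> affine hull \<sigma>"
    proof
      fix z assume z: "z \<in> ball x (min e e')"
      consider "k.nrm \<sigma> \<bullet> z < k.lev \<sigma>" | "k'.nrm \<sigma> \<bullet> z < k'.lev \<sigma>" | "k.nrm \<sigma> \<bullet> z = k.lev \<sigma>"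
        using opp by fastforce
      then show "z \<in> K \<union> K' \<union> affine hull \<sigma>"
        using z e(2) e'(2) k.hull_eq[OF K(2)] by cases auto
    qed
  qed (use e e' in auto)
qed

definition adjacency :: "('d::finite) discr \<Rightarrow> ((real^'d) set \<times> (real^'d) set) set" where
  "adjacency D = {(K, L). K \<in> cells D \<and> L \<in> cells D \<and> cell_faces D K \<inter> cell_faces D L \<noteq> {}}"

text \<open>Near a point in the relative interior of an interface there are only the two cells that share the
  interface, and these are adjacent.\<close>

lemma unrelated_cells_meet_in_rims:
  assumes D: "discretisation \<Omega> D" and \<Omega>: "open \<Omega>" and z: "z \<in> \<Omega>"
    and K: "K \<in> cells D" "z \<in> closure K" and L: "L \<in> cells D" "z \<in> closure L"
    and KL: "(K, L) \<notin> (adjacency D)\<^sup>*"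
  obtains \<sigma> where "\<sigma> \<in> faces D" "z \<in> closure \<sigma> - \<sigma>"
proof -
  interpret k: star_cell K "pt D K" "cell_faces D K" by (rule discretisation_star_cell[OF D K(1)])
  have disj: "K1 \<inter> K2 = {}" if "K1 \<in> cells D" "K2 \<in> cells D" "K1 \<noteq> K2" for K1 K2
    using cells_disjoint[OF D] that unfolding pairwise_def disjnt_def by blast
  have open_L: "open L" using cell_props[OF D] L by blast
  have "K \<noteq> L" using KL by auto
  then have "K \<inter> L = {}" using disj K L by blast
  then have "z \<notin> K"
    using open_Int_closure_eq_empty[OF k.open_K, of L] L by blast
  then have "z \<in> frontier K" using K k.open_K by (simp add: frontier_def interior_open)
  then obtain \<sigma> where \<sigma>: "\<sigma> \<in> cell_faces D K" "z \<in> closure \<sigma>" using k.frontier_K by blast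
  have \<sigma>D: "\<sigma> \<in> faces D" using cell_face_props[OF D] K \<sigma> by blast
  have "z \<notin> \<sigma>"
  proof
    assume z\<sigma>: "z \<in> \<sigma>"
    have "z \<notin> frontier \<Omega>" using z \<Omega> by (simp add: frontier_def interior_open)
    then have "\<not> (\<exists>K. face_cells D \<sigma> = {K} \<and> \<sigma> \<subseteq> frontier \<Omega>)" using z\<sigma> by blast
    then obtain K1 K2 where K12: "K1 \<noteq> K2" "face_cells D \<sigma> = {K1, K2}"
      using bspec[OF face_kinds[OF D] \<sigma>D] by (elim disjE) auto
    obtain e where e: "0 < e" "ball z e \<subseteq> K1 \<union> K2 \<union> affine hull \<sigma>"
      using interface_neighbourhood[OF D z\<sigma> \<sigma>D K12(2,1)] by blast
    have K12c: "K1 \<in> cells D" "K2 \<in> cells D" "\<sigma> \<in> cell_faces D K1" "\<sigma> \<in> cell_faces D K2"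
      using K12 by (auto simp: face_cells_def)
    have "(K, K1) \<in> adjacency D" "(K, K2) \<in> adjacency D"
      using K12c K \<sigma> by (auto simp: adjacency_def)
    then have "L \<noteq> K1" "L \<noteq> K2" using KL by auto
    then have "L \<inter> ball z e \<subseteq> affine hull \<sigma>" using e disj L K12c by blast
    moreover have "open (L \<inter> ball z e)" using open_L by auto
    ultimately have "L \<inter> ball z e \<subseteq> interior (affine hull \<sigma>)" by (rule interior_maximal)
    moreover have "k.nrm \<sigma> \<noteq> 0" using k.norm_nrm[OF \<sigma>(1)] by auto
    then have "interior (affine hull \<sigma>) = {}"
      unfolding k.hull_eq[OF \<sigma>(1)] by (rule interior_hyperplane)
    moreover have "L \<inter> ball z e \<noteq> {}"
      by (rule closure_meets_ball[OF L(2) e(1)])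
    ultimately show False by blast
  qed
  then show ?thesis using that \<sigma> \<sigma>D by blast
qed

text \<open>Otherwise the cells split into two classes without common face, and since \<open>\<Omega>\<close> is connected, their closures
  meet at a point \<open>x\<close> of \<open>\<Omega>\<close>. Near \<open>x\<close>, by \<open>rim_cone\<close>, there is a segment from a cell of one
  class to a cell of the other that avoids all rims. But along this segment the two classes have to
  meet, which they can only do in a rim.\<close>

lemma cells_connected:
  assumes D: "discretisation \<Omega> D" and \<Omega>: "open \<Omega>" "connected \<Omega>"
    and K0: "K0 \<in> cells D" and L0: "L0 \<in> cells D"
  shows "(K0, L0) \<in> (adjacency D)\<^sup>*"
proof (rule ccontr)
  assume L0_not: "(K0, L0) \<notin> (adjacency D)\<^sup>*"
  define A where "A = {L \<in> cells D. (K0, L) \<in> (adjacency D)\<^sup>*}"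
  define B where "B = cells D - A"
  define UA where "UA = (\<Union>K\<in>A. closure K)"
  define UB where "UB = (\<Union>K\<in>B. closure K)"
  have fin: "finite (cells D)" and finf: "finite (faces D)"
    and cover: "closure \<Omega> = (\<Union>K\<in>cells D. closure K)"
    and cell: "\<And>K. K \<in> cells D \<Longrightarrow> K \<noteq> {} \<and> open K \<and> K \<subseteq> \<Omega>"
    and face: "\<And>\<sigma>. \<sigma> \<in> faces D \<Longrightarrow> (\<exists>a b. a \<noteq> 0 \<and> affine hull \<sigma> = {x. a \<bullet> x = b})
        \<and> openin (top_of_set (affine hull \<sigma>)) \<sigma>"
    using finite_cells[OF D] finite_faces[OF D] cells_cover[OF D] cell_props[OF D] face_props[OF D]
    by simp_all
  have AB: "A \<subseteq> cells D" "B \<subseteq> cells D" "A \<union> B = cells D" by (auto simp: A_def B_def)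
  have unrel: "(K, L) \<notin> (adjacency D)\<^sup>*" if "K \<in> A" "L \<in> B" for K L
    using that by (auto simp: A_def B_def intro: rtrancl_trans)
  have closed: "closed UA" "closed UB"
    unfolding UA_def UB_def using fin AB by (auto intro!: closed_UN intro: finite_subset)
  have UAB: "UA \<union> UB = closure \<Omega>" unfolding UA_def UB_def cover using AB by blast
  have rims: "\<exists>\<sigma>\<in>faces D. z \<in> closure \<sigma> - \<sigma>" if "z \<in> \<Omega>" "z \<in> UA" "z \<in> UB" for z
  proof -
    from that obtain K L where "K \<in> A" "L \<in> B" "z \<in> closure K" "z \<in> closure L"
      by (auto simp: UA_def UB_def)
    then show ?thesis
      using unrelated_cells_meet_in_rims[OF D \<Omega>(1) that(1)] unrel AB by (metis subsetD)
  qed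
  have K0A: "K0 \<in> A" and L0B: "L0 \<in> B" using K0 L0 L0_not by (auto simp: A_def B_def)
  have "UA \<inter> \<Omega> \<noteq> {}" "UB \<inter> \<Omega> \<noteq> {}"
    using cell[OF K0] cell[OF L0] K0A L0B closure_subset unfolding UA_def UB_def by blast+
  moreover have "\<Omega> \<subseteq> UA \<union> UB" using UAB closure_subset by blast
  ultimately obtain x where x: "x \<in> \<Omega>" "x \<in> UA" "x \<in> UB"
    using connected_closedD[OF \<Omega>(2), of UA UB] closed by blast
  obtain e where e: "0 < e" "ball x e \<subseteq> \<Omega>" using \<Omega>(1) x(1) by (meson open_contains_ball)
  obtain K L where K: "K \<in> A" "x \<in> closure K" and L: "L \<in> B" "x \<in> closure L"
    using x by (auto simp: UA_def UB_def)
  have open_meet: "open (N \<inter> ball x e) \<and> N \<inter> ball x e \<noteq> {}" if "N \<in> cells D" "x \<in> closure N" for N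
    using cell[OF that(1)] closure_meets_ball[OF that(2) e(1)] by (simp add: open_Int)
  have avoid: "\<exists>p\<in>N. p \<notin> \<Union>F" if "open N" "N \<noteq> {}" "finite F"
    "\<And>S. S \<in> F \<Longrightarrow> closed S \<and> interior S = {}" for N and F :: "(real^'d) set set"
  proof (rule ccontr)
    assume "\<not> ?thesis"
    then have "N \<subseteq> \<Union>F" by blast
    then have "N \<subseteq> interior (\<Union>F)" using that(1) by (rule interior_maximal)
    then show False using interior_Union_closed_empty[OF that(3,4)] that(2) by blast
  qed
  have hull_thin: "closed (affine hull \<sigma>) \<and> interior (affine hull \<sigma>) = {}" if "\<sigma> \<in> faces D" for \<sigma>
    using face[OF that] by auto
  obtain p where p: "p \<in> K \<inter> ball x e" "p \<notin> \<Union>((hull) affine ` faces D)"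
    using avoid[of "K \<inter> ball x e" "(hull) affine ` faces D"] open_meet[of K] K AB finf hull_thin by blast
  define cone where "cone \<sigma> = {q. \<exists>t. t \<in> {0..1} \<and> p + t *\<^sub>R (q - p) \<in> closure \<sigma> - \<sigma>}" for \<sigma>
  have cone_thin: "closed (cone \<sigma>) \<and> interior (cone \<sigma>) = {}" if \<sigma>: "\<sigma> \<in> faces D" for \<sigma>
  proof -
    obtain a b where hull: "affine hull \<sigma> = {x. a \<bullet> x = b}" using face[OF \<sigma>] by blast
    have "p \<notin> affine hull \<sigma>" using p \<sigma> by blast
    with rim_cone[OF _ hull] face[OF \<sigma>] show ?thesis unfolding cone_def by blast
  qed
  obtain q where q: "q \<in> L \<inter> ball x e" "q \<notin> \<Union>(cone ` faces D)"
    using avoid[of "L \<inter> ball x e" "cone ` faces D"] open_meet[of L] L AB finf cone_thin by blast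
  have seg: "closed_segment p q \<subseteq> \<Omega>"
    using p(1) q(1) e(2) convex_ball[of x e] by (meson IntD2 convex_contains_segment subset_trans)
  have "p \<in> UA" "q \<in> UB" using p(1) q(1) K L closure_subset by (auto simp: UA_def UB_def)
  then have "UA \<inter> closed_segment p q \<noteq> {}" "UB \<inter> closed_segment p q \<noteq> {}" by auto
  moreover have "closed_segment p q \<subseteq> UA \<union> UB" using seg UAB closure_subset by blast
  ultimately obtain z where z: "z \<in> closed_segment p q" "z \<in> UA" "z \<in> UB"
    using connected_closedD[OF connected_segment(1), of UA UB p q] closed by blast
  then obtain \<sigma> where \<sigma>: "\<sigma> \<in> faces D" "z \<in> closure \<sigma> - \<sigma>" using rims seg by blast
  from z(1) obtain t where t: "t \<in> {0..1}" "z = p + t *\<^sub>R (q - p)"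
    by (auto simp: closed_segment_def algebra_simps)
  then have "q \<in> cone \<sigma>" using \<sigma> by (auto simp: cone_def)
  then show False using q \<sigma> by blast
qed

section \<open>The discrete gradient and coercivity of the bilinear form\<close>

lemma integrable_matrix_form:
  fixes \<Lambda> :: "real^'d::finite \<Rightarrow> real^'d^'d" and g h :: "real^'d \<Rightarrow> real^'d"
  assumes S: "S \<in> lmeasurable"
    and \<Lambda>: "\<Lambda> \<in> borel_measurable (lebesgue_on S)"
    and bnd: "AE x in lebesgue_on S. \<forall>\<xi>. norm (\<Lambda> x *v \<xi>) \<le> C * norm \<xi>"
    and g: "g \<in> borel_measurable (lebesgue_on S)" "\<And>x. norm (g x) \<le> Cg"
    and h: "h \<in> borel_measurable (lebesgue_on S)" "\<And>x. norm (h x) \<le> Ch"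
    and C: "0 \<le> C"
  shows "integrable (lebesgue_on S) (\<lambda>x. (\<Lambda> x *v g x) \<bullet> h x)"
proof -
  interpret finite_measure "lebesgue_on S" by (rule finite_measure_lebesgue_on[OF S])
  have eq: "(\<Lambda> x *v g x) \<bullet> h x =
      (\<Sum>i\<in>UNIV. (\<Sum>j\<in>UNIV. (\<Lambda> x \<bullet> axis i (axis j 1)) * (g x \<bullet> axis j 1)) * (h x \<bullet> axis i 1))" for x
    by (simp add: matrix_vector_mult_def inner_axis) (simp add: inner_vec_def)
  have meas: "(\<lambda>x. (\<Lambda> x *v g x) \<bullet> h x) \<in> borel_measurable (lebesgue_on S)"
    unfolding eq using \<Lambda> g(1) h(1) by measurable
  show ?thesis
  proof (rule integrable_const_bound[OF _ meas])
    show "AE x in lebesgue_on S. norm ((\<Lambda> x *v g x) \<bullet> h x) \<le> C * Cg * Ch"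
      using bnd
    proof eventually_elim
      case (elim x)
      have "norm ((\<Lambda> x *v g x) \<bullet> h x) \<le> norm (\<Lambda> x *v g x) * norm (h x)"
        using Cauchy_Schwarz_ineq2 by simp
      also have "\<dots> \<le> (C * Cg) * Ch"
      proof (intro mult_mono h)
        show "norm (\<Lambda> x *v g x) \<le> C * Cg"
          using elim[rule_format, of "g x"] mult_left_mono[OF g(2)[of x] C] by linarith
        show "0 \<le> C * Cg" using C g(2)[of undefined] norm_ge_zero[of "g undefined"]
          by (intro mult_nonneg_nonneg) linarith+
      qed auto
      finally show ?case by simp
    qed
  qed
qed

lemma AE_lebesgue_on_subset:
  assumes "AE x in lebesgue_on T. P x" "S \<subseteq> T" "S \<in> sets lebesgue" "T \<in> sets lebesgue"
  shows "AE x in lebesgue_on S. P x"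
  using assms by (auto simp: AE_restrict_space_iff elim: eventually_mono)

text \<open>The two vectors differ by a combination of \<open>n1\<close> and \<open>n2\<close>; testing it with the component of \<open>n1\<close>
  orthogonal to \<open>n2\<close> isolates \<open>c1\<close>.\<close>

lemma common_tangential_bound:
  fixes n1 n2 G :: "'a::real_inner"
  assumes n: "norm n1 = 1" "norm n2 = 1" and q: "\<bar>n1 \<bullet> n2\<bar> < 1"
    and g: "norm (G + c1 *\<^sub>R n1) \<le> s" "norm (G + c2 *\<^sub>R n2) \<le> s"
  shows "norm G \<le> (1 + 4 / (1 - (n1 \<bullet> n2)\<^sup>2)) * s"
proof -
  define q where "q = n1 \<bullet> n2"
  have q2: "0 < 1 - q\<^sup>2" using assms(3) by (simp add: q_def abs_square_less_1)
  have nn: "n1 \<bullet> n1 = 1" "n2 \<bullet> n2 = 1" "n2 \<bullet> n1 = q" "n1 \<bullet> n2 = q"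
    using n by (simp_all add: dot_square_norm q_def inner_commute)
  define d where "d = (G + c1 *\<^sub>R n1) - (G + c2 *\<^sub>R n2)"
  have "d \<bullet> (n1 - q *\<^sub>R n2) = c1 * (1 - q\<^sup>2)"
    using nn by (simp add: d_def inner_diff_left inner_diff_right algebra_simps power2_eq_square)
  moreover have "\<bar>d \<bullet> (n1 - q *\<^sub>R n2)\<bar> \<le> norm d * norm (n1 - q *\<^sub>R n2)"
    by (rule Cauchy_Schwarz_ineq2)
  moreover have "norm d * norm (n1 - q *\<^sub>R n2) \<le> (2 * s) * 2"
  proof (intro mult_mono)
    show "norm d \<le> 2 * s" unfolding d_def using g norm_triangle_ineq4 by (smt (verit))
    show "norm (n1 - q *\<^sub>R n2) \<le> 2"
      using norm_triangle_ineq4[of n1 "q *\<^sub>R n2"] n q by (simp add: q_def)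
    show "0 \<le> 2 * s" using g(1) norm_ge_zero order_trans by (smt (verit))
  qed auto
  ultimately have "\<bar>c1\<bar> * (1 - q\<^sup>2) \<le> 4 * s" using q2 by (simp add: abs_mult)
  then have c1: "\<bar>c1\<bar> \<le> 4 / (1 - q\<^sup>2) * s" using q2 by (simp add: field_simps)
  have "norm G \<le> norm (G + c1 *\<^sub>R n1) + norm (c1 *\<^sub>R n1)"
    using norm_triangle_ineq4[of "G + c1 *\<^sub>R n1" "c1 *\<^sub>R n1"] by simp
  also have "\<dots> \<le> s + 4 / (1 - q\<^sup>2) * s" using g c1 n by simp
  finally show ?thesis by (simp add: q_def algebra_simps)
qed

text \<open>The gradient on the pyramid over \<open>\<rho>\<close> of the vector that has increment \<open>v\<^sub>\<tau> - v\<^sub>K = 1\<close> on the face \<open>\<tau>\<close>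
  and \<open>0\<close> on the others.\<close>

definition gradient_coeff ::
    "real \<Rightarrow> ('d::finite) discr \<Rightarrow> (real^'d) set \<Rightarrow> (real^'d) set \<Rightarrow> (real^'d) set \<Rightarrow> real^'d" where
  "gradient_coeff \<eta> D K \<rho> \<tau> = (face_area \<tau> / vol K) *\<^sub>R outward_normal K \<tau>
     + (\<eta> / pt_face_dist D K \<rho> * ((if \<tau> = \<rho> then 1 else 0)
          - face_area \<tau> / vol K * (outward_normal K \<tau> \<bullet> (barycentre \<rho> - pt D K)))) *\<^sub>R outward_normal K \<rho>"

lemma pyramid_gradient_expand:
  assumes fin: "finite (cell_faces D K)" and \<rho>: "\<rho> \<in> cell_faces D K"
  shows "pyramid_gradient \<eta> D K v \<rho> =
    (\<Sum>\<tau>\<in>cell_faces D K. (fval v \<tau> - cval v K) *\<^sub>R gradient_coeff \<eta> D K \<rho> \<tau>)"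
proof -
  let ?d = "\<lambda>\<tau>. fval v \<tau> - cval v K" and ?e = "barycentre \<rho> - pt D K" and ?k = "\<eta> / pt_face_dist D K \<rho>"
  have G: "GK D K v = (\<Sum>\<tau>\<in>cell_faces D K. (?d \<tau> * (face_area \<tau> / vol K)) *\<^sub>R outward_normal K \<tau>)"
    by (simp add: GK_def scaleR_sum_right mult.commute)
  have d: "(\<Sum>\<tau>\<in>cell_faces D K. ?d \<tau> * (if \<tau> = \<rho> then 1 else 0)) = ?d \<rho>"
    using fin \<rho> by (simp add: if_distrib cong: if_cong)
  have "?d \<rho> - GK D K v \<bullet> ?e = (\<Sum>\<tau>\<in>cell_faces D K. ?d \<tau> * ((if \<tau> = \<rho> then 1 else 0)
      - face_area \<tau> / vol K * (outward_normal K \<tau> \<bullet> ?e)))"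
    unfolding G d[symmetric] inner_sum_left sum_subtractf[symmetric]
    by (intro sum.cong refl) (simp only: inner_scaleR_left right_diff_distrib mult.assoc)
  then have "?k * (?d \<rho> - GK D K v \<bullet> ?e) = (\<Sum>\<tau>\<in>cell_faces D K. ?d \<tau> * (?k * ((if \<tau> = \<rho> then 1 else 0)
      - face_area \<tau> / vol K * (outward_normal K \<tau> \<bullet> ?e))))"
    by (simp add: sum_distrib_left mult.left_commute)
  then show ?thesis
    unfolding pyramid_gradient_def gradient_coeff_def
    by (simp add: G scaleR_sum_left scaleR_add_right sum.distrib)
qed

definition gradient_field ::
    "real \<Rightarrow> ('d::finite) discr \<Rightarrow> (real^'d) set \<Rightarrow> (real^'d) set \<Rightarrow> real^'d \<Rightarrow> real^'d" where
  "gradient_field \<eta> D K \<tau> x =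
     (\<Sum>\<rho>\<in>cell_faces D K. indicator (pyramid D K \<rho>) x *\<^sub>R gradient_coeff \<eta> D K \<rho> \<tau>)"

lemma cell_gradient_expand:
  assumes fin: "finite (cell_faces D K)"
  shows "cell_gradient \<eta> D K v x =
    (\<Sum>\<tau>\<in>cell_faces D K. (fval v \<tau> - cval v K) *\<^sub>R gradient_field \<eta> D K \<tau> x)"
proof -
  have "cell_gradient \<eta> D K v x = (\<Sum>\<rho>\<in>cell_faces D K. \<Sum>\<tau>\<in>cell_faces D K.
      (fval v \<tau> - cval v K) *\<^sub>R (indicator (pyramid D K \<rho>) x *\<^sub>R gradient_coeff \<eta> D K \<rho> \<tau>))"
    unfolding cell_gradient_def
    by (intro sum.cong refl) (simp add: pyramid_gradient_expand[OF fin] scaleR_sum_right mult.commute)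
  also have "\<dots> = (\<Sum>\<tau>\<in>cell_faces D K. (fval v \<tau> - cval v K) *\<^sub>R gradient_field \<eta> D K \<tau> x)"
    unfolding gradient_field_def scaleR_sum_right by (rule sum.swap)
  finally show ?thesis .
qed

lemma norm_gradient_field: "norm (gradient_field \<eta> D K \<tau> x) \<le> (\<Sum>\<rho>\<in>cell_faces D K. norm (gradient_coeff \<eta> D K \<rho> \<tau>))"
  unfolding gradient_field_def by (rule sum_norm_le) (simp add: indicator_def)

definition aK_coeff ::
    "(real^'d \<Rightarrow> real^'d^'d) \<Rightarrow> real \<Rightarrow> ('d::finite) discr \<Rightarrow> (real^'d) set
      \<Rightarrow> (real^'d) set \<Rightarrow> (real^'d) set \<Rightarrow> real" where
  "aK_coeff \<Lambda> \<eta> D K \<rho> \<tau> =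
     (\<integral>x. (\<Lambda> x *v gradient_field \<eta> D K \<rho> x) \<bullet> gradient_field \<eta> D K \<tau> x \<partial>lebesgue_on K)"

locale diffusion_mesh =
  fixes \<Omega> :: "(real^'d::finite) set" and \<Lambda> :: "real^'d \<Rightarrow> real^'d^'d"
    and lam_min lam_max \<eta> :: real and D :: "'d discr"
  assumes dim: "2 \<le> CARD('d)"
    and open_Omega: "open \<Omega>" and bounded_Omega: "bounded \<Omega>" and connected_Omega: "connected \<Omega>"
    and Lambda_measurable: "\<Lambda> \<in> borel_measurable (lebesgue_on \<Omega>)"
    and lam_min: "0 < lam_min" and lam_max: "0 \<le> lam_max"
    and Lambda_coercive: "AE x in lebesgue_on \<Omega>. \<forall>\<xi>. lam_min * (norm \<xi>)\<^sup>2 \<le> \<xi> \<bullet> (\<Lambda> x *v \<xi>)"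
    and Lambda_bounded: "AE x in lebesgue_on \<Omega>. \<forall>\<xi>. norm (\<Lambda> x *v \<xi>) \<le> lam_max * norm \<xi>"
    and D: "discretisation \<Omega> D"
    and eta: "0 < \<eta>"
begin

lemma Omega_lmeasurable: "\<Omega> \<in> lmeasurable"
  using open_Omega bounded_Omega by (simp add: lmeasurable_open)

lemma cell:
  assumes "K \<in> cells D"
  shows cell_open: "open K" and cell_subset: "K \<subseteq> \<Omega>" and cell_bounded: "bounded K"
    and cell_lmeasurable: "K \<in> lmeasurable" and vol_pos: "0 < vol K"
    and finite_cell_faces: "finite (cell_faces D K)" and cell_faces_subset: "cell_faces D K \<subseteq> faces D"
proof -
  show op: "open K" and sub: "K \<subseteq> \<Omega>" and "0 < vol K" using cell_props[OF D] assms by auto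
  show bd: "bounded K" using bounded_subset[OF bounded_Omega sub] .
  show "K \<in> lmeasurable" using op bd by (simp add: lmeasurable_open)
  show fs: "cell_faces D K \<subseteq> faces D" using cell_face_props[OF D] assms by blast
  show "finite (cell_faces D K)" using fs finite_faces[OF D] by (rule finite_subset)
qed

lemma star: "K \<in> cells D \<Longrightarrow> star_cell K (pt D K) (cell_faces D K)"
  by (rule discretisation_star_cell[OF D])

lemma pyramid:
  assumes K: "K \<in> cells D" and \<sigma>: "\<sigma> \<in> cell_faces D K"
  shows pyramid_open: "open (pyramid D K \<sigma>)" and pyramid_subset: "pyramid D K \<sigma> \<subseteq> K"
    and pyramid_lmeasurable: "pyramid D K \<sigma> \<in> lmeasurable"
    and pyramid_vol_pos: "0 < vol (pyramid D K \<sigma>)"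
    and pyramid_disjoint: "\<tau> \<in> cell_faces D K \<Longrightarrow> \<tau> \<noteq> \<sigma> \<Longrightarrow> pyramid D K \<sigma> \<inter> pyramid D K \<tau> = {}"
proof -
  interpret star_cell K "pt D K" "cell_faces D K" by (rule star[OF K])
  have eq: "pyramid D K \<tau> = pyr \<tau>" if "\<tau> \<in> cell_faces D K" for \<tau>
    unfolding pyr_eq[OF that] pyramid_def ..
  show op: "open (pyramid D K \<sigma>)" and sub: "pyramid D K \<sigma> \<subseteq> K"
    using open_pyr pyr_subset \<sigma> by (auto simp: eq)
  have "bounded (pyramid D K \<sigma>)" using bounded_subset[OF cell_bounded[OF K] sub] .
  then show lm: "pyramid D K \<sigma> \<in> lmeasurable" using op by (simp add: lmeasurable_open)
  have "\<not> negligible (pyramid D K \<sigma>)"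
    using open_not_negligible[OF op] pyr_nonempty[OF \<sigma>] by (simp add: eq[OF \<sigma>])
  then have "vol (pyramid D K \<sigma>) \<noteq> 0" using negligible_iff_measure0[OF lm] by (simp add: vol_def)
  then show "0 < vol (pyramid D K \<sigma>)" by (simp add: vol_def zero_less_measure_iff)
  show "pyramid D K \<sigma> \<inter> pyramid D K \<tau> = {}" if \<tau>: "\<tau> \<in> cell_faces D K" "\<tau> \<noteq> \<sigma>"
  proof -
    have "\<sigma> \<in> faces D" "\<tau> \<in> faces D" using cell_faces_subset[OF K] \<sigma> \<tau> by auto
    then have "\<sigma> \<inter> \<tau> = {}" using faces_disjoint[OF D] \<tau>(2) unfolding pairwise_def disjnt_def by metis
    then show ?thesis using pyr_disjoint[OF \<sigma> \<tau>(1)] by (simp add: eq \<sigma> \<tau>)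
  qed
qed

lemma cell_gradient_on_pyramid:
  assumes K: "K \<in> cells D" and \<sigma>: "\<sigma> \<in> cell_faces D K" and x: "x \<in> pyramid D K \<sigma>"
  shows "cell_gradient \<eta> D K v x = pyramid_gradient \<eta> D K v \<sigma>"
proof -
  have "indicator (pyramid D K \<tau>) x *\<^sub>R pyramid_gradient \<eta> D K v \<tau>
      = (if \<tau> = \<sigma> then pyramid_gradient \<eta> D K v \<sigma> else 0)" if "\<tau> \<in> cell_faces D K" for \<tau>
    using pyramid_disjoint[OF K \<sigma> that] x by (auto simp: indicator_def)
  then show ?thesis
    unfolding cell_gradient_def using \<sigma> finite_cell_faces[OF K] by simp
qed

lemma Lambda_on_cell:
  assumes K: "K \<in> cells D"
  shows "\<Lambda> \<in> borel_measurable (lebesgue_on K)"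
    and "AE x in lebesgue_on K. \<forall>\<xi>. norm (\<Lambda> x *v \<xi>) \<le> lam_max * norm \<xi>"
    and "AE x in lebesgue_on K. \<forall>\<xi>. lam_min * (norm \<xi>)\<^sup>2 \<le> \<xi> \<bullet> (\<Lambda> x *v \<xi>)"
proof -
  show "\<Lambda> \<in> borel_measurable (lebesgue_on K)"
    using measurable_restrict_mono[OF Lambda_measurable cell_subset[OF K]] .
  have sets: "K \<in> sets lebesgue" "\<Omega> \<in> sets lebesgue"
    using cell_lmeasurable[OF K] Omega_lmeasurable by (auto simp: fmeasurableD)
  show "AE x in lebesgue_on K. \<forall>\<xi>. norm (\<Lambda> x *v \<xi>) \<le> lam_max * norm \<xi>"
    using Lambda_bounded cell_subset[OF K] sets by (rule AE_lebesgue_on_subset)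
  show "AE x in lebesgue_on K. \<forall>\<xi>. lam_min * (norm \<xi>)\<^sup>2 \<le> \<xi> \<bullet> (\<Lambda> x *v \<xi>)"
    using Lambda_coercive cell_subset[OF K] sets by (rule AE_lebesgue_on_subset)
qed

lemma gradient_field_measurable:
  assumes K: "K \<in> cells D"
  shows "gradient_field \<eta> D K \<tau> \<in> borel_measurable (lebesgue_on K)"
proof -
  have "(\<lambda>x. indicator (pyramid D K \<rho>) x :: real) \<in> borel_measurable (lebesgue_on K)"
    if "\<rho> \<in> cell_faces D K" for \<rho>
  proof (intro measurable_restrict_space1 borel_measurable_indicator)
    show "pyramid D K \<rho> \<in> sets lebesgue" using pyramid_lmeasurable[OF K that] by (simp add: fmeasurableD)
  qed
  then show ?thesis
    unfolding gradient_field_def by (intro borel_measurable_sum borel_measurable_scaleR) auto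
qed

lemma aK_coeff_integrable:
  assumes K: "K \<in> cells D"
  shows "integrable (lebesgue_on K) (\<lambda>x. (\<Lambda> x *v gradient_field \<eta> D K \<rho> x) \<bullet> gradient_field \<eta> D K \<tau> x)"
  by (rule integrable_matrix_form[OF cell_lmeasurable[OF K] Lambda_on_cell(1,2)[OF K]
        gradient_field_measurable[OF K] norm_gradient_field gradient_field_measurable[OF K]
        norm_gradient_field lam_max])

lemma aK_integrand_expand:
  assumes K: "K \<in> cells D"
  shows "(\<Lambda> x *v cell_gradient \<eta> D K u x) \<bullet> cell_gradient \<eta> D K v x =
    (\<Sum>\<rho>\<in>cell_faces D K. \<Sum>\<tau>\<in>cell_faces D K. (fval u \<rho> - cval u K) * (fval v \<tau> - cval v K) *
       ((\<Lambda> x *v gradient_field \<eta> D K \<rho> x) \<bullet> gradient_field \<eta> D K \<tau> x))"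
proof -
  have "\<Lambda> x *v cell_gradient \<eta> D K u x
      = (\<Sum>\<rho>\<in>cell_faces D K. (fval u \<rho> - cval u K) *\<^sub>R (\<Lambda> x *v gradient_field \<eta> D K \<rho> x))"
    unfolding cell_gradient_expand[OF finite_cell_faces[OF K]]
    by (simp add: linear_sum[OF matrix_vector_mul_linear] linear_scale[OF matrix_vector_mul_linear])
  then show ?thesis
    unfolding cell_gradient_expand[OF finite_cell_faces[OF K], of \<eta> v]
    by (simp add: inner_sum_left inner_sum_right mult.assoc sum_distrib_left)
       (subst sum.swap, simp add: mult.left_commute)
qed

text \<open>The form depends on its arguments only through the increments, so it vanishes on constants and
  is continuous; the algebra of \<open>entropy_scheme\<close> is built on this expression.\<close>

lemma aK_expand:
  assumes K: "K \<in> cells D"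
  shows "aK \<Lambda> \<eta> D K u v = (\<Sum>\<rho>\<in>cell_faces D K. \<Sum>\<tau>\<in>cell_faces D K.
     aK_coeff \<Lambda> \<eta> D K \<rho> \<tau> * (fval u \<rho> - cval u K) * (fval v \<tau> - cval v K))"
proof -
  have "aK \<Lambda> \<eta> D K u v = (\<Sum>\<rho>\<in>cell_faces D K. \<Sum>\<tau>\<in>cell_faces D K.
     (fval u \<rho> - cval u K) * (fval v \<tau> - cval v K) * aK_coeff \<Lambda> \<eta> D K \<rho> \<tau>)"
    unfolding aK_def aK_integrand_expand[OF K] aK_coeff_def
    using aK_coeff_integrable[OF K]
    by (subst Bochner_Integration.integral_sum | intro sum.cong refl Bochner_Integration.integrable_sum
          integrable_mult_right integral_mult_right_zero | assumption)+
  then show ?thesis by (simp add: mult.commute mult.left_commute)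
qed

lemma aK_coercive_pyramid:
  assumes K: "K \<in> cells D" and \<sigma>: "\<sigma> \<in> cell_faces D K"
  shows "lam_min * vol (pyramid D K \<sigma>) * (norm (pyramid_gradient \<eta> D K v \<sigma>))\<^sup>2 \<le> aK \<Lambda> \<eta> D K v v"
proof -
  let ?g = "\<lambda>x. (\<Lambda> x *v cell_gradient \<eta> D K v x) \<bullet> cell_gradient \<eta> D K v x"
  let ?P = "pyramid D K \<sigma>"
  let ?k = "lam_min * (norm (pyramid_gradient \<eta> D K v \<sigma>))\<^sup>2"
  have int: "integrable (lebesgue_on K) ?g"
    unfolding aK_integrand_expand[OF K]
    by (intro Bochner_Integration.integrable_sum integrable_mult_right aK_coeff_integrable[OF K])
  have sets: "?P \<in> sets lebesgue" "K \<in> sets lebesgue"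
    using pyramid_lmeasurable[OF K \<sigma>] cell_lmeasurable[OF K] by (auto simp: fmeasurableD)
  have int': "integrable (lebesgue_on K) (\<lambda>x. ?k * indicator ?P x)"
    using sets pyramid_lmeasurable[OF K \<sigma>]
    by (intro integrable_mult_right integrable_real_indicator)
       (auto simp: sets_restrict_space_iff emeasure_restrict_space pyramid_subset[OF K \<sigma>] fmeasurable_def)
  have "?k * vol ?P = (\<integral>x. ?k * indicator ?P x \<partial>lebesgue_on K)"
    using sets pyramid_subset[OF K \<sigma>]
    by (simp add: vol_def measure_restrict_space Int_absorb2)
  also have "\<dots> \<le> integral\<^sup>L (lebesgue_on K) ?g"
  proof (rule integral_mono_AE[OF int' int])
    show "AE x in lebesgue_on K. ?k * indicator ?P x \<le> ?g x"
      using Lambda_on_cell(3)[OF K]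
    proof eventually_elim
      case (elim x)
      show ?case
      proof (cases "x \<in> ?P")
        case True
        then show ?thesis
          using elim by (simp add: cell_gradient_on_pyramid[OF K \<sigma>] inner_commute)
      next
        case False
        have "0 \<le> lam_min * (norm (cell_gradient \<eta> D K v x))\<^sup>2" using lam_min by simp
        then show ?thesis using elim False by (metis (no_types, lifting) indicator_simps(2) inner_commute mult_zero_right order_trans)
      qed
    qed
  qed
  finally show ?thesis by (simp add: aK_def algebra_simps)
qed

text \<open>The form bounds the gradient on each pyramid. The gradients on two pyramids with nonparallel normals
  bound the consistent part, and subtracting it from the gradient on the pyramid over \<open>\<sigma>\<close>
  leaves the increment.\<close>

lemma aK_coercive:
  assumes K: "K \<in> cells D" and \<sigma>: "\<sigma> \<in> cell_faces D K"
  shows "\<exists>\<kappa>>0. \<forall>v. \<kappa> * (fval v \<sigma> - cval v K)\<^sup>2 \<le> aK \<Lambda> \<eta> D K v v"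
proof -
  interpret star_cell K "pt D K" "cell_faces D K" by (rule star[OF K])
  obtain \<sigma>1 \<sigma>2 where s12: "\<sigma>1 \<in> cell_faces D K" "\<sigma>2 \<in> cell_faces D K" "\<bar>nrm \<sigma>1 \<bullet> nrm \<sigma>2\<bar> < 1"
    using nonparallel_normals[OF cell_bounded[OF K] dim] by blast
  define p where "p = lam_min * Min ((\<lambda>\<rho>. vol (pyramid D K \<rho>)) ` cell_faces D K)"
  have fin: "finite ((\<lambda>\<rho>. vol (pyramid D K \<rho>)) ` cell_faces D K)" using finite_cell_faces[OF K] by simp
  have "0 < Min ((\<lambda>\<rho>. vol (pyramid D K \<rho>)) ` cell_faces D K)"
    using fin \<sigma> pyramid_vol_pos[OF K] by (subst Min_gr_iff) auto
  then have p: "0 < p" using lam_min by (simp add: p_def)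
  have grad: "norm (pyramid_gradient \<eta> D K v \<rho>) \<le> sqrt (aK \<Lambda> \<eta> D K v v / p)" if "\<rho> \<in> cell_faces D K" for v \<rho>
  proof -
    have "p * (norm (pyramid_gradient \<eta> D K v \<rho>))\<^sup>2
        \<le> lam_min * vol (pyramid D K \<rho>) * (norm (pyramid_gradient \<eta> D K v \<rho>))\<^sup>2"
      unfolding p_def using fin that lam_min by (intro mult_right_mono mult_left_mono Min_le) auto
    also have "\<dots> \<le> aK \<Lambda> \<eta> D K v v" by (rule aK_coercive_pyramid[OF K that])
    finally have "(norm (pyramid_gradient \<eta> D K v \<rho>))\<^sup>2 \<le> aK \<Lambda> \<eta> D K v v / p"
      using p by (simp add: field_simps)
    then show ?thesis by (rule real_le_rsqrt)
  qed
  have N: "outward_normal K \<rho> = nrm \<rho>" "norm (nrm \<rho>) = 1" if "\<rho> \<in> cell_faces D K" for \<rho>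
    using outward_normal_eq[OF that] norm_nrm[OF that] by auto
  \<comment> \<open>\<open>C1\<close> times the largest pyramid gradient bounds the consistent part, \<open>C2\<close> times it the increment.\<close>
  define C1 where "C1 = 1 + 4 / (1 - (nrm \<sigma>1 \<bullet> nrm \<sigma>2)\<^sup>2)"
  have C1: "0 < C1" using s12(3) unfolding C1_def
    by (intro add_pos_nonneg divide_nonneg_nonneg) (auto simp: abs_square_le_1)
  define d where "d = pt_face_dist D K \<sigma>"
  have d: "0 < d" using centre_props[OF D] K \<sigma> by (auto simp: d_def)
  define e where "e = barycentre \<sigma> - pt D K"
  define C2 where "C2 = d / \<eta> * (1 + C1) + C1 * norm e"
  have C2: "0 < C2" unfolding C2_def using d eta C1
    by (intro add_pos_nonneg mult_pos_pos divide_pos_pos mult_nonneg_nonneg) auto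
  have "p / C2\<^sup>2 * (fval v \<sigma> - cval v K)\<^sup>2 \<le> aK \<Lambda> \<eta> D K v v" for v
  proof -
    define s where "s = sqrt (aK \<Lambda> \<eta> D K v v / p)"
    define G where "G = GK D K v"
    define \<delta> where "\<delta> = fval v \<sigma> - cval v K"
    have s0: "0 \<le> s" using grad[OF \<sigma>, of v] norm_ge_zero[of "pyramid_gradient \<eta> D K v \<sigma>"]
      unfolding s_def by linarith
    have G: "norm G \<le> C1 * s"
      unfolding C1_def
      by (rule common_tangential_bound[OF N(2)[OF s12(1)] N(2)[OF s12(2)] s12(3)])
         (use grad[OF s12(1), of v] grad[OF s12(2), of v] N(1) s12 in
           \<open>auto simp: pyramid_gradient_def G_def s_def\<close>)
    define k where "k = \<eta> / d * (\<delta> - G \<bullet> e)"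
    have g: "pyramid_gradient \<eta> D K v \<sigma> = G + k *\<^sub>R nrm \<sigma>"
      by (simp add: pyramid_gradient_def G_def k_def d_def \<delta>_def e_def N(1)[OF \<sigma>])
    have "\<bar>k\<bar> = norm (k *\<^sub>R nrm \<sigma>)" using N(2)[OF \<sigma>] by simp
    also have "\<dots> \<le> norm (G + k *\<^sub>R nrm \<sigma>) + norm G"
      using norm_triangle_ineq4[of "G + k *\<^sub>R nrm \<sigma>" G] by simp
    also have "\<dots> \<le> s + C1 * s" using grad[OF \<sigma>, of v] G g by (simp add: s_def)
    finally have k: "\<bar>k\<bar> \<le> (1 + C1) * s" by (simp add: algebra_simps)
    have "\<delta> = d / \<eta> * k + G \<bullet> e" using d eta by (simp add: k_def)
    then have "\<bar>\<delta>\<bar> \<le> d / \<eta> * \<bar>k\<bar> + \<bar>G \<bullet> e\<bar>"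
      using d eta abs_triangle_ineq[of "d / \<eta> * k" "G \<bullet> e"] by (simp add: abs_mult)
    also have "\<dots> \<le> d / \<eta> * ((1 + C1) * s) + (C1 * s) * norm e"
    proof (intro add_mono mult_left_mono k)
      have "\<bar>G \<bullet> e\<bar> \<le> norm G * norm e" by (rule Cauchy_Schwarz_ineq2)
      also have "\<dots> \<le> (C1 * s) * norm e" by (intro mult_right_mono G) auto
      finally show "\<bar>G \<bullet> e\<bar> \<le> (C1 * s) * norm e" .
    qed (use d eta in auto)
    also have "\<dots> = C2 * s" using eta by (simp add: C2_def field_simps)
    finally have "\<bar>\<delta>\<bar>\<^sup>2 \<le> (C2 * s)\<^sup>2" by (intro power_mono) auto
    moreover have "0 \<le> aK \<Lambda> \<eta> D K v v / p"
      using s0 by (simp add: s_def)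
    ultimately have "\<delta>\<^sup>2 \<le> C2\<^sup>2 * (aK \<Lambda> \<eta> D K v v / p)"
      by (simp add: power_mult_distrib s_def)
    then show ?thesis using p C2 by (simp add: \<delta>_def field_simps)
  qed
  then show ?thesis using p C2 by (intro exI[of _ "p / C2\<^sup>2"]) auto
qed

end

section \<open>Means, mobilities and averages\<close>

lemma uniform_positive_constant:
  fixes P :: "real \<Rightarrow> 'a \<Rightarrow> bool"
  assumes fin: "finite X" and ex: "\<And>x. x \<in> X \<Longrightarrow> \<exists>c>0. P c x"
    and mono: "\<And>c c' x. 0 < c' \<Longrightarrow> c' \<le> c \<Longrightarrow> P c x \<Longrightarrow> P c' x"
  obtains c where "0 < c" "\<And>x. x \<in> X \<Longrightarrow> P c x"
proof -
  have "\<exists>c>0. \<forall>x\<in>X. P c x"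
    using fin ex
  proof (induction X rule: finite_induct)
    case (insert x X)
    then obtain c1 where "0 < c1" "\<forall>x\<in>X. P c1 x" by auto
    moreover obtain c2 where "0 < c2" "P c2 x" using insert.prems[of x] by auto
    ultimately have c: "0 < c1" "\<forall>x\<in>X. P c1 x" "0 < c2" "P c2 x" by auto
    then have "0 < min c1 c2" by simp
    moreover have "\<forall>y\<in>insert x X. P (min c1 c2) y"
      using c mono[OF calculation, of c1] mono[OF calculation, of c2] by auto
    ultimately show ?case by blast
  qed (auto intro: exI[of _ 1])
  then show ?thesis using that by blast
qed

lemma admissible_mD:
  assumes "admissible_m m"
  shows m_pos: "\<forall>x>0. \<forall>y>0. 0 < m x y"
    and m_mono1: "\<forall>x>0. \<forall>x'>0. \<forall>y>0. x \<le> x' \<longrightarrow> m x y \<le> m x' y"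
    and m_mono2: "\<forall>x>0. \<forall>y>0. \<forall>y'>0. y \<le> y' \<longrightarrow> m x y \<le> m x y'"
    and m_hom: "\<forall>c>0. \<forall>x>0. \<forall>y>0. m (c * x) (c * y) = c * m x y"
    and m_log: "\<forall>x>0. \<forall>y>0. x \<noteq> y \<longrightarrow> (y - x) / (ln y - ln x) \<le> m x y \<and> m x y \<le> max x y"
  by (insert assms[unfolded admissible_m_def], (elim conjE, assumption)+)

lemma m_scale:
  assumes m: "admissible_m m" and pos: "0 < c" "0 < x" "0 < y" "0 < x'" "0 < y'"
    and le: "x \<le> c * x'" "y \<le> c * y'"
  shows "m x y \<le> c * m x' y'"
proof -
  have cpos: "0 < c * x'" "0 < c * y'" using pos by auto
  have "m x y \<le> m (c * x') y" using m_mono1[OF m] pos cpos le by blast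
  also have "\<dots> \<le> m (c * x') (c * y')" using m_mono2[OF m] pos cpos le by blast
  also have "\<dots> = c * m x' y'" using m_hom[OF m] pos by blast
  finally show ?thesis .
qed

text \<open>Continuity of \<open>m\<close> comes from monotonicity and homogeneity: the relative change of \<open>m\<close> is at most
  the largest relative change of its arguments.\<close>

lemma tendsto_m:
  assumes m: "admissible_m m" and f: "(f \<longlongrightarrow> a) F" and g: "(g \<longlongrightarrow> b) F" and pos: "0 < a" "0 < b"
  shows "((\<lambda>x. m (f x) (g x)) \<longlongrightarrow> m a b) F"
proof -
  \<comment> \<open>The largest relative change of the two arguments.\<close>
  define \<rho> where "\<rho> x = max (max (f x / a) (a / f x)) (max (g x / b) (b / g x))" for x
  have "(\<rho> \<longlongrightarrow> max (max (a / a) (a / a)) (max (b / b) (b / b))) F"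
    unfolding \<rho>_def using pos by (intro tendsto_intros f g) auto
  then have \<rho>: "(\<rho> \<longlongrightarrow> 1) F" using pos by simp
  have ev: "\<forall>\<^sub>F x in F. 0 < f x \<and> 0 < g x"
    using order_tendstoD(1)[OF f pos(1)] order_tendstoD(1)[OF g pos(2)] by eventually_elim auto
  have bounds: "m (f x) (g x) \<le> \<rho> x * m a b \<and> m a b / \<rho> x \<le> m (f x) (g x)" if x: "0 < f x \<and> 0 < g x" for x
  proof -
    have le: "f x / a \<le> \<rho> x" "a / f x \<le> \<rho> x" "g x / b \<le> \<rho> x" "b / g x \<le> \<rho> x"
      unfolding \<rho>_def by auto
    have "0 < f x / a" using x pos by simp
    then have "0 < \<rho> x" using le(1) by linarith
    then have "m (f x) (g x) \<le> \<rho> x * m a b" "m a b \<le> \<rho> x * m (f x) (g x)"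
      using le x pos by (intro m_scale[OF m]; simp add: field_simps)+
    then show ?thesis using \<open>0 < \<rho> x\<close> by (simp add: field_simps)
  qed
  show ?thesis
  proof (rule tendsto_sandwich)
    show "\<forall>\<^sub>F x in F. m a b / \<rho> x \<le> m (f x) (g x)" "\<forall>\<^sub>F x in F. m (f x) (g x) \<le> \<rho> x * m a b"
      using ev bounds by (auto elim: eventually_mono)
    show "((\<lambda>x. m a b / \<rho> x) \<longlongrightarrow> m a b) F" "((\<lambda>x. \<rho> x * m a b) \<longlongrightarrow> m a b) F"
      using tendsto_divide[OF tendsto_const \<rho>, of "m a b"] tendsto_mult[OF \<rho> tendsto_const, of "m a b"]
      by simp_all
  qed
qed

lemma m_log_mean:
  assumes m: "admissible_m m"
  shows "(exp b - exp a) * (b - a) \<le> m (exp a) (exp b) * (b - a)\<^sup>2"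
proof (cases "a = b")
  case False
  have "(exp b - exp a) / (ln (exp b) - ln (exp a)) \<le> m (exp a) (exp b)"
    using m_log[OF m] False by (metis exp_gt_zero exp_inj_iff)
  then have "(exp b - exp a) / (b - a) * (b - a)\<^sup>2 \<le> m (exp a) (exp b) * (b - a)\<^sup>2"
    by (intro mult_right_mono) auto
  then show ?thesis using False by (simp add: power2_eq_square)
qed simp

lemma combination_cong:
  assumes "f = f_mean \<or> f = f_max" "\<And>i. i \<in> I \<Longrightarrow> x i = y i"
  shows "f I x = f I y"
  using assms by (auto simp: f_mean_def f_max_def cong: sum.cong image_cong)

lemma combination_lower:
  assumes f: "f = f_mean \<or> f = f_max" and I: "finite I" "i \<in> I" and x: "\<And>j. j \<in> I \<Longrightarrow> 0 \<le> x j"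
  shows "x i / real (card I) \<le> f I x"
proof -
  have "0 < card I" using I by (auto simp: card_gt_0_iff)
  then have card: "1 \<le> real (card I)" by linarith
  have "x i \<le> (\<Sum>j\<in>I. x j)" using I x by (intro member_le_sum) auto
  then have 1: "x i / real (card I) \<le> f_mean I x"
    using card by (simp add: f_mean_def divide_right_mono)
  have "x i / real (card I) \<le> x i" using card x[OF I(2)] by (simp add: divide_le_eq mult_le_cancel_left1)
  also have "x i \<le> f_max I x" unfolding f_max_def using I by (intro Max_ge) auto
  finally show ?thesis using 1 f by auto
qed

lemma continuous_on_combination:
  assumes f: "f = f_mean \<or> f = f_max" and I: "finite I" "I \<noteq> {}"
    and g: "\<And>i. i \<in> I \<Longrightarrow> continuous_on S (g i)"
  shows "continuous_on S (\<lambda>w. f I (\<lambda>i. g i w))"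
proof -
  have "continuous_on S (\<lambda>w. f_mean I (\<lambda>i. g i w))"
    unfolding f_mean_def by (intro continuous_intros g)
  moreover have "continuous_on S (\<lambda>w. f_max I (\<lambda>i. g i w))"
    using I g unfolding f_max_def
  proof (induction I rule: finite_ne_induct)
    case (insert i I)
    then show ?case by (simp add: continuous_on_max)
  qed simp
  ultimately show ?thesis using f by auto
qed

lemma integral_pos_of_pos:
  fixes g :: "real^'d::finite \<Rightarrow> real"
  assumes S: "S \<in> lmeasurable" "0 < vol S" and g: "continuous_on S g"
    and bounds: "0 < lo" "\<And>x. x \<in> S \<Longrightarrow> lo \<le> g x \<and> g x \<le> hi"
  shows "0 < (\<integral>x. g x \<partial>lebesgue_on S)"
proof -
  interpret finite_measure "lebesgue_on S" by (rule finite_measure_lebesgue_on[OF S(1)])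
  have sets: "S \<in> sets lebesgue" using S(1) by (simp add: fmeasurableD)
  have "g \<in> borel_measurable (lebesgue_on S)"
    using g sets by (rule continuous_imp_measurable_on_sets_lebesgue)
  moreover have "AE x in lebesgue_on S. norm (g x) \<le> hi"
    using bounds by (intro AE_I2) force
  ultimately have "integrable (lebesgue_on S) g" by (rule integrable_const_bound[rotated])
  then have "(\<integral>x. lo \<partial>lebesgue_on S) \<le> (\<integral>x. g x \<partial>lebesgue_on S)"
    using bounds by (intro integral_mono) auto
  moreover have "(\<integral>x. lo \<partial>lebesgue_on S) = lo * vol S"
    using sets by (simp add: vol_def measure_restrict_space)
  ultimately show ?thesis using mult_pos_pos[OF bounds(1) S(2)] by linarith
qed

text \<open>A set of infinite measure has measure \<open>0\<close> by convention, so a positive face area also says that the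
  measure of the face is finite.\<close>

lemma face_average_pos:
  fixes g :: "real^'d::finite \<Rightarrow> real"
  assumes \<sigma>: "\<sigma> \<in> sets borel" "0 < face_area \<sigma>" and g: "continuous_on \<sigma> g"
    and bounds: "0 < lo" "\<And>x. x \<in> \<sigma> \<Longrightarrow> lo \<le> g x \<and> g x \<le> hi"
  shows "0 < face_average \<sigma> g"
proof -
  let ?M = "face_measure \<sigma>"
  have sets: "sets ?M = sets borel" by (simp add: face_measure_def hyperplane_measure_def)
  have area: "0 < measure ?M \<sigma>" using \<sigma>(2) by (simp add: face_area_def)
  have "emeasure ?M \<sigma> \<noteq> \<infinity>"
  proof
    assume "emeasure ?M \<sigma> = \<infinity>"
    then show False using area by (simp add: measure_def)
  qed
  then have fin: "emeasure ?M \<sigma> < \<infinity>" by (simp add: top.not_eq_extremum)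
  have \<sigma>M: "\<sigma> \<in> sets ?M" using \<sigma> sets by simp
  have int: "integrable ?M (\<lambda>x. c * indicator \<sigma> x)" for c :: real
    using fin \<sigma>M by (intro integrable_mult_right integrable_real_indicator)
  have "(\<lambda>x. indicator \<sigma> x *\<^sub>R g x) \<in> borel_measurable borel"
    using \<sigma>(1) g by (rule borel_measurable_continuous_on_indicator)
  then have meas: "(\<lambda>x. indicator \<sigma> x *\<^sub>R g x) \<in> borel_measurable ?M"
    by (simp add: measurable_cong_sets[OF sets refl])
  have "integrable ?M (\<lambda>x. indicator \<sigma> x *\<^sub>R g x)"
    by (rule Bochner_Integration.integrable_bound[OF int[of hi] meas])
       (use bounds in \<open>force simp: indicator_def intro!: AE_I2\<close>)
  then have "(\<integral>x. lo * indicator \<sigma> x \<partial>?M) \<le> (\<integral>x. indicator \<sigma> x *\<^sub>R g x \<partial>?M)"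
    using bounds by (intro integral_mono int) (auto simp: indicator_def)
  moreover have "(\<integral>x. lo * indicator \<sigma> x \<partial>?M) = lo * measure ?M \<sigma>"
    using sets.sets_into_space[OF \<sigma>M] by (simp add: Int_absorb2)
  ultimately have "0 < (\<integral>x. indicator \<sigma> x *\<^sub>R g x \<partial>?M)"
    using mult_pos_pos[OF bounds(1) area] by linarith
  then show ?thesis
    using \<sigma>(2) by (simp add: face_average_def set_lebesgue_integral_def)
qed

lemma L2_on_integrable:
  fixes g :: "real^'d::finite \<Rightarrow> real"
  assumes "S \<in> lmeasurable" "L2_on S g"
  shows "integrable (lebesgue_on S) g"
proof -
  interpret finite_measure "lebesgue_on S" by (rule finite_measure_lebesgue_on[OF assms(1)])
  have g: "g \<in> borel_measurable (lebesgue_on S)" "integrable (lebesgue_on S) (\<lambda>x. (norm (g x))\<^sup>2)"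
    using assms(2) by (auto simp: L2_on_def)
  have "integrable (lebesgue_on S) (\<lambda>x. 1 + (norm (g x))\<^sup>2)"
    using g(2) by (intro Bochner_Integration.integrable_add) auto
  then show ?thesis
  proof (rule Bochner_Integration.integrable_bound[OF _ g(1)])
    have "norm t \<le> norm (1 + (norm t)\<^sup>2)" for t :: real
    proof -
      have "0 \<le> (norm t - 1)\<^sup>2" "0 \<le> (norm t)\<^sup>2" by auto
      then show ?thesis by (simp add: power2_eq_square algebra_simps)
    qed
    then show "AE x in lebesgue_on S. norm (g x) \<le> norm (1 + (norm (g x))\<^sup>2)" by simp
  qed
qed

section \<open>Integrals over the mesh\<close>

context diffusion_mesh
begin

lemma cells_disjointD: "K \<in> cells D \<Longrightarrow> L \<in> cells D \<Longrightarrow> K \<noteq> L \<Longrightarrow> K \<inter> L = {}"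
  using cells_disjoint[OF D] unfolding pairwise_def disjnt_def by blast

lemma cell_function_at:
  assumes "K \<in> cells D" "x \<in> K"
  shows "cell_function D v x = cval v K"
proof -
  have "cval v L * indicator L x = (if L = K then cval v K else 0)" if "L \<in> cells D" for L
    using cells_disjointD[OF that assms(1)] assms(2) by (auto simp: indicator_def)
  then show ?thesis unfolding cell_function_def using assms(1) finite_cells[OF D] by simp
qed

lemma cell_function_outside: "(\<And>K. K \<in> cells D \<Longrightarrow> x \<notin> K) \<Longrightarrow> cell_function D v x = 0"
  unfolding cell_function_def by (intro sum.neutral) auto

lemma integral_cell_function_product:
  "(\<integral>x. (cell_function D u x - cell_function D u' x) * cell_function D v x \<partial>lebesgue_on \<Omega>)
     = (\<Sum>K\<in>cells D. vol K * ((cval u K - cval u' K) * cval v K))"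
proof -
  have sets: "K \<in> sets (lebesgue_on \<Omega>) \<and> emeasure (lebesgue_on \<Omega>) K < \<infinity>
      \<and> measure (lebesgue_on \<Omega>) K = vol K \<and> K \<inter> \<Omega> = K" if K: "K \<in> cells D" for K
  proof -
    have "K \<in> sets lebesgue" "\<Omega> \<in> sets lebesgue" "emeasure lebesgue K < \<infinity>"
      using cell_lmeasurable[OF K] Omega_lmeasurable by (auto simp: fmeasurable_def)
    then show ?thesis
      using cell_subset[OF K]
      by (simp add: sets_restrict_space_iff emeasure_restrict_space measure_restrict_space vol_def Int_absorb2)
  qed
  have point: "(cell_function D u x - cell_function D u' x) * cell_function D v x
      = (\<Sum>K\<in>cells D. ((cval u K - cval u' K) * cval v K) * indicator K x)" for x
  proof (cases "\<exists>K\<in>cells D. x \<in> K")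
    case True
    then obtain K where K: "K \<in> cells D" "x \<in> K" by blast
    have "((cval u L - cval u' L) * cval v L) * indicator L x
        = (if L = K then (cval u K - cval u' K) * cval v K else 0)" if "L \<in> cells D" for L
      using cells_disjointD[OF that K(1)] K(2) by (auto simp: indicator_def)
    then show ?thesis using K finite_cells[OF D] by (simp add: cell_function_at[OF K])
  next
    case False
    then show ?thesis by (simp add: cell_function_outside indicator_def)
  qed
  have "(\<integral>x. (cell_function D u x - cell_function D u' x) * cell_function D v x \<partial>lebesgue_on \<Omega>)
     = (\<Sum>K\<in>cells D. \<integral>x. ((cval u K - cval u' K) * cval v K) * indicator K x \<partial>lebesgue_on \<Omega>)"
    unfolding point
    using sets by (intro Bochner_Integration.integral_sum integrable_mult_right integrable_real_indicator) blast+
  also have "\<dots> = (\<Sum>K\<in>cells D. vol K * ((cval u K - cval u' K) * cval v K))"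
    by (intro sum.cong refl) (simp add: sets)
  finally show ?thesis .
qed

lemma faces_negligible: "negligible (\<Union>\<sigma>\<in>faces D. closure \<sigma>)"
proof -
  have "negligible (closure \<sigma>)" if \<sigma>: "\<sigma> \<in> faces D" for \<sigma>
  proof -
    obtain a b where ab: "a \<noteq> 0" "affine hull \<sigma> = {x. a \<bullet> x = b}"
      using face_props[OF D] \<sigma> by blast
    have "closed (affine hull \<sigma>)" by simp
    then have "closure \<sigma> \<subseteq> {x. a \<bullet> x = b}"
      unfolding ab(2)[symmetric] by (intro closure_minimal hull_subset)
    then show ?thesis using negligible_hyperplane[of a b] ab(1) negligible_subset by blast
  qed
  then show ?thesis using finite_faces[OF D] by (intro negligible_Union) auto
qed

text \<open>The cells cover \<open>\<Omega>\<close> up to their frontiers, which lie in finitely many hyperplanes.\<close>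

lemma integral_eq_sum_cells:
  fixes g :: "real^'d \<Rightarrow> real"
  assumes g: "integrable (lebesgue_on \<Omega>) g"
  shows "(\<integral>x. g x \<partial>lebesgue_on \<Omega>) = (\<Sum>K\<in>cells D. \<integral>x. g x \<partial>lebesgue_on K)"
proof -
  have sets: "\<Omega> \<in> sets lebesgue" "K \<in> cells D \<Longrightarrow> K \<in> sets lebesgue" for K
    using Omega_lmeasurable cell_lmeasurable by (auto simp: fmeasurableD)
  have int\<Omega>: "integrable lebesgue (\<lambda>x. indicator \<Omega> x *\<^sub>R g x)"
    using g sets by (simp add: integrable_restrict_space)
  have intK: "integrable lebesgue (\<lambda>x. indicator K x *\<^sub>R g x)" if K: "K \<in> cells D" for K
  proof -
    have eq: "indicator K x *\<^sub>R (indicator \<Omega> x *\<^sub>R g x) = indicator K x *\<^sub>R g x" for x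
      using cell_subset[OF K] by (auto simp: indicator_def)
    show ?thesis using integrable_mult_indicator[OF sets(2)[OF K] int\<Omega>] unfolding eq .
  qed
  have split: "indicator \<Omega> x *\<^sub>R g x = (\<Sum>K\<in>cells D. indicator K x *\<^sub>R g x)"
    if x: "x \<notin> (\<Union>\<sigma>\<in>faces D. closure \<sigma>)" for x
  proof (cases "\<exists>K\<in>cells D. x \<in> K")
    case True
    then obtain K where K: "K \<in> cells D" "x \<in> K" by blast
    have "indicator L x *\<^sub>R g x = (if L = K then g x else 0)" if "L \<in> cells D" for L
      using cells_disjointD[OF that K(1)] K(2) by (auto simp: indicator_def)
    then show ?thesis using K cell_subset[OF K(1)] finite_cells[OF D] by (auto simp: indicator_def)
  next
    case False
    have "x \<notin> \<Omega>"
    proof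
      assume "x \<in> \<Omega>"
      then have "x \<in> closure \<Omega>" using closure_subset by blast
      then obtain K where K: "K \<in> cells D" "x \<in> closure K" using cells_cover[OF D] by blast
      then have "x \<in> frontier K"
        using False cell_open[OF K(1)] by (auto simp: frontier_def interior_open)
      then have "x \<in> (\<Union>\<sigma>\<in>cell_faces D K. closure \<sigma>)" using cell_face_props[OF D] K(1) by blast
      then show False using x cell_faces_subset[OF K(1)] by blast
    qed
    then show ?thesis using False by (simp add: indicator_def)
  qed
  have "(\<integral>x. g x \<partial>lebesgue_on \<Omega>) = (\<integral>x. indicator \<Omega> x *\<^sub>R g x \<partial>lebesgue)"
    using sets by (simp add: integral_restrict_space)
  also have "\<dots> = (\<integral>x. (\<Sum>K\<in>cells D. indicator K x *\<^sub>R g x) \<partial>lebesgue)"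
  proof (rule integral_cong_AE)
    have "AE x in lebesgue. x \<notin> (\<Union>\<sigma>\<in>faces D. closure \<sigma>)"
      by (rule AE_not_in[OF faces_negligible[unfolded negligible_iff_null_sets]])
    then show "AE x in lebesgue. indicator \<Omega> x *\<^sub>R g x = (\<Sum>K\<in>cells D. indicator K x *\<^sub>R g x)"
      by (rule eventually_mono) (rule split)
    show "(\<lambda>x. \<Sum>K\<in>cells D. indicator K x *\<^sub>R g x) \<in> borel_measurable lebesgue"
      using intK by (intro borel_measurable_sum borel_measurable_integrable)
  qed (use int\<Omega> in simp)
  also have "\<dots> = (\<Sum>K\<in>cells D. \<integral>x. indicator K x *\<^sub>R g x \<partial>lebesgue)"
    by (intro Bochner_Integration.integral_sum intK)
  also have "\<dots> = (\<Sum>K\<in>cells D. \<integral>x. g x \<partial>lebesgue_on K)"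
    using sets by (intro sum.cong refl) (simp add: integral_restrict_space)
  finally show ?thesis .
qed

end

section \<open>Solutions of the nonlinear scheme\<close>

locale nonlinear_scheme = diffusion_mesh \<Omega> \<Lambda> lam_min lam_max \<eta> D
  for \<Omega> :: "(real^'d::finite) set" and \<Lambda> :: "real^'d \<Rightarrow> real^'d^'d"
    and lam_min lam_max \<eta> :: real and D :: "'d discr" +
  fixes \<phi> u_in :: "real^'d \<Rightarrow> real" and M dt :: real
    and f :: "(real^'d) set set \<Rightarrow> ((real^'d) set \<Rightarrow> real) \<Rightarrow> real" and m :: "real \<Rightarrow> real \<Rightarrow> real"
  assumes phi_continuous: "continuous_on (closure \<Omega>) \<phi>"
    and dt_pos: "0 < dt"
    and f: "f = f_mean \<or> f = f_max"
    and m: "admissible_m m"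
    and u_in_L2: "L2_on \<Omega> u_in"
    and u_in_nonneg: "AE x in lebesgue_on \<Omega>. 0 \<le> u_in x"
    and mass: "(\<integral>x. u_in x \<partial>lebesgue_on \<Omega>) = M" and M_pos: "0 < M"
begin

abbreviation uinf :: "'d hybrid" where "uinf \<equiv> u_inf \<Omega> \<phi> M"

lemma weight:
  obtains lo hi where "0 < lo" "\<And>x. x \<in> closure \<Omega> \<Longrightarrow> lo \<le> exp (- \<phi> x) \<and> exp (- \<phi> x) \<le> hi"
proof -
  have "compact (closure \<Omega>)" using bounded_Omega by (simp add: compact_closure)
  then have "bounded (\<phi> ` closure \<Omega>)"
    using phi_continuous by (intro compact_imp_bounded compact_continuous_image)
  then obtain B where "\<And>x. x \<in> closure \<Omega> \<Longrightarrow> \<bar>\<phi> x\<bar> \<le> B" by (auto simp: bounded_iff)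
  then show ?thesis
    by (intro that[of "exp (- B)" "exp B"]) (auto simp: abs_le_iff minus_le_iff)
qed

lemma weight_continuous: "S \<subseteq> closure \<Omega> \<Longrightarrow> continuous_on S (\<lambda>x. exp (- \<phi> x))"
  by (intro continuous_intros continuous_on_subset[OF phi_continuous])

lemma cells_nonempty: "cells D \<noteq> {}"
proof
  assume "cells D = {}"
  then have "closure \<Omega> = {}" using cells_cover[OF D] by simp
  then have "\<Omega> = {}" using closure_subset[of \<Omega>] by blast
  moreover have "integral\<^sup>L (lebesgue_on {}) u_in = 0"
    by (simp add: integral_restrict_space)
  ultimately show False using mass M_pos by simp
qed

lemma uinf_pos: "K \<in> cells D \<Longrightarrow> 0 < cval uinf K" "\<sigma> \<in> faces D \<Longrightarrow> 0 < fval uinf \<sigma>"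
proof -
  obtain lo hi where w: "0 < lo" "\<And>x. x \<in> closure \<Omega> \<Longrightarrow> lo \<le> exp (- \<phi> x) \<and> exp (- \<phi> x) \<le> hi"
    using weight by blast
  have int: "0 < (\<integral>x. exp (- \<phi> x) \<partial>lebesgue_on S)"
    if "S \<in> lmeasurable" "0 < vol S" "S \<subseteq> closure \<Omega>" for S
    using that(1,2) weight_continuous[OF that(3)] w that(3)
    by (intro integral_pos_of_pos[where lo = lo and hi = hi]) blast+
  obtain K0 where K0: "K0 \<in> cells D" using cells_nonempty by blast
  have "vol K0 \<le> vol \<Omega>"
    unfolding vol_def using cell_subset[OF K0] cell_lmeasurable[OF K0] Omega_lmeasurable
    by (intro measure_mono_fmeasurable) (auto simp: fmeasurableD)
  then have "0 < vol \<Omega>" using vol_pos[OF K0] by linarith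
  then have c: "0 < M / (\<integral>x. exp (- \<phi> x) \<partial>lebesgue_on \<Omega>)"
    using M_pos Omega_lmeasurable closure_subset[of \<Omega>] by (intro divide_pos_pos int)
  show "0 < cval uinf K" if K: "K \<in> cells D"
  proof -
    have "K \<subseteq> closure \<Omega>" using cell_subset[OF K] closure_subset by blast
    then have "0 < (\<integral>x. exp (- \<phi> x) \<partial>lebesgue_on K)"
      using cell_lmeasurable[OF K] vol_pos[OF K] by (intro int)
    then have "0 < cell_average K (\<lambda>x. exp (- \<phi> x))"
      using vol_pos[OF K] by (simp add: cell_average_def)
    from mult_pos_pos[OF c this] show ?thesis by (simp add: u_inf_def Let_def)
  qed
  show "0 < fval uinf \<sigma>" if \<sigma>: "\<sigma> \<in> faces D"
  proof -
    have sub: "\<sigma> \<subseteq> closure \<Omega>" and area: "0 < face_area \<sigma>"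
      and op: "openin (top_of_set (affine hull \<sigma>)) \<sigma>"
      using face_props[OF D] \<sigma> by auto
    obtain T where T: "open T" "\<sigma> = affine hull \<sigma> \<inter> T" using op by (auto simp: openin_open)
    have "closed (affine hull \<sigma>)" by simp
    then have "affine hull \<sigma> \<inter> T \<in> sets borel" using T(1) by (intro sets.Int borel_closed borel_open)
    then have "\<sigma> \<in> sets borel" using T(2) by simp
    then have "0 < face_average \<sigma> (\<lambda>x. exp (- \<phi> x))"
      using area weight_continuous[OF sub] w sub
      by (intro face_average_pos[where lo = lo and hi = hi]) blast+
    from mult_pos_pos[OF c this] show ?thesis by (simp add: u_inf_def Let_def)
  qed
qed

definition from_logs :: "((real^'d) set + (real^'d) set \<Rightarrow> real) \<Rightarrow> 'd hybrid" where
  "from_logs w = \<lparr> cval = (\<lambda>K. cval uinf K * exp (w (Inl K))), fval = (\<lambda>\<sigma>. fval uinf \<sigma> * exp (w (Inr \<sigma>))) \<rparr>"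

definition mobility :: "(real^'d) set \<Rightarrow> ((real^'d) set + (real^'d) set \<Rightarrow> real) \<Rightarrow> real" where
  "mobility K w = rK f m D K (from_logs w)"

lemma mobility_continuous:
  assumes K: "K \<in> cells D" "cell_faces D K \<noteq> {}"
  shows "continuous_on UNIV (mobility K)"
proof -
  have cont: "continuous_on UNIV (\<lambda>w. m (cval uinf K * exp (w (Inl K))) (fval uinf \<sigma> * exp (w (Inr \<sigma>))))"
    if \<sigma>: "\<sigma> \<in> cell_faces D K" for \<sigma>
    unfolding continuous_on_def
  proof (intro ballI tendsto_m[OF m])
    fix w0 :: "(real^'d) set + (real^'d) set \<Rightarrow> real"
    have "continuous_on UNIV (\<lambda>w. c * exp (w i))" for c :: real and i :: "(real^'d) set + (real^'d) set"
      by (intro continuous_intros continuous_on_product_coordinates)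
    then show "((\<lambda>w. cval uinf K * exp (w (Inl K))) \<longlongrightarrow> cval uinf K * exp (w0 (Inl K))) (at w0 within UNIV)"
      "((\<lambda>w. fval uinf \<sigma> * exp (w (Inr \<sigma>))) \<longlongrightarrow> fval uinf \<sigma> * exp (w0 (Inr \<sigma>))) (at w0 within UNIV)"
      unfolding continuous_on_def by blast+
    show "0 < cval uinf K * exp (w0 (Inl K))" "0 < fval uinf \<sigma> * exp (w0 (Inr \<sigma>))"
      using uinf_pos K \<sigma> cell_faces_subset[OF K(1)] by auto
  qed
  show ?thesis
    unfolding mobility_def rK_def from_logs_def
    by (simp, intro continuous_on_combination[OF f finite_cell_faces[OF K(1)] K(2)] cont)
qed

text \<open>The mobility is at least \<open>m (u\<^sub>K, u\<^sub>\<sigma>)\<close> divided by the number of faces, whichever of the two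
  combinations is used. Homogeneity replaces \<open>u\<close> by \<open>u / u\<^sup>\<infinity> = exp w\<close>, and then \<open>m\<close> dominates the
  logarithmic mean, which turns the square \<open>(w\<^sub>\<sigma> - w\<^sub>K)\<^sup>2\<close> from coercivity into the product of differences.\<close>

lemma mobility_dissipation:
  assumes K: "K \<in> cells D" and \<sigma>: "\<sigma> \<in> cell_faces D K"
  shows "\<exists>c>0. \<forall>w. c * ((exp (w (Inr \<sigma>)) - exp (w (Inl K))) * (w (Inr \<sigma>) - w (Inl K)))
    \<le> mobility K w * (\<Sum>\<rho>\<in>cell_faces D K. \<Sum>\<tau>\<in>cell_faces D K.
         aK_coeff \<Lambda> \<eta> D K \<rho> \<tau> * (w (Inr \<rho>) - w (Inl K)) * (w (Inr \<tau>) - w (Inl K)))"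
proof -
  obtain \<kappa> where \<kappa>: "0 < \<kappa>" "\<And>v. \<kappa> * (fval v \<sigma> - cval v K)\<^sup>2 \<le> aK \<Lambda> \<eta> D K v v"
    using aK_coercive[OF K \<sigma>] by blast
  define \<delta> where "\<delta> = min (cval uinf K) (fval uinf \<sigma>)"
  have U: "0 < cval uinf K" "\<And>\<tau>. \<tau> \<in> cell_faces D K \<Longrightarrow> 0 < fval uinf \<tau>"
    using uinf_pos K cell_faces_subset[OF K] by auto
  have \<delta>: "0 < \<delta>" "\<delta> \<le> cval uinf K" "\<delta> \<le> fval uinf \<sigma>" using U \<sigma> by (auto simp: \<delta>_def)
  define k where "k = real (card (cell_faces D K))"
  have k: "0 < k" using \<sigma> finite_cell_faces[OF K] by (auto simp: k_def card_gt_0_iff)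
  have "\<delta> * \<kappa> / k * ((exp (w (Inr \<sigma>)) - exp (w (Inl K))) * (w (Inr \<sigma>) - w (Inl K)))
    \<le> mobility K w * (\<Sum>\<rho>\<in>cell_faces D K. \<Sum>\<tau>\<in>cell_faces D K.
         aK_coeff \<Lambda> \<eta> D K \<rho> \<tau> * (w (Inr \<rho>) - w (Inl K)) * (w (Inr \<tau>) - w (Inl K)))" for w
  proof -
    let ?Q = "\<Sum>\<rho>\<in>cell_faces D K. \<Sum>\<tau>\<in>cell_faces D K.
         aK_coeff \<Lambda> \<eta> D K \<rho> \<tau> * (w (Inr \<rho>) - w (Inl K)) * (w (Inr \<tau>) - w (Inl K))"
    let ?a = "w (Inl K)" and ?b = "w (Inr \<sigma>)"
    have Q: "\<kappa> * (?b - ?a)\<^sup>2 \<le> ?Q"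
      using \<kappa>(2)[of "\<lparr> cval = (\<lambda>K. w (Inl K)), fval = (\<lambda>\<sigma>. w (Inr \<sigma>)) \<rparr>"] by (simp add: aK_expand[OF K])
    have mpos: "0 < m (exp ?a) (exp ?b)" using m_pos[OF m] by simp
    have "m (exp ?a) (exp ?b) \<le> 1 / \<delta> * m (cval uinf K * exp ?a) (fval uinf \<sigma> * exp ?b)"
      using \<delta> U \<sigma> by (intro m_scale[OF m]) (auto simp: field_simps)
    then have "\<delta> * m (exp ?a) (exp ?b) \<le> m (cval uinf K * exp ?a) (fval uinf \<sigma> * exp ?b)"
      using \<delta> by (simp add: field_simps)
    then have "\<delta> * m (exp ?a) (exp ?b) / k \<le> m (cval uinf K * exp ?a) (fval uinf \<sigma> * exp ?b) / k"
      using k by (simp add: divide_right_mono)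
    also have "\<dots> \<le> mobility K w"
    proof -
      have "0 \<le> m (cval uinf K * exp ?a) (fval uinf \<tau> * exp (w (Inr \<tau>)))" if "\<tau> \<in> cell_faces D K" for \<tau>
        using m_pos[OF m] U(1) U(2)[OF that] by (simp add: less_imp_le)
      then show ?thesis
        unfolding mobility_def rK_def k_def from_logs_def
        using combination_lower[OF f finite_cell_faces[OF K] \<sigma>,
            of "\<lambda>\<tau>. m (cval uinf K * exp ?a) (fval uinf \<tau> * exp (w (Inr \<tau>)))"] by simp
    qed
    finally have r: "\<delta> * m (exp ?a) (exp ?b) / k \<le> mobility K w" .
    have "\<delta> * \<kappa> / k * ((exp ?b - exp ?a) * (?b - ?a)) \<le> \<delta> * \<kappa> / k * (m (exp ?a) (exp ?b) * (?b - ?a)\<^sup>2)"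
      using \<delta> \<kappa> k by (intro mult_left_mono m_log_mean[OF m]) auto
    also have "\<dots> = (\<delta> * m (exp ?a) (exp ?b) / k) * (\<kappa> * (?b - ?a)\<^sup>2)" by simp
    also have "\<dots> \<le> mobility K w * ?Q"
    proof (intro mult_mono r Q)
      have "0 \<le> \<delta> * m (exp ?a) (exp ?b) / k" using \<delta> mpos k by simp
      then show "0 \<le> mobility K w" using r by linarith
    qed (use \<kappa> in simp)
    finally show ?thesis .
  qed
  moreover have "0 < \<delta> * \<kappa> / k" using \<delta> \<kappa> k by simp
  ultimately show ?thesis by blast
qed

lemma cell_faces_nonempty: "K \<in> cells D \<Longrightarrow> cell_faces D K \<noteq> {}"
proof -
  assume K: "K \<in> cells D"
  interpret star_cell K "pt D K" "cell_faces D K" by (rule star[OF K])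
  show ?thesis using nonparallel_normals[OF cell_bounded[OF K] dim] by blast
qed

lemma entropy_scheme_exists:
  obtains c where "entropy_scheme (cells D) (faces D) (cell_faces D) vol (cval uinf) (aK_coeff \<Lambda> \<eta> D) mobility dt M c"
proof -
  let ?X = "SIGMA K:cells D. cell_faces D K"
  let ?P = "\<lambda>c (K, \<sigma>). \<forall>w. c * ((exp (w (Inr \<sigma>)) - exp (w (Inl K))) * (w (Inr \<sigma>) - w (Inl K)))
    \<le> mobility K w * (\<Sum>\<rho>\<in>cell_faces D K. \<Sum>\<tau>\<in>cell_faces D K.
         aK_coeff \<Lambda> \<eta> D K \<rho> \<tau> * (w (Inr \<rho>) - w (Inl K)) * (w (Inr \<tau>) - w (Inl K)))"
  obtain c where c: "0 < c" "\<And>x. x \<in> ?X \<Longrightarrow> ?P c x"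
  proof (rule uniform_positive_constant[of ?X ?P])
    show "finite ?X" using finite_cells[OF D] finite_cell_faces by auto
    show "\<exists>c>0. ?P c x" if "x \<in> ?X" for x
      using that mobility_dissipation by auto
    show "?P c' x" if "0 < c'" "c' \<le> c" "?P c x" for c c' x
    proof -
      obtain K \<sigma> where x: "x = (K, \<sigma>)" by (cases x)
      have "c' * ((exp (w (Inr \<sigma>)) - exp (w (Inl K))) * (w (Inr \<sigma>) - w (Inl K)))
          \<le> c * ((exp (w (Inr \<sigma>)) - exp (w (Inl K))) * (w (Inr \<sigma>) - w (Inl K)))" for w
        using that(2) by (intro mult_right_mono exp_diff_mult_diff_nonneg)
      then show ?thesis using that(3) unfolding x by (auto intro: order_trans)
    qed
  qed blast
  have "entropy_scheme (cells D) (faces D) (cell_faces D) vol (cval uinf) (aK_coeff \<Lambda> \<eta> D) mobility dt M c"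
  proof
    show "\<exists>K\<in>cells D. \<sigma> \<in> cell_faces D K" if "\<sigma> \<in> faces D" for \<sigma>
    proof -
      have "face_cells D \<sigma> \<noteq> {}" using bspec[OF face_kinds[OF D] that] by auto
      then show ?thesis by (auto simp: face_cells_def)
    qed
    show "(K, L) \<in> {(K, L). K \<in> cells D \<and> L \<in> cells D \<and> cell_faces D K \<inter> cell_faces D L \<noteq> {}}\<^sup>*"
      if "K \<in> cells D" "L \<in> cells D" for K L
      using cells_connected[OF D open_Omega connected_Omega that] unfolding adjacency_def .
    show "c * ((exp (w (Inr \<sigma>)) - exp (w (Inl K))) * (w (Inr \<sigma>) - w (Inl K)))
      \<le> mobility K w * (\<Sum>\<rho>\<in>cell_faces D K. \<Sum>\<tau>\<in>cell_faces D K.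
         aK_coeff \<Lambda> \<eta> D K \<rho> \<tau> * (w (Inr \<rho>) - w (Inl K)) * (w (Inr \<tau>) - w (Inl K)))"
      if "K \<in> cells D" "\<sigma> \<in> cell_faces D K" for K \<sigma> w
      using c(2)[of "(K, \<sigma>)"] that by simp
  qed (use finite_cells[OF D] finite_faces[OF D] cell_faces_subset cell_faces_nonempty vol_pos uinf_pos
        dt_pos M_pos c(1) mobility_continuous in auto)
  then show ?thesis by (rule that)
qed

definition scheme_form :: "'d hybrid \<Rightarrow> 'd hybrid \<Rightarrow> 'd hybrid \<Rightarrow> real" where
  "scheme_form u' u v = 1 / dt *
       (\<integral>x. (cell_function D u x - cell_function D u' x) * cell_function D v x \<partial>lebesgue_on \<Omega>)
     + TD \<Lambda> \<eta> f m D u (log_ratio uinf u) v"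

definition step :: "'d hybrid \<Rightarrow> 'd hybrid \<Rightarrow> bool" where
  "step u' u \<longleftrightarrow> positive_hybrid D u \<and> (\<forall>v. scheme_form u' u v = 0)"

lemma positive_solution_iff:
  "positive_solution \<Omega> \<Lambda> \<phi> u_in M dt \<eta> f m D u \<longleftrightarrow>
     (\<forall>K\<in>cells D. cval (u 0) K = cell_average K u_in) \<and> (\<forall>n. step (u n) (u (Suc n)))"
proof -
  have "(\<forall>n\<ge>1. P n (n - 1)) \<longleftrightarrow> (\<forall>n. P (Suc n) n)" for P :: "nat \<Rightarrow> nat \<Rightarrow> bool"
    by (metis Suc_le_D Suc_le_mono diff_Suc_1 le0 One_nat_def)
  from this[of "\<lambda>n k. step (u k) (u n)"] show ?thesis
    unfolding positive_solution_def step_def scheme_form_def by simp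
qed

text \<open>A positive vector solves one step of the scheme if and only if its logarithms are a zero of the
  residual of \<open>entropy_scheme\<close>. The previous state enters that residual only through its cell
  values, and these form a density of mass \<open>M\<close> at all times, which is what makes the bound independent of time.\<close>

theorem solution_and_uniform_bound:
  "(\<exists>u. positive_solution \<Omega> \<Lambda> \<phi> u_in M dt \<eta> f m D u)
    \<and> (\<exists>\<epsilon>>0. \<forall>u. positive_solution \<Omega> \<Lambda> \<phi> u_in M dt \<eta> f m D u \<longrightarrow>
          (\<forall>n\<ge>1. (\<forall>K\<in>cells D. \<epsilon> \<le> cval (u n) K) \<and> (\<forall>\<sigma>\<in>faces D. \<epsilon> \<le> fval (u n) \<sigma>)))"
proof -
  obtain c where "entropy_scheme (cells D) (faces D) (cell_faces D) vol (cval uinf) (aK_coeff \<Lambda> \<eta> D) mobility dt M c"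
    by (rule entropy_scheme_exists)
  then interpret es: entropy_scheme "cells D" "faces D" "cell_faces D" vol "cval uinf" "aK_coeff \<Lambda> \<eta> D" mobility dt M c .
  have density_cong: "es.density p = es.density q" if "\<And>K. K \<in> cells D \<Longrightarrow> p K = q K" for p q
    using that by (auto simp: es.density_def cong: sum.cong)
  have form_eq: "scheme_form u' u v = es.residual (cval u') w (case_sum (cval v) (fval v))"
    if u: "\<And>K. K \<in> cells D \<Longrightarrow> cval u K = cval uinf K * exp (w (Inl K))"
      "\<And>\<sigma>. \<sigma> \<in> faces D \<Longrightarrow> fval u \<sigma> = fval uinf \<sigma> * exp (w (Inr \<sigma>))" for u u' v w
  proof -
    have "rK f m D K u * aK \<Lambda> \<eta> D K (log_ratio uinf u) v
        = mobility K w * es.flux K w (case_sum (cval v) (fval v))" if K: "K \<in> cells D" for K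
    proof -
      have F: "\<sigma> \<in> faces D" if "\<sigma> \<in> cell_faces D K" for \<sigma> using that cell_faces_subset[OF K] by blast
      have "rK f m D K u = mobility K w"
        unfolding mobility_def rK_def from_logs_def
        by (rule combination_cong[OF f]) (simp add: u K F)
      moreover have "cval (log_ratio uinf u) K = w (Inl K)"
        using uinf_pos(1)[OF K] by (simp add: log_ratio_def u K)
      moreover have "fval (log_ratio uinf u) \<sigma> = w (Inr \<sigma>)" if "\<sigma> \<in> cell_faces D K" for \<sigma>
        using uinf_pos(2)[OF F[OF that]] by (simp add: log_ratio_def u F[OF that])
      ultimately show ?thesis
        by (simp add: aK_expand[OF K] es.flux_def cong: sum.cong)
    qed
    then show ?thesis
      unfolding scheme_form_def es.residual_def TD_def integral_cell_function_product
      by (simp add: u cong: sum.cong)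
  qed
  have step_residual: "(\<forall>v. es.residual (cval u') w v = 0) \<longleftrightarrow>
(\<forall>v. scheme_form u' u v = 0)"
    if u: "\<And>K. K \<in> cells D \<Longrightarrow> cval u K = cval uinf K * exp (w (Inl K))"
      "\<And>\<sigma>. \<sigma> \<in> faces D \<Longrightarrow> fval u \<sigma> = fval uinf \<sigma> * exp (w (Inr \<sigma>))" for u u' w
  proof -
    have surj: "\<exists>v' :: 'd hybrid. v = case_sum (cval v') (fval v')" for v :: "(real^'d) set + (real^'d) set \<Rightarrow> real"
      by (rule exI[of _ "\<lparr> cval = v \<circ> Inl, fval = v \<circ> Inr \<rparr>"]) (auto simp: fun_eq_iff split: sum.split)
    have eq: "scheme_form u' u v = es.residual (cval u') w (case_sum (cval v) (fval v))" for v
      by (rule form_eq) (simp_all add: u)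
    show ?thesis
    proof (intro iffI allI)
      fix v assume all: "\<forall>v. scheme_form u' u v = 0"
      obtain v' :: "'d hybrid" where "v = case_sum (cval v') (fval v')" using surj by blast
      then show "es.residual (cval u') w v = 0" using all eq[of v'] by simp
    qed (simp add: eq)
  qed
  have logs: "\<exists>w. (\<forall>v. es.residual (cval u') w v = 0)
      \<and> (\<forall>K\<in>cells D. cval u K = cval uinf K * exp (w (Inl K)))
      \<and> (\<forall>\<sigma>\<in>faces D. fval u \<sigma> = fval uinf \<sigma> * exp (w (Inr \<sigma>)))" if st: "step u' u" for u u'
  proof -
    define w where "w = case_sum (\<lambda>K. ln (cval u K / cval uinf K)) (\<lambda>\<sigma>. ln (fval u \<sigma> / fval uinf \<sigma>))"
    have wK: "cval u K = cval uinf K * exp (w (Inl K))" if "K \<in> cells D" for K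
      using uinf_pos(1)[OF that] st that by (simp add: w_def step_def positive_hybrid_def)
    have w\<sigma>: "fval u \<sigma> = fval uinf \<sigma> * exp (w (Inr \<sigma>))" if "\<sigma> \<in> faces D" for \<sigma>
      using uinf_pos(2)[OF that] st that by (simp add: w_def step_def positive_hybrid_def)
    show ?thesis using step_residual[where u = u and w = w, OF wK w\<sigma>] wK w\<sigma> st unfolding step_def by blast
  qed
  have step_density: "es.density (cval u)" if p: "es.density (cval u')" and st: "step u' u" for u u'
  proof -
    obtain w where w: "\<forall>v. es.residual (cval u') w v = 0"
      "\<forall>K\<in>cells D. cval u K = cval uinf K * exp (w (Inl K))"
      using logs[OF st] by blast
    then show ?thesis using es.solution_density[OF p, of w] density_cong[of "cval u"] by simp
  qed
  have step_exists: "\<exists>u. step u' u" if p: "es.density (cval u')" for u'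
  proof -
    obtain w where w: "\<And>v. es.residual (cval u') w v = 0" using es.solution_exists[OF p] by blast
    have "positive_hybrid D (from_logs w)"
      using uinf_pos by (simp add: positive_hybrid_def from_logs_def)
    then have "step u' (from_logs w)"
      unfolding step_def using step_residual[of "from_logs w" w u'] w by (simp add: from_logs_def)
    then show ?thesis by blast
  qed
  have initial: "es.density (\<lambda>K. cell_average K u_in)"
    unfolding es.density_def
  proof (intro conjI ballI)
    fix K assume K: "K \<in> cells D"
    have "AE x in lebesgue_on K. 0 \<le> u_in x"
      using u_in_nonneg cell_subset[OF K] fmeasurableD[OF cell_lmeasurable[OF K]]
        fmeasurableD[OF Omega_lmeasurable]
      by (rule AE_lebesgue_on_subset)
    then have "0 \<le> (\<integral>x. u_in x \<partial>lebesgue_on K)" by (rule integral_nonneg_AE)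
    then show "0 \<le> cell_average K u_in" using vol_pos[OF K] by (simp add: cell_average_def)
  next
    have "(\<Sum>K\<in>cells D. vol K * cell_average K u_in) = (\<Sum>K\<in>cells D. \<integral>x. u_in x \<partial>lebesgue_on K)"
      using vol_pos by (intro sum.cong refl) (simp add: cell_average_def less_imp_neq[symmetric])
    also have "\<dots> = M"
      using integral_eq_sum_cells[OF L2_on_integrable[OF Omega_lmeasurable u_in_L2]] mass by simp
    finally show "(\<Sum>K\<in>cells D. vol K * cell_average K u_in) = M" .
  qed
  show ?thesis
  proof
    define u0 :: "'d hybrid" where "u0 = \<lparr> cval = (\<lambda>K. cell_average K u_in), fval = (\<lambda>_. 0) \<rparr>"
    have "\<exists>u. \<forall>n. (es.density (cval (u n)) \<and> (n = 0 \<longrightarrow> u n = u0)) \<and> step (u n) (u (Suc n))"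
    proof (rule dependent_nat_choice)
      show "\<exists>x. es.density (cval x) \<and> (0 = 0 \<longrightarrow> x = u0)"
        using initial by (intro exI[of _ u0]) (simp add: u0_def)
      show "\<exists>y. (es.density (cval y) \<and> (Suc n = 0 \<longrightarrow> y = u0)) \<and> step x y"
        if "es.density (cval x) \<and> (n = 0 \<longrightarrow> x = u0)" for x n
        using that step_exists[of x] step_density[of x] by auto
    qed
    then obtain u where "u 0 = u0" "\<forall>n. step (u n) (u (Suc n))" by blast
    then show "\<exists>u. positive_solution \<Omega> \<Lambda> \<phi> u_in M dt \<eta> f m D u"
      unfolding positive_solution_iff by (intro exI[of _ u]) (simp add: u0_def)
  next
    obtain R where R: "0 < R" "\<And>p w. es.density p \<Longrightarrow> es.residual p w w \<le> 0 \<Longrightarrow> \<forall>i\<in>es.dofs. \<bar>w i\<bar> < R"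
      by (rule es.a_priori_bound) blast
    obtain \<epsilon>1 where \<epsilon>1: "0 < \<epsilon>1" "\<And>K. K \<in> cells D \<Longrightarrow> \<epsilon>1 \<le> cval uinf K"
      by (rule uniform_positive_constant[OF finite_cells[OF D], of "\<lambda>c K. c \<le> cval uinf K"])
         (use uinf_pos in auto)
    obtain \<epsilon>2 where \<epsilon>2: "0 < \<epsilon>2" "\<And>\<sigma>. \<sigma> \<in> faces D \<Longrightarrow> \<epsilon>2 \<le> fval uinf \<sigma>"
      by (rule uniform_positive_constant[OF finite_faces[OF D], of "\<lambda>c \<sigma>. c \<le> fval uinf \<sigma>"])
         (use uinf_pos in auto)
    define \<epsilon> where "\<epsilon> = min \<epsilon>1 \<epsilon>2 * exp (- R)"
    have "(\<forall>K\<in>cells D. \<epsilon> \<le> cval (u n) K) \<and> (\<forall>\<sigma>\<in>faces D. \<epsilon> \<le> fval (u n) \<sigma>)"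
      if sol: "positive_solution \<Omega> \<Lambda> \<phi> u_in M dt \<eta> f m D u" and n: "1 \<le> n" for u n
    proof -
      have st: "step (u k) (u (Suc k))" for k using sol unfolding positive_solution_iff by blast
      have dens: "es.density (cval (u k))" for k
      proof (induction k)
        case 0
        then show ?case
          using sol initial density_cong[of "cval (u 0)" "\<lambda>K. cell_average K u_in"]
          by (simp add: positive_solution_iff)
      next
        case (Suc k)
        then show ?case using step_density st by blast
      qed
      obtain k where k: "n = Suc k" using n by (cases n) auto
      obtain w where w: "\<forall>v. es.residual (cval (u k)) w v = 0"
        "\<forall>K\<in>cells D. cval (u n) K = cval uinf K * exp (w (Inl K))"
        "\<forall>\<sigma>\<in>faces D. fval (u n) \<sigma> = fval uinf \<sigma> * exp (w (Inr \<sigma>))"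
        using logs[OF st[of k]] k by blast
      have "\<forall>i\<in>es.dofs. \<bar>w i\<bar> < R" using R(2)[OF dens[of k], of w] w(1) by simp
      then have wR: "- R \<le> w i" if "i \<in> es.dofs" for i using that by (metis abs_less_iff less_eq_real_def minus_less_iff)
      have lower: "\<epsilon> \<le> U * exp (w i)" if "i \<in> es.dofs" "min \<epsilon>1 \<epsilon>2 \<le> U" for U i
        unfolding \<epsilon>_def using that wR[OF that(1)] \<epsilon>1(1) \<epsilon>2(1) by (intro mult_mono) auto
      show ?thesis
      proof (intro conjI ballI)
        fix K assume K: "K \<in> cells D"
        then have "\<epsilon> \<le> cval uinf K * exp (w (Inl K))"
          using \<epsilon>1(2)[OF K] by (intro lower) auto
        then show "\<epsilon> \<le> cval (u n) K" using w(2) K by simp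
      next
        fix \<sigma> assume \<sigma>: "\<sigma> \<in> faces D"
        then have "\<epsilon> \<le> fval uinf \<sigma> * exp (w (Inr \<sigma>))"
          using \<epsilon>2(2)[OF \<sigma>] by (intro lower) auto
        then show "\<epsilon> \<le> fval (u n) \<sigma>" using w(3) \<sigma> by simp
      qed
    qed
    moreover have "0 < \<epsilon>" using \<epsilon>1 \<epsilon>2 by (simp add: \<epsilon>_def)
    ultimately show "\<exists>\<epsilon>>0. \<forall>u. positive_solution \<Omega> \<Lambda> \<phi> u_in M dt \<eta> f m D u \<longrightarrow>
          (\<forall>n\<ge>1. (\<forall>K\<in>cells D. \<epsilon> \<le> cval (u n) K) \<and> (\<forall>\<sigma>\<in>faces D. \<epsilon> \<le> fval (u n) \<sigma>))"
      by blast
  qed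
qed

end

theorem theorem1:
  fixes \<Omega> :: "(real^'d) set"
    and \<Lambda> :: "real^'d \<Rightarrow> real^'d^'d"
    and \<phi> u_in :: "real^'d \<Rightarrow> real"
    and lam_min lam_max M dt \<eta> :: real
    and f :: "(real^'d) set set \<Rightarrow> ((real^'d) set \<Rightarrow> real) \<Rightarrow> real"
    and m :: "real \<Rightarrow> real \<Rightarrow> real"
    and D :: "('d::finite) discr"
  assumes dim: "CARD('d) \<in> {2, 3}"
    and Omega: "open \<Omega>" "bounded \<Omega>" "connected \<Omega>" "polytopal \<Omega>"
    and Lambda_Linf: "Linf_on \<Omega> \<Lambda>"
    and Lambda_sym: "AE x in lebesgue_on \<Omega>. transpose (\<Lambda> x) = \<Lambda> x"
    and lam: "0 < lam_min" "lam_min \<le> lam_max"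
    and Lambda_coercive: "AE x in lebesgue_on \<Omega>. \<forall>\<xi>. lam_min * (norm \<xi>)\<^sup>2 \<le> \<xi> \<bullet> (\<Lambda> x *v \<xi>)"
    and Lambda_bounded: "AE x in lebesgue_on \<Omega>. \<forall>\<xi>. norm (\<Lambda> x *v \<xi>) \<le> lam_max * norm \<xi>"
    and phi_C1: "C1_closure \<Omega> \<phi>"
    and phi_Hdiv: "Hdiv_on \<Omega> (\<lambda>x. \<Lambda> x *v gradient \<phi> x)"
    and D: "discretisation \<Omega> D"
    and dt: "0 < dt"
    and eta: "0 < \<eta>"
    and f: "f = f_mean \<or> f = f_max"
    and m: "admissible_m m"
    and u_in_L2: "L2_on \<Omega> u_in"
    and u_in_nonneg: "AE x in lebesgue_on \<Omega>. 0 \<le> u_in x"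
    and mass: "(\<integral>x. u_in x \<partial>lebesgue_on \<Omega>) = M" "0 < M"
  shows "(\<exists>u. positive_solution \<Omega> \<Lambda> \<phi> u_in M dt \<eta> f m D u)
    \<and> (\<exists>\<epsilon>>0. \<forall>u. positive_solution \<Omega> \<Lambda> \<phi> u_in M dt \<eta> f m D u \<longrightarrow>
          (\<forall>n\<ge>1. (\<forall>K\<in>cells D. \<epsilon> \<le> cval (u n) K) \<and> (\<forall>\<sigma>\<in>faces D. \<epsilon> \<le> fval (u n) \<sigma>)))"
proof -
  interpret nonlinear_scheme \<Omega> \<Lambda> lam_min lam_max \<eta> D \<phi> u_in M dt f m
  proof
    show "2 \<le> CARD('d)" using dim by auto
    show "\<Lambda> \<in> borel_measurable (lebesgue_on \<Omega>)" using Lambda_Linf by (simp add: Linf_on_def)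
    show "0 \<le> lam_max" using lam by linarith
    show "continuous_on (closure \<Omega>) \<phi>" using phi_C1 by (simp add: C1_closure_def)
  qed (fact Omega lam Lambda_coercive Lambda_bounded D dt eta f m u_in_L2 u_in_nonneg mass)+
  show ?thesis by (rule solution_and_uniform_bound)
qed


end
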